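(* Let $k$ be a field of characteristic $0$. For all dgas $(A,\phi)$ over $k$ we have $$HC^1_{dg}(A)\simeq H^0\big(\Delta_-^1HH^*_{dg}(A)\big),$$ $$HC^2_{dg}(A)\simeq H^0\big(\Delta_-^2HH^*_{dg}(A)\big)\oplus H^1\big(\Delta_-^1HH^*_{dg}(A)\big).$$
   Context: **Dgas.** A dga $(A,\phi)$ over $k$ is a unital associative graded $k$-algebra $A=\bigoplus_{m\ge 0}A^m$ with a $k$-linear map $\phi$ lowering degree by one such that $\phi^2=0$ and $\phi(xy)=\phi(x)y+(-1)^{|x|}x\phi(y)$, where $|x|$ is the degree of a homogeneous element. $(A^{\otimes n})^m$ is the total-degree-$m$ part of $A^{\otimes n}$, and $\phi^{\otimes n}$ denotes the induced differential $\phi^{\otimes n}(a_1\otimes\dots\otimes a_n)=\sum_i(-1)^{|a_1|+\dots+|a_{i-1}|}a_1\otimes\dots\otimes\phi(a_i)\otimes\dots\otimes a_n$. For $n,m\ge 0$ put $C^n(A)^m=\mathrm{Hom}_k((A^{\otimes n+1})^m,k)$. **Operators** (on homogeneous $a_i$, with $\gamma_n=|a_n|(|a_0|+\dots+|a_{n-1}|)$): - $\delta:C^n(A)^m\to C^n(A)^{m+1}$, $\delta f=(-1)^m f\circ\phi^{\otimes n+1}$. - $b:C^{n-1}(A)^m\to C^n(A)^m$, $b(f)(a_0\otimes\dots\otimes a_n)=\sum_{i=0}^{n-1}(-1)^i f(a_0\otimes\dots\otimes a_ia_{i+1}\otimes\dots\otimes a_n)+(-1)^{n+\gamma_n}f(a_na_0\otimes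 a_1\otimes\dots\otimes a_{n-1})$. - $\tau:C^n(A)^m\to C^n(A)^m$, $\tau(f)(a_0\otimes\dots\otimes a_n)=(-1)^{n+\gamma_n}f(a_n\otimes a_0\otimes\dots\otimes a_{n-1})$; $N=\sum_{i=0}^n\tau^i$ on $C^n(A)^m$. - $s:C^{n+1}(A)^m\to C^n(A)^m$, $s(f)(a_0\otimes\dots\otimes a_n)=(-1)^n f(a_0\otimes\dots\otimes a_n\otimes 1)$. - $B=Ns(\mathbf 1-\tau):C^{n+1}(A)^m\to C^n(A)^m$ (and $B=0$ on $C^0(A)^m$). **Hochschild cohomology.** $\mathcal T(EH(A))^n=\bigoplus_{p+q=n}C^p(A)^q$ with differential $b+(-1)^p\delta$ on $C^p(A)^q$; $HH^n_{dg}(A)=H^n(\mathcal T(EH(A)))$. **Cyclic cohomology.** $EC(A)$ is the tricomplex with $EC(A)^{p,q,r}=C^{q-p}(A)^r$ for $0\le p\le q$, $r\ge 0$, and $0$ otherwise. $\mathcal T(EC(A))^n=\bigoplus_{p+q+r=n}EC(A)^{p,q,r}$ has differential $b+B+(-1)^{q-p}\delta$, where $b$ raises $q$, $B$ raises $p$, $\delta$ raises $r$ by one. $HC^n_{dg}(A)=H^n(\mathcal T(EC(A)))$. **Truncation.** For a graded vector space $V$, $(\Delta_-^kV)^n=V^{k-n}$ if $n\le k$ and $0$ if $n>k$ (here $n\ge 0$). $\Delta_-^qHH^*_{dg}(A)$ is regarded as a cochain complex $HH^q_{dg}(A)\to HH^{q-1}_{dg}(A)\to\dots\to HH^0_{dg}(A)\to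 0$, with $HH^{q-n}_{dg}(A)$ in degree $n$, whose differential is induced by $B$ (which anticommutes with the differential of $\mathcal T(EH(A))$). *)

theory Defs
  imports Complex_Main "HOL-Library.Poly_Mapping" "HOL-Library.Function_Algebras" "HOL-Library.FuncSet"
begin

section \<open>Vector spaces with explicit carrier, subquotients, cohomology\<close>

text \<open>Quotient spaces are sets of cosets and do not fill a type, so vector spaces are
  passed around as records.\<close>

record ('k, 'v) vspace =
  vcarrier :: "'v set"
  vadd :: "'v \<Rightarrow> 'v \<Rightarrow> 'v"
  vzero :: "'v"
  vscale :: "'k \<Rightarrow> 'v \<Rightarrow> 'v"

definition ambient :: "('k \<Rightarrow> 'v \<Rightarrow> 'v) \<Rightarrow> 'v set \<Rightarrow> ('k, 'v::ab_group_add) vspace" where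
  "ambient s S = \<lparr>vcarrier = S, vadd = (+), vzero = 0, vscale = s\<rparr>"

definition subsp :: "('k, 'v) vspace \<Rightarrow> 'v set \<Rightarrow> ('k, 'v) vspace" where
  "subsp V S = V\<lparr>vcarrier := S\<rparr>"

definition vhom :: "('k, 'v) vspace \<Rightarrow> ('k, 'w) vspace \<Rightarrow> ('v \<Rightarrow> 'w) \<Rightarrow> bool" where
  "vhom V W h \<longleftrightarrow>
     h \<in> vcarrier V \<rightarrow> vcarrier W \<and>
     (\<forall>x\<in>vcarrier V. \<forall>y\<in>vcarrier V. h (vadd V x y) = vadd W (h x) (h y)) \<and>
     (\<forall>c. \<forall>x\<in>vcarrier V. h (vscale V c x) = vscale W c (h x))"

definition viso :: "('k, 'v) vspace \<Rightarrow> ('k, 'w) vspace \<Rightarrow> bool"  (infix "\<simeq>" 50) where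
  "V \<simeq> W \<longleftrightarrow> (\<exists>h. vhom V W h \<and> bij_betw h (vcarrier V) (vcarrier W))"

definition vsum :: "('k, 'v) vspace \<Rightarrow> ('k, 'w) vspace \<Rightarrow> ('k, 'v \<times> 'w) vspace"
    (infixr "\<oplus>\<^sub>v" 65) where
  "V \<oplus>\<^sub>v W = \<lparr>vcarrier = vcarrier V \<times> vcarrier W,
     vadd = (\<lambda>(x, y) (x', y'). (vadd V x x', vadd W y y')),
     vzero = (vzero V, vzero W),
     vscale = (\<lambda>c (x, y). (vscale V c x, vscale W c y))\<rparr>"

definition coset :: "('k, 'v) vspace \<Rightarrow> 'v set \<Rightarrow> 'v \<Rightarrow> 'v set" where
  "coset V U x = vadd V x ` U"

text \<open>The scaled coset is \<open>c x + U\<close>, not \<open>c (x + U)\<close>: the two differ for \<open>c = 0\<close>.\<close>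

definition vquotient :: "('k, 'v) vspace \<Rightarrow> 'v set \<Rightarrow> ('k, 'v set) vspace" where
  "vquotient V U = \<lparr>vcarrier = coset V U ` vcarrier V,
     vadd = (\<lambda>X Y. {vadd V x y | x y. x \<in> X \<and> y \<in> Y}),
     vzero = U,
     vscale = (\<lambda>c X. \<Union>x\<in>X. coset V U (vscale V c x))\<rparr>"

text \<open>The dual space; functionals are extended by \<open>0\<close> outside the carrier, so that two of
  them are equal iff they agree on the carrier and addition is pointwise.\<close>

definition dual :: "('k::field, 'v) vspace \<Rightarrow> ('v \<Rightarrow> 'k) set" where
  "dual V = {f.
     (\<forall>x\<in>vcarrier V. \<forall>y\<in>vcarrier V. f (vadd V x y) = f x + f y) \<and>
     (\<forall>c. \<forall>x\<in>vcarrier V. f (vscale V c x) = c * f x) \<and>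
     (\<forall>x. x \<notin> vcarrier V \<longrightarrow> f x = 0)}"

text \<open>Cochain complexes \<open>V 0 \<rightarrow> V 1 \<rightarrow> \<dots>\<close> with \<open>d n : V n \<rightarrow> V (n + 1)\<close>.\<close>

definition cocycles :: "(nat \<Rightarrow> ('k, 'v) vspace) \<Rightarrow> (nat \<Rightarrow> 'v \<Rightarrow> 'v) \<Rightarrow> nat \<Rightarrow> 'v set" where
  "cocycles V d n = {x \<in> vcarrier (V n). d n x = vzero (V (Suc n))}"

definition coboundaries :: "(nat \<Rightarrow> ('k, 'v) vspace) \<Rightarrow> (nat \<Rightarrow> 'v \<Rightarrow> 'v) \<Rightarrow> nat \<Rightarrow> 'v set" where
  "coboundaries V d n =
     (case n of 0 \<Rightarrow> {vzero (V 0)} | Suc m \<Rightarrow> d m ` vcarrier (V m))"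

definition cohomology ::
    "(nat \<Rightarrow> ('k, 'v) vspace) \<Rightarrow> (nat \<Rightarrow> 'v \<Rightarrow> 'v) \<Rightarrow> nat \<Rightarrow> ('k, 'v set) vspace" where
  "cohomology V d n = vquotient (subsp (V n) (cocycles V d n)) (coboundaries V d n)"

definition truncation :: "nat \<Rightarrow> (nat \<Rightarrow> ('k, 'v) vspace) \<Rightarrow> nat \<Rightarrow> ('k, 'v) vspace" where
  "truncation k V n = (if n \<le> k then V (k - n) else subsp (V 0) {vzero (V 0)})"

text \<open>The differential that maps \<open>e j : V j \<rightarrow> V (j - 1)\<close>, \<open>j > 0\<close>, induce on the truncation.\<close>

definition truncation_d ::
    "nat \<Rightarrow> (nat \<Rightarrow> ('k, 'v) vspace) \<Rightarrow> (nat \<Rightarrow> 'v \<Rightarrow> 'v) \<Rightarrow> nat \<Rightarrow> 'v \<Rightarrow> 'v" where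
  "truncation_d k V e n x = (if n < k then e (k - n) x else vzero (V 0))"

section \<open>The free vector space on a type\<close>

definition fscale :: "'k::field \<Rightarrow> ('b \<Rightarrow>\<^sub>0 'k) \<Rightarrow> ('b \<Rightarrow>\<^sub>0 'k)" where
  "fscale c p = Poly_Mapping.map ((*) c) p"

lemma lookup_fscale: "Poly_Mapping.lookup (fscale c p) x = c * Poly_Mapping.lookup p x"
  by (simp add: fscale_def Poly_Mapping.map.rep_eq when_def)

global_interpretation free: vector_space "fscale :: 'k::field \<Rightarrow> ('b \<Rightarrow>\<^sub>0 'k) \<Rightarrow> _"
  by unfold_locales
    (auto intro!: poly_mapping_eqI simp: lookup_fscale lookup_add algebra_simps)

abbreviation fbasis :: "'b \<Rightarrow> ('b \<Rightarrow>\<^sub>0 'k::field)" where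
  "fbasis x \<equiv> Poly_Mapping.single x 1"

section \<open>Differential graded algebras\<close>

text \<open>The sort \<open>{ring, monoid_mult}\<close> is that of unital associative rings, the zero ring
  included (which \<open>ring_1\<close> would exclude). The graded piece of degree \<open>-1\<close> is zero, whence
  \<open>phi_0\<close>.\<close>

locale dga = vector_space scale
  for scale :: "'k::field \<Rightarrow> 'a::{ring, monoid_mult} \<Rightarrow> 'a" +
  fixes A :: "nat \<Rightarrow> 'a set" and \<phi> :: "'a \<Rightarrow> 'a"
  assumes scale_mult_left: "scale c x * y = scale c (x * y)"
    and scale_mult_right: "x * scale c y = scale c (x * y)"
    and subspace_A: "subspace (A m)"
    and direct_sum_A:
      "\<exists>!c. (\<forall>m. c m \<in> A m) \<and> finite {m. c m \<noteq> 0} \<and> x = (\<Sum>m | c m \<noteq> 0. c m)"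
    and one_A: "1 \<in> A 0"
    and mult_A: "x \<in> A m \<Longrightarrow> y \<in> A n \<Longrightarrow> x * y \<in> A (m + n)"
    and linear_phi: "Vector_Spaces.linear scale scale \<phi>"
    and phi_0: "x \<in> A 0 \<Longrightarrow> \<phi> x = 0"
    and phi_Suc: "x \<in> A (Suc m) \<Longrightarrow> \<phi> x \<in> A m"
    and phi_phi: "\<phi> (\<phi> x) = 0"
    and Leibniz: "x \<in> A m \<Longrightarrow> \<phi> (x * y) = \<phi> x * y + scale ((-1) ^ m) (x * \<phi> y)"
begin

subsection \<open>Tensor powers\<close>

text \<open>The \<open>n\<close>-th tensor power is the free vector space on the lists of length \<open>n\<close> modulo the
  multilinearity relations.\<close>

definition tensor_rel :: "nat \<Rightarrow> ('a list \<Rightarrow>\<^sub>0 'k) set" where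
  "tensor_rel n = free.span
     ({fbasis (us @ (x + y) # vs) - fbasis (us @ x # vs) - fbasis (us @ y # vs)
         | us x y vs. length us + 1 + length vs = n} \<union>
      {fbasis (us @ scale c x # vs) - fscale c (fbasis (us @ x # vs))
         | us c x vs. length us + 1 + length vs = n})"

definition free_lists :: "nat \<Rightarrow> ('k, 'a list \<Rightarrow>\<^sub>0 'k) vspace" where
  "free_lists n = ambient fscale (free.span {fbasis xs | xs. length xs = n})"

definition tensor_power :: "nat \<Rightarrow> ('k, ('a list \<Rightarrow>\<^sub>0 'k) set) vspace" where
  "tensor_power n = vquotient (free_lists n) (tensor_rel n)"

definition tensor_class :: "nat \<Rightarrow> ('a list \<Rightarrow>\<^sub>0 'k) \<Rightarrow> ('a list \<Rightarrow>\<^sub>0 'k) set" where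
  "tensor_class n p = coset (free_lists n) (tensor_rel n) p"

text \<open>\<open>pure [x\<^sub>1, \<dots>, x\<^sub>n]\<close> is \<open>x\<^sub>1 \<otimes> \<dots> \<otimes> x\<^sub>n\<close>.\<close>

definition pure :: "'a list \<Rightarrow> ('a list \<Rightarrow>\<^sub>0 'k) set" where
  "pure xs = tensor_class (length xs) (fbasis xs)"

definition homogeneous :: "nat \<Rightarrow> nat \<Rightarrow> 'a list \<Rightarrow> nat list \<Rightarrow> bool" where
  "homogeneous n m xs ds \<longleftrightarrow>
     length xs = n \<and> list_all2 (\<lambda>x d. x \<in> A d) xs ds \<and> sum_list ds = m"

definition tensor_power_deg :: "nat \<Rightarrow> nat \<Rightarrow> ('k, ('a list \<Rightarrow>\<^sub>0 'k) set) vspace" where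
  "tensor_power_deg n m = subsp (tensor_power n)
     (tensor_class n ` free.span {fbasis xs | xs ds. homogeneous n m xs ds})"

text \<open>The differential of the tensor power is determined by its values on pure tensors of
  homogeneous elements.\<close>

definition phi_tensor :: "nat \<Rightarrow> ('a list \<Rightarrow>\<^sub>0 'k) set \<Rightarrow> ('a list \<Rightarrow>\<^sub>0 'k) set" where
  "phi_tensor n = (THE h. vhom (tensor_power n) (tensor_power n) h \<and>
     h \<in> extensional (vcarrier (tensor_power n)) \<and>
     (\<forall>m xs ds. homogeneous n m xs ds \<longrightarrow>
        h (pure xs) = tensor_class n
          (\<Sum>i<n. fscale ((-1) ^ sum_list (take i ds)) (fbasis (xs[i := \<phi> (xs ! i)])))))"

subsection \<open>Cochains and operators\<close>

definition C :: "nat \<Rightarrow> nat \<Rightarrow> (('a list \<Rightarrow>\<^sub>0 'k) set \<Rightarrow> 'k) set" where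
  "C n m = dual (tensor_power_deg (Suc n) m)"

text \<open>The cochain with prescribed values \<open>F [a\<^sub>0, \<dots>, a\<^sub>n] [\<bar>a\<^sub>0\<bar>, \<dots>, \<bar>a\<^sub>n\<bar>]\<close> on the pure tensors
  \<open>a\<^sub>0 \<otimes> \<dots> \<otimes> a\<^sub>n\<close> of homogeneous elements.\<close>

definition cochain :: "nat \<Rightarrow> nat \<Rightarrow> ('a list \<Rightarrow> nat list \<Rightarrow> 'k) \<Rightarrow> ('a list \<Rightarrow>\<^sub>0 'k) set \<Rightarrow> 'k" where
  "cochain n m F = (THE g. g \<in> C n m \<and>
     (\<forall>xs ds. homogeneous (Suc n) m xs ds \<longrightarrow> g (pure xs) = F xs ds))"

definition gam :: "nat list \<Rightarrow> nat" where
  "gam ds = last ds * sum_list (butlast ds)"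

text \<open>The indices \<open>n m\<close> of an operator are those of its source \<open>C n m\<close>, except for \<open>ext_s\<close> and
  \<open>ext_B\<close>, where they are those of the target and the source is \<open>C (n + 1) m\<close>.\<close>

definition del ::
    "nat \<Rightarrow> nat \<Rightarrow> (('a list \<Rightarrow>\<^sub>0 'k) set \<Rightarrow> 'k) \<Rightarrow> ('a list \<Rightarrow>\<^sub>0 'k) set \<Rightarrow> 'k" where
  "del n m f = (\<lambda>t. if t \<in> vcarrier (tensor_power_deg (Suc n) (Suc m))
     then (-1) ^ m * f (phi_tensor (Suc n) t) else 0)"

definition hoch_b ::
    "nat \<Rightarrow> nat \<Rightarrow> (('a list \<Rightarrow>\<^sub>0 'k) set \<Rightarrow> 'k) \<Rightarrow> ('a list \<Rightarrow>\<^sub>0 'k) set \<Rightarrow> 'k" where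
  "hoch_b n m f = cochain (Suc n) m (\<lambda>xs ds.
     (\<Sum>i<Suc n. (-1) ^ i * f (pure (take i xs @ (xs ! i * xs ! Suc i) # drop (i + 2) xs))) +
     (-1) ^ (Suc n + gam ds) * f (pure ((last xs * hd xs) # butlast (tl xs))))"

definition cyc ::
    "nat \<Rightarrow> nat \<Rightarrow> (('a list \<Rightarrow>\<^sub>0 'k) set \<Rightarrow> 'k) \<Rightarrow> ('a list \<Rightarrow>\<^sub>0 'k) set \<Rightarrow> 'k" where
  "cyc n m f = cochain n m (\<lambda>xs ds. (-1) ^ (n + gam ds) * f (pure (last xs # butlast xs)))"

definition cyc_N ::
    "nat \<Rightarrow> nat \<Rightarrow> (('a list \<Rightarrow>\<^sub>0 'k) set \<Rightarrow> 'k) \<Rightarrow> ('a list \<Rightarrow>\<^sub>0 'k) set \<Rightarrow> 'k" where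
  "cyc_N n m f = (\<Sum>i\<le>n. (cyc n m ^^ i) f)"

definition ext_s ::
    "nat \<Rightarrow> nat \<Rightarrow> (('a list \<Rightarrow>\<^sub>0 'k) set \<Rightarrow> 'k) \<Rightarrow> ('a list \<Rightarrow>\<^sub>0 'k) set \<Rightarrow> 'k" where
  "ext_s n m f = cochain n m (\<lambda>xs ds. (-1) ^ n * f (pure (xs @ [1])))"

definition ext_B ::
    "nat \<Rightarrow> nat \<Rightarrow> (('a list \<Rightarrow>\<^sub>0 'k) set \<Rightarrow> 'k) \<Rightarrow> ('a list \<Rightarrow>\<^sub>0 'k) set \<Rightarrow> 'k" where
  "ext_B n m f = cyc_N n m (ext_s n m (f - cyc (Suc n) m f))"

subsection \<open>Total complexes\<close>

text \<open>An element of a direct sum over an index set is a family of cochains, indexed by the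
  bidegrees \<open>(p, q)\<close> or tridegrees \<open>(p, q, r)\<close>, that is \<open>0\<close> off the index set.\<close>

definition family_space ::
    "('i \<Rightarrow> (('a list \<Rightarrow>\<^sub>0 'k) set \<Rightarrow> 'k) set) \<Rightarrow> 'i set \<Rightarrow>
     ('k, 'i \<Rightarrow> ('a list \<Rightarrow>\<^sub>0 'k) set \<Rightarrow> 'k) vspace" where
  "family_space S I = ambient (\<lambda>c F i t. c * F i t)
     {F. (\<forall>i\<in>I. F i \<in> S i) \<and> (\<forall>i. i \<notin> I \<longrightarrow> F i = 0)}"

definition TEH :: "nat \<Rightarrow> ('k, nat \<times> nat \<Rightarrow> ('a list \<Rightarrow>\<^sub>0 'k) set \<Rightarrow> 'k) vspace" where
  "TEH n = family_space (\<lambda>(p, q). C p q) {(p, q). p + q = n}"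

definition TEH_d ::
    "nat \<Rightarrow> (nat \<times> nat \<Rightarrow> ('a list \<Rightarrow>\<^sub>0 'k) set \<Rightarrow> 'k) \<Rightarrow>
     nat \<times> nat \<Rightarrow> ('a list \<Rightarrow>\<^sub>0 'k) set \<Rightarrow> 'k" where
  "TEH_d n F = (\<lambda>(p, q).
     (if p > 0 then hoch_b (p - 1) q (F (p - 1, q)) else 0) +
     (if q > 0 then (\<lambda>t. (-1) ^ p * del p (q - 1) (F (p, q - 1)) t) else 0))"

definition HH :: "nat \<Rightarrow> ('k, (nat \<times> nat \<Rightarrow> ('a list \<Rightarrow>\<^sub>0 'k) set \<Rightarrow> 'k) set) vspace" where
  "HH = cohomology TEH TEH_d"

definition TEH_B ::
    "(nat \<times> nat \<Rightarrow> ('a list \<Rightarrow>\<^sub>0 'k) set \<Rightarrow> 'k) \<Rightarrow>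
     nat \<times> nat \<Rightarrow> ('a list \<Rightarrow>\<^sub>0 'k) set \<Rightarrow> 'k" where
  "TEH_B F = (\<lambda>(p, q). ext_B p q (F (Suc p, q)))"

text \<open>The map \<open>HH n \<rightarrow> HH (n - 1)\<close>, \<open>n > 0\<close>, induced by \<open>B\<close>: it sends the class of a cocycle
  \<open>F\<close> to the class of \<open>B F\<close>.\<close>

definition HH_B ::
    "nat \<Rightarrow> (nat \<times> nat \<Rightarrow> ('a list \<Rightarrow>\<^sub>0 'k) set \<Rightarrow> 'k) set \<Rightarrow>
     (nat \<times> nat \<Rightarrow> ('a list \<Rightarrow>\<^sub>0 'k) set \<Rightarrow> 'k) set" where
  "HH_B n X = (\<Union>F\<in>X. coset (TEH (n - 1)) (coboundaries TEH TEH_d (n - 1)) (TEH_B F))"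

text \<open>\<open>H_trunc_HH q n\<close> is the cohomology in degree \<open>n\<close> of
  \<open>HH q \<rightarrow> HH (q - 1) \<rightarrow> \<dots> \<rightarrow> HH 0 \<rightarrow> 0\<close>.\<close>

definition H_trunc_HH ::
    "nat \<Rightarrow> nat \<Rightarrow> ('k, (nat \<times> nat \<Rightarrow> ('a list \<Rightarrow>\<^sub>0 'k) set \<Rightarrow> 'k) set set) vspace" where
  "H_trunc_HH q n = cohomology (truncation q HH) (truncation_d q HH HH_B) n"

definition EC :: "nat \<Rightarrow> nat \<Rightarrow> nat \<Rightarrow> (('a list \<Rightarrow>\<^sub>0 'k) set \<Rightarrow> 'k) set" where
  "EC p q r = (if p \<le> q then C (q - p) r else {0})"

definition TEC :: "nat \<Rightarrow> ('k, nat \<times> nat \<times> nat \<Rightarrow> ('a list \<Rightarrow>\<^sub>0 'k) set \<Rightarrow> 'k) vspace" where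
  "TEC n = family_space (\<lambda>(p, q, r). EC p q r) {(p, q, r). p + q + r = n}"

text \<open>The component of \<open>B\<close> from \<open>EC p p r\<close> to \<open>EC (p + 1) p r = {0}\<close> is zero; this is \<open>B = 0\<close> on
  \<open>C 0 r\<close>.\<close>

definition TEC_d ::
    "nat \<Rightarrow> (nat \<times> nat \<times> nat \<Rightarrow> ('a list \<Rightarrow>\<^sub>0 'k) set \<Rightarrow> 'k) \<Rightarrow>
     nat \<times> nat \<times> nat \<Rightarrow> ('a list \<Rightarrow>\<^sub>0 'k) set \<Rightarrow> 'k" where
  "TEC_d n G = (\<lambda>(p, q, r). if p \<le> q then
     (if p < q then hoch_b (q - 1 - p) r (G (p, q - 1, r)) else 0) +
     (if p > 0 then ext_B (q - p) r (G (p - 1, q, r)) else 0) +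
     (if r > 0 then (\<lambda>t. (-1) ^ (q - p) * del (q - p) (r - 1) (G (p, q, r - 1)) t) else 0)
   else 0)"

definition HC ::
    "nat \<Rightarrow> ('k, (nat \<times> nat \<times> nat \<Rightarrow> ('a list \<Rightarrow>\<^sub>0 'k) set \<Rightarrow> 'k) set) vspace" where
  "HC = cohomology TEC TEC_d"

end

end

theory Submission
  imports Defs
begin

text \<open>
  Let \<open>D\<close> be the differential \<open>b \<plusminus> \<delta>\<close> of the total complex of \<open>EH(A)\<close>. An element of the total
  complex of \<open>EC(A)\<close> of degree \<open>n\<close> is cut into rows according to its first index \<open>p\<close>: the row
  \<open>F\<^sub>p\<close> is an element of degree \<open>n - 2p\<close> of the total complex of \<open>EH(A)\<close>, and the differential sends
  the rows \<open>(F\<^sub>0, F\<^sub>1, \<dots>)\<close> to \<open>(D F\<^sub>0, D F\<^sub>1 + B F\<^sub>0, \<dots>)\<close> (\<open>row_TEC_d_0\<close>, \<open>row_TEC_d_Suc\<close>).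

  In degree \<open>1\<close> there is a single row. It is a cocycle iff \<open>D F = 0\<close> and \<open>B F = 0\<close>, and a coboundary iff
  \<open>F = D E\<close> with \<open>E\<close> of degree \<open>0\<close>. As nothing is divided out in \<open>HH\<^sup>0\<close>, the condition \<open>B F = 0\<close>
  says that \<open>B\<close> kills the class of \<open>F\<close> in \<open>HH\<^sup>1\<close>, whence the formula for \<open>HC\<^sup>1\<close>.

  In degree \<open>2\<close> there are two rows \<open>F\<close> and \<open>g\<close>, of degrees \<open>2\<close> and \<open>0\<close>. They form a cocycle iff
  \<open>D F = 0\<close> and \<open>D g + B F = 0\<close>, and a coboundary iff \<open>(F, g) = (D E, B E)\<close> with \<open>E\<close> of degree \<open>1\<close>.
  Hence \<open>F\<close> represents a class of \<open>HH\<^sup>2\<close> that \<open>B\<close> kills, every such class occurs, and the pairs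
  \<open>(0, g)\<close> are the cocycles \<open>g\<close> of degree \<open>0\<close>, taken modulo \<open>B\<close> of the cocycles of degree \<open>1\<close>. This is
  an exact sequence
  \<open>0 \<rightarrow> HH\<^sup>0 / B HH\<^sup>1 \<rightarrow> HC\<^sup>2 \<rightarrow> ker (B : HH\<^sup>2 \<rightarrow> HH\<^sup>1) \<rightarrow> 0\<close>
  of vector spaces, and it splits. The splitting is obtained on cocycles, from a linear section of
  \<open>(F, g) \<mapsto> F\<close> that maps first rows of coboundaries to coboundaries
  (\<open>section_adapted_to_subspace\<close>); it therefore descends to cohomology.

  Two ingredients remain. One is \<open>B D = - D B\<close> on elements of degree \<open>0\<close> and \<open>1\<close>
  (\<open>TEH_B_d_0\<close>, \<open>TEH_B_d_1\<close>). It reduces to three identities, which are checked on pure tensors with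
  at most two factors: \<open>B b = 0\<close> on \<open>C\<^sup>0(A)\<close>, and \<open>B b = - b B\<close> and \<open>B \<delta> = \<delta> B\<close> on
  the degree-\<open>0\<close> part of \<open>C\<^sup>1(A)\<close>. The other is that the operators are what their formulas say.
  A formula on pure tensors of homogeneous elements defines a cochain if it is linear in every factor
  (\<open>cochain_mem\<close>, \<open>cochain_pure\<close>), and the formula for the differential of a tensor power, whose signs
  depend on degrees, becomes multilinear in arbitrary factors when the signs are written with the
  grading involution (\<open>phi_tensor_pure\<close>).
\<close>

section \<open>Linear algebra of subquotients\<close>

lemma vcarrier_ambient [simp]: "vcarrier (ambient s S) = S"
  and vadd_ambient [simp]: "vadd (ambient s S) = (+)"
  and vzero_ambient [simp]: "vzero (ambient s S) = 0"
  and vscale_ambient [simp]: "vscale (ambient s S) = s"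
  by (simp_all add: ambient_def)

lemma vcarrier_subsp [simp]: "vcarrier (subsp V S) = S"
  and vadd_subsp [simp]: "vadd (subsp V S) = vadd V"
  and vzero_subsp [simp]: "vzero (subsp V S) = vzero V"
  and vscale_subsp [simp]: "vscale (subsp V S) = vscale V"
  by (simp_all add: subsp_def)

lemma subsp_ambient [simp]: "subsp (ambient s S) T = ambient s T"
  by (simp add: subsp_def ambient_def)

lemma coset_subsp [simp]: "coset (subsp V S) U = coset V U"
  by (simp add: coset_def fun_eq_iff)

lemma coset_ambient [simp]: "coset (ambient s S) U x = (+) x ` U"
  by (simp add: coset_def)

lemma vquotient_simps [simp]:
  "vcarrier (vquotient V U) = coset V U ` vcarrier V"
  "vadd (vquotient V U) X Y = {vadd V x y | x y. x \<in> X \<and> y \<in> Y}"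
  "vzero (vquotient V U) = U"
  "vscale (vquotient V U) c X = (\<Union>x\<in>X. coset V U (vscale V c x))"
  by (simp_all add: vquotient_def)

lemma vsum_simps [simp]:
  "vcarrier (V \<oplus>\<^sub>v W) = vcarrier V \<times> vcarrier W"
  "vadd (V \<oplus>\<^sub>v W) (x, y) (x', y') = (vadd V x x', vadd W y y')"
  "vscale (V \<oplus>\<^sub>v W) c (x, y) = (vscale V c x, vscale W c y)"
  by (simp_all add: vsum_def)

text \<open>A copy of \<open>vector_space\<close> without interpretations. Facts added to \<open>vector_space\<close> itself would be
  shadowed by their instances for real vector spaces.\<close>

locale subquotients = vector_space scale
  for scale :: "'a::field \<Rightarrow> 'b::ab_group_add \<Rightarrow> 'b"
begin

text \<open>\<open>W\<close> is the subquotient \<open>Z / (Z \<inter> K)\<close>, with projection \<open>\<pi>\<close>. Since \<open>Z\<close> and \<open>K\<close> live in an honest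
  vector space, iterated quotients, whose elements are sets of sets, can be compared by comparing
  subspaces.\<close>

definition presents ::
    "'b set \<Rightarrow> 'b set \<Rightarrow> ('a, 'w) vspace \<Rightarrow> ('b \<Rightarrow> 'w) \<Rightarrow> bool" where
  "presents Z K W \<pi> \<longleftrightarrow> subspace Z \<and> vhom (ambient scale Z) W \<pi> \<and> \<pi> ` Z = vcarrier W \<and>
     (\<forall>x\<in>Z. \<forall>y\<in>Z. \<pi> x = \<pi> y \<longleftrightarrow> x - y \<in> K)"

lemma presentsD:
  assumes "presents Z K W \<pi>"
  shows "subspace Z"
    and "x \<in> Z \<Longrightarrow> \<pi> x \<in> vcarrier W"
    and "x \<in> Z \<Longrightarrow> y \<in> Z \<Longrightarrow> \<pi> (x + y) = vadd W (\<pi> x) (\<pi> y)"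
    and "x \<in> Z \<Longrightarrow> \<pi> (scale c x) = vscale W c (\<pi> x)"
    and "vcarrier W = \<pi> ` Z"
    and "x \<in> Z \<Longrightarrow> y \<in> Z \<Longrightarrow> \<pi> x = \<pi> y \<longleftrightarrow> x - y \<in> K"
  using assms by (auto simp: presents_def vhom_def)

lemma presents_closed:
  assumes W: "presents Z K W \<pi>"
  shows "v \<in> vcarrier W \<Longrightarrow> w \<in> vcarrier W \<Longrightarrow> vadd W v w \<in> vcarrier W"
    and "v \<in> vcarrier W \<Longrightarrow> vscale W c v \<in> vcarrier W"
  unfolding presentsD(5)[OF W]
  by (auto simp: presentsD(3,4)[OF W, symmetric]
      intro!: imageI subspace_add[OF presentsD(1)[OF W]] subspace_scale[OF presentsD(1)[OF W]])

lemma presentsI: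
  assumes "subspace Z"
    and "\<And>x. x \<in> Z \<Longrightarrow> \<pi> x \<in> vcarrier W"
    and "\<And>x y. x \<in> Z \<Longrightarrow> y \<in> Z \<Longrightarrow> \<pi> (x + y) = vadd W (\<pi> x) (\<pi> y)"
    and "\<And>c x. x \<in> Z \<Longrightarrow> \<pi> (scale c x) = vscale W c (\<pi> x)"
    and "\<And>w. w \<in> vcarrier W \<Longrightarrow> \<exists>x\<in>Z. \<pi> x = w"
    and "\<And>x y. x \<in> Z \<Longrightarrow> y \<in> Z \<Longrightarrow> \<pi> x = \<pi> y \<longleftrightarrow> x - y \<in> K"
  shows "presents Z K W \<pi>"
proof -
  have "\<pi> ` Z = vcarrier W"
    using assms(2,5) by blast
  then show ?thesis
    using assms unfolding presents_def vhom_def by auto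
qed

lemma presents_ambient: "presents UNIV {0} (ambient scale UNIV) (\<lambda>x. x)"
  by (rule presentsI) auto

text \<open>Both spaces are \<open>Z / (Z \<inter> K)\<close>; the isomorphism sends \<open>\<pi> x\<close> to \<open>\<pi>' x\<close>.\<close>

lemma viso_if_presents:
  assumes W: "presents Z K W \<pi>" and W': "presents Z K W' \<pi>'"
  shows "W \<simeq> W'"
proof -
  define h where "h w = \<pi>' (SOME x. x \<in> Z \<and> \<pi> x = w)" for w
  have eq: "\<pi> x = \<pi> y \<longleftrightarrow> \<pi>' x = \<pi>' y" if "x \<in> Z" "y \<in> Z" for x y
    using presentsD(6)[OF W that] presentsD(6)[OF W' that] by simp
  have h: "h (\<pi> x) = \<pi>' x" if "x \<in> Z" for x
  proof -
    have "(SOME y. y \<in> Z \<and> \<pi> y = \<pi> x) \<in> Z \<and> \<pi> (SOME y. y \<in> Z \<and> \<pi> y = \<pi> x) = \<pi> x"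
      by (rule someI_ex) (use that in blast)
    then show ?thesis
      unfolding h_def using eq that by blast
  qed
  have sub: "subspace Z"
    by (rule presentsD(1)[OF W])
  have "vhom W W' h"
    unfolding vhom_def presentsD(5)[OF W]
  proof (intro conjI ballI allI, goal_cases)
    case 1
    then show ?case using h presentsD(2)[OF W'] by auto
  next
    case (2 x y)
    then obtain a b where ab: "a \<in> Z" "b \<in> Z" "x = \<pi> a" "y = \<pi> b" by blast
    show ?case
      unfolding ab(3,4) presentsD(3)[OF W ab(1,2), symmetric]
      using h ab(1,2) subspace_add[OF sub ab(1,2)] presentsD(3)[OF W' ab(1,2)] by simp
  next
    case (3 c x)
    then obtain a where a: "a \<in> Z" "x = \<pi> a" by blast
    show ?case
      unfolding a(2) presentsD(4)[OF W a(1), symmetric]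
      using h a(1) subspace_scale[OF sub a(1)] presentsD(4)[OF W' a(1)] by simp
  qed
  moreover have "bij_betw h (vcarrier W) (vcarrier W')"
    unfolding bij_betw_def inj_on_def presentsD(5)[OF W] presentsD(5)[OF W'] image_image
    using h eq by (auto intro!: image_cong)
  ultimately show ?thesis
    unfolding viso_def by blast
qed

text \<open>The universal property of a quotient. Linearity of the induced map is left to the applications,
  as its target varies in kind.\<close>

lemma presents_factor:
  assumes W: "presents Z K W \<pi>" and L: "\<And>x y. x \<in> Z \<Longrightarrow> y \<in> Z \<Longrightarrow> x - y \<in> K \<Longrightarrow> L x = L y"
  obtains f where "\<And>x. x \<in> Z \<Longrightarrow> f (\<pi> x) = L x"
proof
  fix x assume x: "x \<in> Z"
  define y where "y = (SOME y. y \<in> Z \<and> \<pi> y = \<pi> x)"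
  have "y \<in> Z \<and> \<pi> y = \<pi> x"
    unfolding y_def by (rule someI_ex) (use x in blast)
  then show "(\<lambda>w. L (SOME y. y \<in> Z \<and> \<pi> y = w)) (\<pi> x) = L x"
    using L[of y x] presentsD(6)[OF W, of y x] x by (simp add: y_def)
qed

lemma translate_eq_iff:
  assumes "subspace U"
  shows "(+) x ` U = (+) y ` U \<longleftrightarrow> x - y \<in> U"
proof
  assume "(+) x ` U = (+) y ` U"
  moreover have "x \<in> (+) x ` U"
    using subspace_0[OF assms] by force
  ultimately show "x - y \<in> U" by auto
next
  assume d: "x - y \<in> U"
  have "(+) x ` U = (+) y ` (+) (x - y) ` U"
    by (simp add: image_image add.assoc[symmetric])
  also have "(+) (x - y) ` U = U"
  proof
    show "(+) (x - y) ` U \<subseteq> U"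
      using subspace_add[OF assms d] by auto
    show "U \<subseteq> (+) (x - y) ` U"
    proof
      fix u assume "u \<in> U"
      then have "u - (x - y) \<in> U" by (rule subspace_diff[OF assms _ d])
      then show "u \<in> (+) (x - y) ` U" by (force simp: image_iff)
    qed
  qed
  finally show "(+) x ` U = (+) y ` U" .
qed

text \<open>The third isomorphism theorem: the subquotient \<open>S / T\<close> of a subquotient of \<open>Z\<close> is the quotient of
  the preimages of \<open>S\<close> and \<open>T\<close> in \<open>Z\<close>.\<close>

lemma presents_vquotient:
  assumes W: "presents Z K W \<pi>"
    and S: "S \<subseteq> vcarrier W" and T: "T \<subseteq> vcarrier W"
    and Z': "Z' = {x \<in> Z. \<pi> x \<in> S}" and K': "K' = {x \<in> Z. \<pi> x \<in> T}"
    and sub_Z': "subspace Z'" and sub_K': "subspace K'"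
  shows "presents Z' K' (vquotient (subsp W S) T) (\<lambda>x. coset W T (\<pi> x))"
proof -
  have sub: "subspace Z"
    by (rule presentsD(1)[OF W])
  have K'Z: "K' \<subseteq> Z" and Z'Z: "Z' \<subseteq> Z"
    using K' Z' by auto
  have T_eq: "T = \<pi> ` K'"
    using T unfolding K' presentsD(5)[OF W] by blast
  have coset: "coset W T (\<pi> x) = \<pi> ` (+) x ` K'" if "x \<in> Z" for x
    unfolding coset_def T_eq image_image
    by (rule image_cong) (use presentsD(3)[OF W that] K'Z in auto)
  have mem: "x + k \<in> Z" if "x \<in> Z" "k \<in> K'" for x k
    using that K'Z subspace_add[OF sub] by blast
  show ?thesis
  proof (rule presentsI)
    show "subspace Z'" by (rule sub_Z')
  next
    fix x assume "x \<in> Z'"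
    then show "coset W T (\<pi> x) \<in> vcarrier (vquotient (subsp W S) T)"
      using Z' by auto
  next
    fix x y assume "x \<in> Z'" "y \<in> Z'"
    then have xy: "x \<in> Z" "y \<in> Z" using Z'Z by auto
    have "vadd (vquotient (subsp W S) T) (coset W T (\<pi> x)) (coset W T (\<pi> y)) =
        {vadd W (\<pi> (x + k)) (\<pi> (y + l)) | k l. k \<in> K' \<and> l \<in> K'}"
      using xy by (auto simp: coset)
    also have "\<dots> = {\<pi> ((x + y) + (k + l)) | k l. k \<in> K' \<and> l \<in> K'}"
    proof -
      have "vadd W (\<pi> (x + k)) (\<pi> (y + l)) = \<pi> ((x + y) + (k + l))" if "k \<in> K'" "l \<in> K'" for k l
        using presentsD(3)[OF W mem mem, of x k y l] xy that by (simp add: algebra_simps)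
      then show ?thesis
        by (metis (no_types, lifting))
    qed
    also have "\<dots> = \<pi> ` (+) (x + y) ` K'"
    proof (intro subset_antisym subsetI)
      fix z assume "z \<in> \<pi> ` (+) (x + y) ` K'"
      then obtain k where "k \<in> K'" "z = \<pi> ((x + y) + (k + 0))" by auto
      then show "z \<in> {\<pi> ((x + y) + (k + l)) | k l. k \<in> K' \<and> l \<in> K'}"
        using subspace_0[OF sub_K'] by blast
    next
      fix z assume "z \<in> {\<pi> ((x + y) + (k + l)) | k l. k \<in> K' \<and> l \<in> K'}"
      then obtain k l where "k \<in> K'" "l \<in> K'" "z = \<pi> ((x + y) + (k + l))" by auto
      then show "z \<in> \<pi> ` (+) (x + y) ` K'"
        using subspace_add[OF sub_K'] by auto
    qed
    finally show "coset W T (\<pi> (x + y)) =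
        vadd (vquotient (subsp W S) T) (coset W T (\<pi> x)) (coset W T (\<pi> y))"
      using coset[OF subspace_add[OF sub xy]] by simp
  next
    fix c x assume "x \<in> Z'"
    then have x: "x \<in> Z" using Z'Z by auto
    have *: "coset W T (vscale W c (\<pi> (x + k))) = \<pi> ` (+) (scale c x) ` K'" if "k \<in> K'" for k
    proof -
      have "coset W T (vscale W c (\<pi> (x + k))) = \<pi> ` (+) (scale c (x + k)) ` K'"
        using presentsD(4)[OF W mem[OF x that]] coset[OF subspace_scale[OF sub mem[OF x that]]] by metis
      also have "(+) (scale c (x + k)) ` K' = (+) (scale c x) ` K'"
        unfolding translate_eq_iff[OF sub_K']
        using subspace_scale[OF sub_K' that] by (simp add: scale_right_distrib)
      finally show ?thesis .
    qed
    have "vscale (vquotient (subsp W S) T) c (coset W T (\<pi> x)) = \<pi> ` (+) (scale c x) ` K'"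
      using * subspace_0[OF sub_K'] by (auto simp: coset[OF x])
    then show "coset W T (\<pi> (scale c x)) = vscale (vquotient (subsp W S) T) c (coset W T (\<pi> x))"
      using coset[OF subspace_scale[OF sub x]] by simp
  next
    fix w assume "w \<in> vcarrier (vquotient (subsp W S) T)"
    then obtain v where v: "v \<in> S" "w = coset W T v"
      by auto
    then obtain x where "x \<in> Z" "v = \<pi> x"
      using S presentsD(5)[OF W] by blast
    then show "\<exists>x\<in>Z'. coset W T (\<pi> x) = w"
      using v Z' by blast
  next
    fix x y assume "x \<in> Z'" "y \<in> Z'"
    then have xy: "x \<in> Z" "y \<in> Z" using Z'Z by auto
    show "coset W T (\<pi> x) = coset W T (\<pi> y) \<longleftrightarrow> x - y \<in> K'"
    proof
      assume "coset W T (\<pi> x) = coset W T (\<pi> y)"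
      moreover have "\<pi> x \<in> \<pi> ` (+) x ` K'"
        using subspace_0[OF sub_K'] by force
      ultimately obtain k where k: "k \<in> K'" "\<pi> x = \<pi> (y + k)"
        using coset xy by auto
      have "\<pi> (x - y) = vadd W (\<pi> x) (\<pi> (- y))"
        using presentsD(3)[OF W xy(1) subspace_neg[OF sub xy(2)]] by simp
      also have "\<dots> = \<pi> k"
        using presentsD(3)[OF W mem[OF xy(2) k(1)] subspace_neg[OF sub xy(2)]] k(2) by simp
      finally show "x - y \<in> K'"
        using k(1) subspace_diff[OF sub xy] unfolding K' by simp
    next
      assume "x - y \<in> K'"
      then show "coset W T (\<pi> x) = coset W T (\<pi> y)"
        unfolding coset[OF xy(1)] coset[OF xy(2)]
        using translate_eq_iff[OF sub_K', of x y] by simp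
    qed
  qed
qed

lemma presents_coset:
  assumes "subspace Z" and "subspace U"
  shows "presents Z U (vquotient (ambient scale Z) U) (\<lambda>x. (+) x ` U)"
  using presents_vquotient[OF presents_ambient, of Z U Z U] assms by simp

lemma presents_subsp:
  assumes W: "presents Z K W \<pi>" and "subspace Z'" and "Z' \<subseteq> Z"
  shows "presents Z' K (subsp W (\<pi> ` Z')) \<pi>"
  using assms by (auto intro!: presentsI simp: presentsD subset_iff)

end

locale subquotients_pair = vs1: subquotients s1 + vs2: subquotients s2
  for s1 :: "'a::field \<Rightarrow> 'b::ab_group_add \<Rightarrow> 'b"
    and s2 :: "'a::field \<Rightarrow> 'c::ab_group_add \<Rightarrow> 'c"
begin

sublocale vector_space_pair s1 s2 ..

lemma presents_pullback:
  assumes W: "vs2.presents Z K W \<pi>" and h: "Vector_Spaces.linear s1 s2 h"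
    and "vs1.subspace Z0" and "h ` Z0 = Z" and "\<And>x. x \<in> Z0 \<Longrightarrow> h x \<in> K \<longleftrightarrow> x \<in> K0"
  shows "vs1.presents Z0 K0 W (\<lambda>x. \<pi> (h x))"
proof (rule vs1.presentsI)
  have mem: "h x \<in> Z" if "x \<in> Z0" for x
    using assms(4) that by blast
  show "vs1.subspace Z0" by fact
  show "\<pi> (h x) \<in> vcarrier W" if "x \<in> Z0" for x
    by (rule vs2.presentsD(2)[OF W mem[OF that]])
  show "\<pi> (h (x + y)) = vadd W (\<pi> (h x)) (\<pi> (h y))" if "x \<in> Z0" "y \<in> Z0" for x y
    using vs2.presentsD(3)[OF W mem mem] that linear_add[OF h] by simp
  show "\<pi> (h (s1 c x)) = vscale W c (\<pi> (h x))" if "x \<in> Z0" for c x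
    using vs2.presentsD(4)[OF W mem] that linear_scale[OF h] by simp
  show "\<exists>x\<in>Z0. \<pi> (h x) = w" if "w \<in> vcarrier W" for w
    using that unfolding vs2.presentsD(5)[OF W] assms(4)[symmetric] by blast
  show "\<pi> (h x) = \<pi> (h y) \<longleftrightarrow> x - y \<in> K0" if "x \<in> Z0" "y \<in> Z0" for x y
    using vs2.presentsD(6)[OF W mem mem] that linear_diff[OF h, symmetric] assms(5) 
      vs1.subspace_diff[OF assms(3)] by simp
qed

lemma presents_vsum:
  assumes W1: "vs2.presents Z1 K1 W1 \<pi>1" and W2: "vs2.presents Z2 K2 W2 \<pi>2"
    and h1: "Vector_Spaces.linear s1 s2 h1" and h2: "Vector_Spaces.linear s1 s2 h2"
    and Z: "vs1.subspace Z"
    and surj: "(\<lambda>x. (h1 x, h2 x)) ` Z = Z1 \<times> Z2"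
    and ker: "\<And>x. x \<in> Z \<Longrightarrow> h1 x \<in> K1 \<and> h2 x \<in> K2 \<longleftrightarrow> x \<in> K"
  shows "vs1.presents Z K (W1 \<oplus>\<^sub>v W2) (\<lambda>x. (\<pi>1 (h1 x), \<pi>2 (h2 x)))"
proof (rule vs1.presentsI)
  have mem: "h1 x \<in> Z1" "h2 x \<in> Z2" if "x \<in> Z" for x
    using surj that by blast+
  show "vs1.subspace Z" by fact
  show "(\<pi>1 (h1 x), \<pi>2 (h2 x)) \<in> vcarrier (W1 \<oplus>\<^sub>v W2)" if "x \<in> Z" for x
    using vs2.presentsD(2)[OF W1] vs2.presentsD(2)[OF W2] mem that by simp
  show "(\<pi>1 (h1 (x + y)), \<pi>2 (h2 (x + y))) =
      vadd (W1 \<oplus>\<^sub>v W2) (\<pi>1 (h1 x), \<pi>2 (h2 x)) (\<pi>1 (h1 y), \<pi>2 (h2 y))" if "x \<in> Z" "y \<in> Z" for x y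
    using vs2.presentsD(3)[OF W1 mem(1) mem(1)] vs2.presentsD(3)[OF W2 mem(2) mem(2)] that
      linear_add[OF h1] linear_add[OF h2] by simp
  show "(\<pi>1 (h1 (s1 c x)), \<pi>2 (h2 (s1 c x))) = vscale (W1 \<oplus>\<^sub>v W2) c (\<pi>1 (h1 x), \<pi>2 (h2 x))"
    if "x \<in> Z" for c x
    using vs2.presentsD(4)[OF W1 mem(1)] vs2.presentsD(4)[OF W2 mem(2)] that
      linear_scale[OF h1] linear_scale[OF h2] by simp
  show "\<exists>x\<in>Z. (\<pi>1 (h1 x), \<pi>2 (h2 x)) = w" if w: "w \<in> vcarrier (W1 \<oplus>\<^sub>v W2)" for w
  proof -
    obtain a b where ab: "a \<in> Z1" "b \<in> Z2" "w = (\<pi>1 a, \<pi>2 b)"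
      using w[unfolded vsum_simps vs2.presentsD(5)[OF W1] vs2.presentsD(5)[OF W2]] by blast
    then have "(a, b) \<in> (\<lambda>x. (h1 x, h2 x)) ` Z"
      unfolding surj by simp
    then show ?thesis using ab(3) by auto
  qed
  show "(\<pi>1 (h1 x), \<pi>2 (h2 x)) = (\<pi>1 (h1 y), \<pi>2 (h2 y)) \<longleftrightarrow> x - y \<in> K" if "x \<in> Z" "y \<in> Z" for x y
    using ker[OF vs1.subspace_diff[OF Z that]] that
      vs2.presentsD(6)[OF W1 mem(1) mem(1)] vs2.presentsD(6)[OF W2 mem(2) mem(2)]
      linear_diff[OF h1] linear_diff[OF h2] by simp
qed

text \<open>Extend a basis of \<open>p ` K\<close> to a basis of \<open>p ` Z\<close> and lift basis vectors, those of \<open>p ` K\<close> into \<open>K\<close>.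
  Since the section respects \<open>K\<close>, it induces a section of the quotients by \<open>K\<close> and \<open>p ` K\<close>.\<close>

lemma section_adapted_to_subspace:
  assumes p: "Vector_Spaces.linear s1 s2 p" and K: "vs1.subspace K" and Z: "vs1.subspace Z" and "K \<subseteq> Z"
  obtains \<rho> where "Vector_Spaces.linear s2 s1 \<rho>"
    and "\<And>v. v \<in> p ` Z \<Longrightarrow> \<rho> v \<in> Z \<and> p (\<rho> v) = v"
    and "\<And>v. v \<in> p ` K \<Longrightarrow> \<rho> v \<in> K"
proof -
  interpret sw: vector_space_pair s2 s1 ..
  have span_p: "vs2.span (p ` K) = p ` K" "vs2.span (p ` Z) = p ` Z"
    using linear_subspace_image[OF p K] linear_subspace_image[OF p Z] by (simp_all add: vs2.span_eq_iff)
  obtain B0 where B0: "B0 \<subseteq> p ` K" "vs2.independent B0" "p ` K \<subseteq> vs2.span B0"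
    using vs2.maximal_independent_subset .
  obtain B where B: "B0 \<subseteq> B" "B \<subseteq> p ` Z" "vs2.independent B" "p ` Z \<subseteq> vs2.span B"
    by (rule vs2.maximal_independent_subset_extend[of B0 "p ` Z"]) (use B0 \<open>K \<subseteq> Z\<close> in blast)+
  have "\<exists>e. e \<in> Z \<and> p e = b \<and> (b \<in> B0 \<longrightarrow> e \<in> K)" if "b \<in> B" for b
    using that B(2) B0(1) \<open>K \<subseteq> Z\<close> by (cases "b \<in> B0") blast+
  then obtain e where e: "\<And>b. b \<in> B \<Longrightarrow> e b \<in> Z \<and> p (e b) = b \<and> (b \<in> B0 \<longrightarrow> e b \<in> K)"
    by metis
  define \<rho> where "\<rho> = sw.construct B e"
  have lin: "Vector_Spaces.linear s2 s1 \<rho>"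
    unfolding \<rho>_def by (rule sw.linear_construct[OF B(3)])
  have basis: "\<rho> b = e b" if "b \<in> B" for b
    unfolding \<rho>_def by (rule sw.construct_basis[OF B(3) that])
  have \<rho>_K: "\<rho> ` vs2.span B0 \<subseteq> K"
    unfolding sw.linear_span_image[OF lin, symmetric]
    by (rule vs1.span_minimal[OF _ K]) (use basis e B(1) in auto)
  have \<rho>_Z: "\<rho> ` vs2.span B \<subseteq> Z"
    unfolding sw.linear_span_image[OF lin, symmetric]
    by (rule vs1.span_minimal[OF _ Z]) (use basis e in auto)
  have p_\<rho>: "p (\<rho> v) = v" if "v \<in> vs2.span B" for v
    using that
  proof (induction rule: vs2.span_induct_alt)
    case base
    then show ?case using linear_0[OF p] sw.linear_0[OF lin] by simp
  next
    case (step c x y)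
    then show ?case
      using e basis sw.linear_add[OF lin] sw.linear_scale[OF lin] linear_add[OF p] linear_scale[OF p]
      by simp
  qed
  show thesis
  proof (rule that[OF lin])
    show "\<rho> v \<in> Z \<and> p (\<rho> v) = v" if "v \<in> p ` Z" for v
      using subsetD[OF B(4) that] p_\<rho> \<rho>_Z by blast
    show "\<rho> v \<in> K" if "v \<in> p ` K" for v
      using subsetD[OF B0(3) that] \<rho>_K by blast
  qed
qed

end

section \<open>Linear maps out of a free vector space\<close>

global_interpretation free_sub: subquotients "fscale :: 'k::field \<Rightarrow> ('b \<Rightarrow>\<^sub>0 'k) \<Rightarrow> _" ..

lemma vector_space_mult: "vector_space ((*) :: 'k::field \<Rightarrow> 'k \<Rightarrow> 'k)"
  by unfold_locales (simp_all add: algebra_simps)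

definition linear_ext ::
    "('k::field \<Rightarrow> 'v::ab_group_add \<Rightarrow> 'v) \<Rightarrow> ('b \<Rightarrow> 'v) \<Rightarrow> ('b \<Rightarrow>\<^sub>0 'k) \<Rightarrow> 'v" where
  "linear_ext s G p = (\<Sum>x\<in>Poly_Mapping.keys p. s (Poly_Mapping.lookup p x) (G x))"

lemma linear_linear_ext:
  assumes "vector_space s"
  shows "Vector_Spaces.linear fscale s (linear_ext s G)"
proof -
  interpret s: vector_space s by fact
  have sup: "linear_ext s G p = (\<Sum>x\<in>M. s (Poly_Mapping.lookup p x) (G x))"
    if "finite M" "Poly_Mapping.keys p \<subseteq> M" for p M
    unfolding linear_ext_def
    by (rule sum.mono_neutral_left) (use that in \<open>auto simp: in_keys_iff\<close>)
  have "linear_ext s G (p + q) = linear_ext s G p + linear_ext s G q" for p q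
  proof -
    let ?M = "Poly_Mapping.keys p \<union> Poly_Mapping.keys q"
    have "Poly_Mapping.keys (p + q) \<subseteq> ?M" by (rule Poly_Mapping.keys_add)
    then show ?thesis
      by (subst (1 2 3) sup[of ?M])
        (auto simp: lookup_add s.scale_left_distrib sum.distrib)
  qed
  moreover have "linear_ext s G (fscale c p) = s c (linear_ext s G p)" for c p
  proof -
    have "Poly_Mapping.keys (fscale c p) \<subseteq> Poly_Mapping.keys p"
      by (auto simp: in_keys_iff lookup_fscale)
    then show ?thesis
      by (subst (1 2) sup[of "Poly_Mapping.keys p"])
        (auto simp: lookup_fscale s.scale_sum_right)
  qed
  ultimately show ?thesis
    unfolding Vector_Spaces.linear_iff using assms free.vector_space_axioms by auto
qed

lemma linear_ext_fbasis [simp]: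
  assumes "vector_space s"
  shows "linear_ext s G (fbasis x) = G x"
proof -
  interpret s: vector_space s by fact
  show ?thesis by (simp add: linear_ext_def)
qed

section \<open>Tensor powers, cochains and their operators\<close>

context dga
begin

sublocale subquotients scale ..

lemma phi_add: "\<phi> (x + y) = \<phi> x + \<phi> y" and phi_scale: "\<phi> (scale c x) = scale c (\<phi> x)"
  and phi_zero [simp]: "\<phi> 0 = 0"
proof -
  interpret l: Vector_Spaces.linear scale scale \<phi> by (rule linear_phi)
  show "\<phi> (x + y) = \<phi> x + \<phi> y" "\<phi> (scale c x) = scale c (\<phi> x)" "\<phi> 0 = 0"
    by (rule l.add l.scale l.zero)+
qed

subsection \<open>Homogeneous components\<close>

definition component :: "'a \<Rightarrow> nat \<Rightarrow> 'a" where
  "component x = (THE c. (\<forall>m. c m \<in> A m) \<and> finite {m. c m \<noteq> 0} \<and> x = (\<Sum>m | c m \<noteq> 0. c m))"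

lemma component:
  shows component_mem: "component x m \<in> A m"
    and finite_component: "finite {m. component x m \<noteq> 0}"
    and sum_component: "(\<Sum>m | component x m \<noteq> 0. component x m) = x"
  using theI'[OF direct_sum_A[of x]] unfolding component_def by auto

lemma component_eqI:
  assumes "\<And>m. c m \<in> A m" and "finite M" and "\<And>m. m \<notin> M \<Longrightarrow> c m = 0" and "x = (\<Sum>m\<in>M. c m)"
  shows "component x = c"
proof -
  have "{m. c m \<noteq> 0} \<subseteq> M"
    using assms(3) by auto
  moreover from this have "x = (\<Sum>m | c m \<noteq> 0. c m)"
    unfolding assms(4) by (intro sum.mono_neutral_right) (use assms(2) in auto)
  ultimately have "(\<forall>m. c m \<in> A m) \<and> finite {m. c m \<noteq> 0} \<and> x = (\<Sum>m | c m \<noteq> 0. c m)"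
    using assms(1,2) finite_subset by blast
  then show ?thesis
    unfolding component_def by (rule the1_equality[OF direct_sum_A])
qed

lemma sum_component_superset:
  assumes "finite M" and "\<And>m. m \<notin> M \<Longrightarrow> component x m = 0"
  shows "(\<Sum>m\<in>M. component x m) = x"
  using assms by (subst sum_component[of x, symmetric]) (auto intro!: sum.mono_neutral_right)

lemma component_add: "component (x + y) m = component x m + component y m"
proof -
  let ?M = "{m. component x m \<noteq> 0} \<union> {m. component y m \<noteq> 0}"
  have "component (x + y) = (\<lambda>m. component x m + component y m)"
  proof (rule component_eqI)
    have "(\<Sum>m\<in>?M. component z m) = z" if "z \<in> {x, y}" for z
      by (rule sum_component_superset) (use that in \<open>auto simp: finite_component\<close>)
    then show "x + y = (\<Sum>m\<in>?M. component x m + component y m)"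
      by (simp add: sum.distrib)
  qed (auto intro: subspace_add[OF subspace_A] component_mem simp: finite_component)
  then show ?thesis by simp
qed

lemma component_scale: "component (scale c x) m = scale c (component x m)"
proof -
  have "component (scale c x) = (\<lambda>m. scale c (component x m))"
  proof (rule component_eqI)
    show "scale c x = (\<Sum>m | component x m \<noteq> 0. scale c (component x m))"
      by (simp add: scale_sum_right[symmetric] sum_component)
  qed (auto intro: subspace_scale[OF subspace_A] component_mem simp: finite_component)
  then show ?thesis by simp
qed

lemma component_homogeneous:
  assumes "x \<in> A d"
  shows "component x m = (if m = d then x else 0)"
proof -
  have "component x = (\<lambda>m. if m = d then x else 0)"
    by (rule component_eqI[of _ "{d}"]) (use assms subspace_0[OF subspace_A] in auto)
  then show ?thesis by simp
qed

text \<open>The grading involution \<open>x \<mapsto> (-1)\<^bsup>\<bar>x\<bar>\<^esup> x\<close>, extended to all elements.\<close>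

definition sgn_op :: "'a \<Rightarrow> 'a" where
  "sgn_op x = (\<Sum>m | component x m \<noteq> 0. scale ((- 1) ^ m) (component x m))"

lemma sgn_op_superset:
  assumes "finite M" and "\<And>m. m \<notin> M \<Longrightarrow> component x m = 0"
  shows "sgn_op x = (\<Sum>m\<in>M. scale ((- 1) ^ m) (component x m))"
  unfolding sgn_op_def by (rule sum.mono_neutral_left) (use assms in auto)

lemma sgn_op_add: "sgn_op (x + y) = sgn_op x + sgn_op y"
proof -
  let ?M = "{m. component x m \<noteq> 0} \<union> {m. component y m \<noteq> 0}"
  have "sgn_op z = (\<Sum>m\<in>?M. scale ((- 1) ^ m) (component z m))" if "z \<in> {x, y, x + y}" for z
    by (rule sgn_op_superset) (use that in \<open>auto simp: finite_component component_add\<close>)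
  then show ?thesis
    by (simp add: component_add scale_right_distrib sum.distrib)
qed

lemma sgn_op_scale: "sgn_op (scale c x) = scale c (sgn_op x)"
proof -
  have "sgn_op (scale c x) =
      (\<Sum>m | component x m \<noteq> 0. scale ((- 1) ^ m) (component (scale c x) m))"
    by (rule sgn_op_superset) (auto simp: finite_component component_scale)
  then show ?thesis
    by (simp add: sgn_op_def component_scale scale_sum_right mult.commute)
qed

lemma sgn_op_homogeneous: "x \<in> A d \<Longrightarrow> sgn_op x = scale ((- 1) ^ d) x"
  by (subst sgn_op_superset[of "{d}"]) (auto simp: component_homogeneous)

subsection \<open>The tensor relations\<close>

definition list_span :: "nat \<Rightarrow> ('a list \<Rightarrow>\<^sub>0 'k) set" where
  "list_span n = free.span {fbasis xs | xs. length xs = n}"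

definition homogeneous_span :: "nat \<Rightarrow> nat \<Rightarrow> ('a list \<Rightarrow>\<^sub>0 'k) set" where
  "homogeneous_span n m = free.span {fbasis xs | xs ds. homogeneous n m xs ds}"

lemma homogeneous_length: "homogeneous n m xs ds \<Longrightarrow> length xs = n \<and> length ds = n"
  by (auto simp: homogeneous_def dest: list_all2_lengthD)

lemma homogeneous_nth: "homogeneous n m xs ds \<Longrightarrow> i < n \<Longrightarrow> xs ! i \<in> A (ds ! i)"
  by (auto simp: homogeneous_def list_all2_conv_all_nth)

lemma homogeneous_iff:
  "homogeneous n m xs ds \<longleftrightarrow>
     length xs = n \<and> length ds = n \<and> (\<forall>i<n. xs ! i \<in> A (ds ! i)) \<and> sum_list ds = m"
  by (auto simp: homogeneous_def list_all2_conv_all_nth)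

lemma homogeneous_update:
  "homogeneous n m xs ds \<Longrightarrow> x \<in> A (ds ! i) \<Longrightarrow> homogeneous n m (xs[i := x]) ds"
  unfolding homogeneous_iff
  by (metis length_list_update nth_list_update_eq nth_list_update_neq)

lemma homogeneous_span_subset: "homogeneous_span n m \<subseteq> list_span n"
  unfolding homogeneous_span_def list_span_def
  by (rule free.span_mono) (auto simp: homogeneous_def)

lemma subspace_tensor_rel: "free.subspace (tensor_rel n)"
  unfolding tensor_rel_def by (rule free.subspace_span)

lemma tensor_rel_add:
  "length us + 1 + length vs = n \<Longrightarrow>
     fbasis (us @ (x + y) # vs) - fbasis (us @ x # vs) - fbasis (us @ y # vs) \<in> tensor_rel n"
  unfolding tensor_rel_def by (rule free.span_base) blast

lemma tensor_rel_scale: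
  "length us + 1 + length vs = n \<Longrightarrow>
     fbasis (us @ scale c x # vs) - fscale c (fbasis (us @ x # vs)) \<in> tensor_rel n"
  unfolding tensor_rel_def by (rule free.span_base) blast

lemma tensor_rel_zero:
  assumes "length us + 1 + length vs = n"
  shows "fbasis (us @ 0 # vs) \<in> tensor_rel n"
  using tensor_rel_scale[OF assms, of 0 0] by simp

lemma tensor_rel_subset: "tensor_rel n \<subseteq> list_span n"
  unfolding tensor_rel_def list_span_def
proof (rule free.span_minimal)
  have "(fbasis xs :: _ \<Rightarrow>\<^sub>0 'k) \<in> free.span {fbasis xs | xs. length xs = n}" if "length xs = n" for xs :: "'a list"
    by (rule free.span_base) (use that in blast)
  then show "{fbasis (us @ (x + y) # vs) - fbasis (us @ x # vs) - fbasis (us @ y # vs)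
         | us x y vs. length us + 1 + length vs = n} \<union>
      {fbasis (us @ scale c x # vs) - fscale c (fbasis (us @ x # vs))
         | us c x vs. length us + 1 + length vs = n} \<subseteq> free.span {fbasis xs | xs. length xs = n}"
    by (auto intro!: free.span_diff free.span_scale)
qed simp

lemma tensor_class_eq: "tensor_class n p = (+) p ` tensor_rel n"
  by (simp add: tensor_class_def free_lists_def)

lemma tensor_class_eq_iff: "tensor_class n p = tensor_class n q \<longleftrightarrow> p - q \<in> tensor_rel n"
  unfolding tensor_class_eq by (rule free_sub.translate_eq_iff[OF subspace_tensor_rel])

lemma presents_tensor_power:
  "free_sub.presents (list_span n) (tensor_rel n) (tensor_power n) (tensor_class n)"
  using free_sub.presents_coset[OF _ subspace_tensor_rel, of "list_span n" n]
  unfolding tensor_power_def free_lists_def list_span_def tensor_class_eq[abs_def]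
  by simp

lemma presents_tensor_power_deg:
  "free_sub.presents (homogeneous_span n m) (tensor_rel n) (tensor_power_deg n m) (tensor_class n)"
  unfolding tensor_power_deg_def homogeneous_span_def[symmetric]
  by (rule free_sub.presents_subsp[OF presents_tensor_power _ homogeneous_span_subset])
    (simp add: homogeneous_span_def)

text \<open>A map out of the free vector space respects the tensor relations as soon as it is
  multilinear modulo the relations of the target.\<close>

lemma linear_ext_tensor_rel:
  assumes s: "vector_space s" and U: "module.subspace s U"
    and add: "\<And>us x y vs. length us + 1 + length vs = n \<Longrightarrow>
      G (us @ (x + y) # vs) - G (us @ x # vs) - G (us @ y # vs) \<in> U"
    and scale: "\<And>us c x vs. length us + 1 + length vs = n \<Longrightarrow>
      G (us @ scale c x # vs) - s c (G (us @ x # vs)) \<in> U"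
    and p: "p \<in> tensor_rel n"
  shows "linear_ext s G p \<in> U"
proof -
  interpret s: vector_space s by (rule s)
  interpret l: Vector_Spaces.linear fscale s "linear_ext s G"
    by (rule linear_linear_ext[OF s])
  have "tensor_rel n \<subseteq> {p. linear_ext s G p \<in> U}"
    unfolding tensor_rel_def
  proof (rule free.span_minimal)
    show "free.subspace {p. linear_ext s G p \<in> U}"
      by (rule l.subspace_linear_preimage[OF U])
  qed (use add scale in \<open>auto simp: l.diff l.scale linear_ext_fbasis[OF s]\<close>)
  then show ?thesis using p by blast
qed

subsection \<open>Cochains with prescribed values\<close>

text \<open>The formulas for the cochains also use the degrees of the factors, and make sense on homogeneous
  factors only. So linearity in the \<open>i\<close>-th factor is demanded on the graded piece \<open>A (ds ! i)\<close>.\<close>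

definition graded_multilinear :: "nat \<Rightarrow> nat \<Rightarrow> ('a list \<Rightarrow> nat list \<Rightarrow> 'k) \<Rightarrow> bool" where
  "graded_multilinear n m F \<longleftrightarrow>
     (\<forall>xs ds i x y c. homogeneous n m xs ds \<longrightarrow> i < n \<longrightarrow> x \<in> A (ds ! i) \<longrightarrow> y \<in> A (ds ! i) \<longrightarrow>
        F (xs[i := x + y]) ds = F (xs[i := x]) ds + F (xs[i := y]) ds \<and>
        F (xs[i := scale c x]) ds = c * F (xs[i := x]) ds)"

lemma graded_multilinearD:
  assumes "graded_multilinear n m F" and "homogeneous n m xs ds" and "i < n"
  shows "x \<in> A (ds ! i) \<Longrightarrow> y \<in> A (ds ! i) \<Longrightarrow>
      F (xs[i := x + y]) ds = F (xs[i := x]) ds + F (xs[i := y]) ds"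
    and "x \<in> A (ds ! i) \<Longrightarrow> F (xs[i := scale c x]) ds = c * F (xs[i := x]) ds"
  using assms unfolding graded_multilinear_def by blast+

lemma graded_multilinear_zero:
  assumes "graded_multilinear n m F" and "homogeneous n m xs ds" and "i < n" and "xs ! i = 0"
  shows "F xs ds = 0"
proof -
  have "xs = xs[i := scale 0 0]"
    using assms(4) by (simp add: list_update_same_conv[symmetric] del: list_update_same_conv)
      (metis list_update_id)
  then show ?thesis
    using graded_multilinearD(2)[OF assms(1-3), of 0 0] subspace_0[OF subspace_A] by simp
qed

text \<open>Cutting every entry into its components extends such a function to all lists, and the
  extension is multilinear on the nose.\<close>

definition ungraded :: "nat \<Rightarrow> nat \<Rightarrow> ('a list \<Rightarrow> nat list \<Rightarrow> 'k) \<Rightarrow> 'a list \<Rightarrow> 'k" where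
  "ungraded n m F xs =
     (\<Sum>ds | length ds = n \<and> sum_list ds = m. F (map2 component xs ds) ds)"

lemma finite_degrees: "finite {ds :: nat list. length ds = n \<and> sum_list ds = m}"
proof (rule finite_subset)
  show "{ds :: nat list. length ds = n \<and> sum_list ds = m} \<subseteq> {ds. set ds \<subseteq> {..m} \<and> length ds = n}"
    using member_le_sum_list by fastforce
qed (simp add: finite_lists_length_eq)

lemma homogeneous_components:
  "length xs = n \<Longrightarrow> length ds = n \<Longrightarrow> sum_list ds = m \<Longrightarrow>
     homogeneous n m (map2 component xs ds) ds"
  by (auto simp: homogeneous_iff component_mem)

text \<open>If \<open>es \<noteq> ds\<close>, some factor has component \<open>0\<close> in the degree that \<open>es\<close> prescribes, so only the summand
  of \<open>ds\<close> survives.\<close>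

lemma ungraded_homogeneous:
  assumes F: "graded_multilinear n m F" and xs: "homogeneous n m xs ds"
  shows "ungraded n m F xs = F xs ds"
proof -
  have len: "length xs = n" "length ds = n" and m: "sum_list ds = m"
    using xs by (auto simp: homogeneous_iff)
  have "F (map2 component xs es) es = 0" if es: "length es = n" "sum_list es = m" "es \<noteq> ds" for es
  proof -
    obtain i where i: "i < n" "es ! i \<noteq> ds ! i"
      using es len by (auto simp: list_eq_iff_nth_eq)
    show ?thesis
      by (rule graded_multilinear_zero[OF F homogeneous_components i(1)])
        (use len es i homogeneous_nth[OF xs i(1)] in \<open>auto simp: component_homogeneous\<close>)
  qed
  then have "ungraded n m F xs = (\<Sum>es\<in>{ds}. F (map2 component xs es) es)"
    unfolding ungraded_def by (intro sum.mono_neutral_right finite_degrees) (use len m in auto)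
  moreover have "map2 component xs ds = xs"
    by (rule nth_equalityI)
      (use len in \<open>auto simp: component_homogeneous[OF homogeneous_nth[OF xs]]\<close>)
  ultimately show ?thesis by simp
qed

lemma ungraded_multilinear:
  assumes F: "graded_multilinear n m F" and len: "length us + 1 + length vs = n"
  shows "ungraded n m F (us @ (x + y) # vs) = ungraded n m F (us @ x # vs) + ungraded n m F (us @ y # vs)"
    and "ungraded n m F (us @ scale c x # vs) = c * ungraded n m F (us @ x # vs)"
proof -
  have upd: "map2 component (us @ z # vs) ds =
      (map2 component (us @ 0 # vs) ds)[length us := component z (ds ! length us)]"
    if "length ds = n" for z ds
    by (rule nth_equalityI) (use len that in \<open>auto simp: nth_append nth_list_update nth_Cons'\<close>)
  have hom: "homogeneous n m (map2 component (us @ 0 # vs) ds) ds"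
    if "length ds = n" "sum_list ds = m" for ds
    by (rule homogeneous_components) (use len that in auto)
  have i: "length us < n"
    using len by simp
  show "ungraded n m F (us @ (x + y) # vs) = ungraded n m F (us @ x # vs) + ungraded n m F (us @ y # vs)"
    unfolding ungraded_def sum.distrib[symmetric]
  proof (rule sum.cong[OF refl])
    fix ds assume "ds \<in> {ds. length ds = n \<and> sum_list ds = m}"
    then have ds: "length ds = n" "sum_list ds = m" by auto
    show "F (map2 component (us @ (x + y) # vs) ds) ds =
        F (map2 component (us @ x # vs) ds) ds + F (map2 component (us @ y # vs) ds) ds"
      unfolding upd[OF ds(1), of "x + y"] upd[OF ds(1), of x] upd[OF ds(1), of y] component_add
      by (rule graded_multilinearD(1)[OF F hom[OF ds] i]) (rule component_mem)+
  qed
  show "ungraded n m F (us @ scale c x # vs) = c * ungraded n m F (us @ x # vs)"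
    unfolding ungraded_def sum_distrib_left
  proof (rule sum.cong[OF refl])
    fix ds assume "ds \<in> {ds. length ds = n \<and> sum_list ds = m}"
    then have ds: "length ds = n" "sum_list ds = m" by auto
    show "F (map2 component (us @ scale c x # vs) ds) ds = c * F (map2 component (us @ x # vs) ds) ds"
      unfolding upd[OF ds(1), of "scale c x"] upd[OF ds(1), of x] component_scale
      by (rule graded_multilinearD(2)[OF F hom[OF ds] i]) (rule component_mem)
  qed
qed

lemma pure_mem: "homogeneous n m xs ds \<Longrightarrow> pure xs \<in> vcarrier (tensor_power_deg n m)"
  unfolding pure_def free_sub.presentsD(5)[OF presents_tensor_power_deg]
  by (rule image_eqI[of _ _ "fbasis xs"])
    (auto simp: homogeneous_def homogeneous_span_def intro: free.span_base)

lemma C_zero [simp]: "0 \<in> C n m"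
  and C_add: "f \<in> C n m \<Longrightarrow> g \<in> C n m \<Longrightarrow> f + g \<in> C n m"
  and C_scale: "f \<in> C n m \<Longrightarrow> (\<lambda>t. c * f t) \<in> C n m"
  and C_diff: "f \<in> C n m \<Longrightarrow> g \<in> C n m \<Longrightarrow> f - g \<in> C n m"
  by (auto simp: C_def dual_def algebra_simps)

lemma C_class_linear:
  assumes "f \<in> C n m"
  shows "p \<in> homogeneous_span (Suc n) m \<Longrightarrow> q \<in> homogeneous_span (Suc n) m \<Longrightarrow>
      f (tensor_class (Suc n) (p + q)) = f (tensor_class (Suc n) p) + f (tensor_class (Suc n) q)"
    and "p \<in> homogeneous_span (Suc n) m \<Longrightarrow>
      f (tensor_class (Suc n) (fscale c p)) = c * f (tensor_class (Suc n) p)"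
  using assms free_sub.presentsD(2-4)[OF presents_tensor_power_deg]
  by (simp_all add: C_def dual_def)

lemma C_zero_class: "f \<in> C n m \<Longrightarrow> f (tensor_class (Suc n) 0) = 0"
  using C_class_linear(2)[of f n m 0 0]
  by (simp add: homogeneous_span_def free.span_zero)

text \<open>The graded piece of the tensor power is spanned by the pure tensors of homogeneous elements.\<close>

lemma C_eqI:
  assumes "f \<in> C n m" and "g \<in> C n m"
    and "\<And>xs ds. homogeneous (Suc n) m xs ds \<Longrightarrow> f (pure xs) = g (pure xs)"
  shows "f = g"
proof
  fix t
  show "f t = g t"
  proof (cases "t \<in> vcarrier (tensor_power_deg (Suc n) m)")
    case True
    then obtain p where p: "p \<in> homogeneous_span (Suc n) m" "t = tensor_class (Suc n) p"
      unfolding free_sub.presentsD(5)[OF presents_tensor_power_deg] by blast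
    have "p \<in> homogeneous_span (Suc n) m \<and> f (tensor_class (Suc n) p) = g (tensor_class (Suc n) p)"
      using p(1)[unfolded homogeneous_span_def]
    proof (induction rule: free.span_induct_alt)
      case base
      then show ?case
        using C_zero_class[OF assms(1)] C_zero_class[OF assms(2)]
        by (simp add: homogeneous_span_def free.span_zero)
    next
      case (step c x y)
      then obtain xs ds where xs: "homogeneous (Suc n) m xs ds" "x = fbasis xs" by blast
      have x: "x \<in> homogeneous_span (Suc n) m" and y: "y \<in> homogeneous_span (Suc n) m"
        using step(1) step(2) by (auto simp: homogeneous_span_def intro: free.span_base)
      have cx: "fscale c x \<in> homogeneous_span (Suc n) m"
        using x by (auto simp: homogeneous_span_def intro: free.span_scale)
      have "f (tensor_class (Suc n) x) = g (tensor_class (Suc n) x)"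
        using assms(3)[OF xs(1)] xs by (simp add: pure_def homogeneous_def)
      then show ?case
        using step C_class_linear(1)[OF assms(1) cx y] C_class_linear(1)[OF assms(2) cx y]
          C_class_linear(2)[OF assms(1) x] C_class_linear(2)[OF assms(2) x] cx y
        by (simp add: homogeneous_span_def free.span_add)
    qed
    then show ?thesis using p(2) by simp
  qed (use assms in \<open>auto simp: C_def dual_def\<close>)
qed

text \<open>Existence: the extension \<open>ungraded\<close> to all lists is multilinear, so its linear extension to the
  free vector space kills the tensor relations. Uniqueness is \<open>C_eqI\<close>.\<close>

lemma cochain:
  assumes F: "graded_multilinear (Suc n) m F"
  shows cochain_mem: "cochain n m F \<in> C n m"
    and cochain_pure: "homogeneous (Suc n) m xs ds \<Longrightarrow> cochain n m F (pure xs) = F xs ds"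
proof -
  define G where "G = ungraded (Suc n) m F"
  interpret l: Vector_Spaces.linear fscale "(*)" "linear_ext (*) G"
    by (rule linear_linear_ext[OF vector_space_mult])
  have zero: "module.subspace (*) {0 :: 'k}"
    by (rule l.vs2.subspace_single_0)
  have rel: "linear_ext (*) G p = 0" if "p \<in> tensor_rel (Suc n)" for p
  proof -
    have "linear_ext (*) G p \<in> {0}"
      by (rule linear_ext_tensor_rel[OF vector_space_mult zero _ _ that])
        (simp_all add: G_def ungraded_multilinear[OF F])
    then show ?thesis by simp
  qed
  note P = presents_tensor_power_deg[of "Suc n" m]
  obtain f where f: "\<And>p. p \<in> homogeneous_span (Suc n) m \<Longrightarrow> f (tensor_class (Suc n) p) = linear_ext (*) G p"
  proof (rule free_sub.presents_factor[OF P])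
    show "linear_ext (*) G p = linear_ext (*) G q" if "p - q \<in> tensor_rel (Suc n)" for p q
      using rel[OF that] by (simp add: l.diff)
  qed blast
  define g where "g t = (if t \<in> vcarrier (tensor_power_deg (Suc n) m) then f t else 0)" for t
  have g: "g (tensor_class (Suc n) p) = linear_ext (*) G p" if "p \<in> homogeneous_span (Suc n) m" for p
    using f[OF that] free_sub.presentsD(2)[OF P that] by (simp add: g_def)
  have sub: "free.subspace (homogeneous_span (Suc n) m)"
    by (rule free_sub.presentsD(1)[OF P])
  have "g \<in> C n m"
    unfolding C_def dual_def
  proof (intro CollectI conjI ballI allI impI)
    fix t u assume "t \<in> vcarrier (tensor_power_deg (Suc n) m)" "u \<in> vcarrier (tensor_power_deg (Suc n) m)"
    then obtain p q where pq: "p \<in> homogeneous_span (Suc n) m" "q \<in> homogeneous_span (Suc n) m"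
      "t = tensor_class (Suc n) p" "u = tensor_class (Suc n) q"
      unfolding free_sub.presentsD(5)[OF P] by blast
    show "g (vadd (tensor_power_deg (Suc n) m) t u) = g t + g u"
      unfolding pq(3,4) free_sub.presentsD(3)[OF P pq(1,2), symmetric]
      using g pq(1,2) free.subspace_add[OF sub pq(1,2)] by (simp add: l.add)
  next
    fix c t assume "t \<in> vcarrier (tensor_power_deg (Suc n) m)"
    then obtain p where p: "p \<in> homogeneous_span (Suc n) m" "t = tensor_class (Suc n) p"
      unfolding free_sub.presentsD(5)[OF P] by blast
    show "g (vscale (tensor_power_deg (Suc n) m) c t) = c * g t"
      unfolding p(2) free_sub.presentsD(4)[OF P p(1), symmetric]
      using g p(1) free.subspace_scale[OF sub p(1)] by (simp add: l.scale)
  qed (simp add: g_def)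
  moreover have "g (pure xs) = F xs ds" if xs: "homogeneous (Suc n) m xs ds" for xs ds
  proof -
    have "fbasis xs \<in> homogeneous_span (Suc n) m"
      unfolding homogeneous_span_def using xs by (auto intro: free.span_base)
    then show ?thesis
      using g xs homogeneous_length[OF xs] ungraded_homogeneous[OF F xs]
      by (simp add: pure_def linear_ext_fbasis[OF vector_space_mult] G_def)
  qed
  ultimately have "\<exists>!g. g \<in> C n m \<and> (\<forall>xs ds. homogeneous (Suc n) m xs ds \<longrightarrow> g (pure xs) = F xs ds)"
    by (intro ex1I[of _ g]) (auto intro: C_eqI)
  from theI'[OF this] show "cochain n m F \<in> C n m"
    and "homogeneous (Suc n) m xs ds \<Longrightarrow> cochain n m F (pure xs) = F xs ds"
    unfolding cochain_def by auto
qed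

subsection \<open>Operators given by formulas on pure tensors\<close>

lemma graded_multilinear_pure:
  assumes f: "f \<in> C n m"
  shows "graded_multilinear (Suc n) m (\<lambda>xs ds. f (pure xs))"
  unfolding graded_multilinear_def
proof (intro allI impI)
  fix xs ds i x y c
  assume xs: "homogeneous (Suc n) m xs ds" and i: "i < Suc n"
    and x: "x \<in> A (ds ! i)" and y: "y \<in> A (ds ! i)"
  let ?us = "take i xs" and ?vs = "drop (Suc i) xs"
  have len: "length xs = Suc n" and n: "length ?us + 1 + length ?vs = Suc n"
    using homogeneous_length[OF xs] i by auto
  have upd: "xs[i := z] = ?us @ z # ?vs" for z
    using i len by (simp add: upd_conv_take_nth_drop)
  have pure: "pure (xs[i := z]) = tensor_class (Suc n) (fbasis (?us @ z # ?vs))" for z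
    using len by (simp add: pure_def upd[symmetric])
  have mem: "fbasis (?us @ z # ?vs) \<in> homogeneous_span (Suc n) m" if "z \<in> A (ds ! i)" for z
    unfolding homogeneous_span_def upd[symmetric]
    using homogeneous_update[OF xs that] by (blast intro: free.span_base)
  have "pure (xs[i := x + y]) = tensor_class (Suc n) (fbasis (?us @ x # ?vs) + fbasis (?us @ y # ?vs))"
    unfolding pure tensor_class_eq_iff using tensor_rel_add[OF n, of x y] by (simp add: algebra_simps)
  moreover have "pure (xs[i := scale c x]) = tensor_class (Suc n) (fscale c (fbasis (?us @ x # ?vs)))"
    unfolding pure tensor_class_eq_iff by (rule tensor_rel_scale[OF n])
  ultimately show "f (pure (xs[i := x + y])) = f (pure (xs[i := x])) + f (pure (xs[i := y])) \<and>
      f (pure (xs[i := scale c x])) = c * f (pure (xs[i := x]))"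
    using C_class_linear[OF f] mem x y by (simp add: pure)
qed

lemma graded_multilinear_sum:
  assumes "\<And>i. i \<in> I \<Longrightarrow> graded_multilinear n m (F i)"
  shows "graded_multilinear n m (\<lambda>xs ds. \<Sum>i\<in>I. F i xs ds)"
  using assms unfolding graded_multilinear_def by (simp add: sum.distrib sum_distrib_left)

lemma graded_multilinear_add:
  assumes "graded_multilinear n m F" and "graded_multilinear n m G"
  shows "graded_multilinear n m (\<lambda>xs ds. F xs ds + G xs ds)"
  using assms unfolding graded_multilinear_def by (simp add: algebra_simps)

lemma graded_multilinear_mult:
  assumes "graded_multilinear n m F"
  shows "graded_multilinear n m (\<lambda>xs ds. c ds * F xs ds)"
  using assms unfolding graded_multilinear_def by (simp add: algebra_simps)

text \<open>The operators \<open>b\<close>, \<open>\<tau>\<close> and \<open>s\<close> evaluate a cochain on a list made from the list of factors. This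
  captures what makes the result multilinear again: changing the \<open>i\<close>-th factor changes one
  factor of the new list, by a linear map; \<open>E\<close> is the effect on the degrees.\<close>

definition list_operation ::
    "nat \<Rightarrow> nat \<Rightarrow> ('a list \<Rightarrow> 'a list) \<Rightarrow> (nat list \<Rightarrow> nat list) \<Rightarrow> bool" where
  "list_operation n n' T E \<longleftrightarrow>
     (\<forall>m xs ds. homogeneous n m xs ds \<longrightarrow> homogeneous n' m (T xs) (E ds) \<and>
       (\<forall>i<n. \<exists>j<n'. \<exists>L. (\<forall>z. T (xs[i := z]) = (T xs)[j := L z]) \<and>
          (\<forall>z\<in>A (ds ! i). L z \<in> A (E ds ! j)) \<and>
          (\<forall>x y. L (x + y) = L x + L y) \<and> (\<forall>c x. L (scale c x) = scale c (L x))))"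

lemma graded_multilinear_list_operation:
  assumes G: "graded_multilinear n' m G" and T: "list_operation n n' T E"
  shows "graded_multilinear n m (\<lambda>xs ds. G (T xs) (E ds))"
  unfolding graded_multilinear_def
proof (intro allI impI)
  fix xs ds i x y c
  assume xs: "homogeneous n m xs ds" and i: "i < n" and x: "x \<in> A (ds ! i)" and y: "y \<in> A (ds ! i)"
  have T': "homogeneous n' m (T xs) (E ds)"
    using T xs unfolding list_operation_def by blast
  obtain j L where "j < n'" "\<And>z. T (xs[i := z]) = (T xs)[j := L z]"
    "\<And>z. z \<in> A (ds ! i) \<Longrightarrow> L z \<in> A (E ds ! j)"
    "\<And>x y. L (x + y) = L x + L y" "\<And>c x. L (scale c x) = scale c (L x)"
    using T xs i unfolding list_operation_def by metis
  then show "G (T (xs[i := x + y])) (E ds) = G (T (xs[i := x])) (E ds) + G (T (xs[i := y])) (E ds) \<and>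
      G (T (xs[i := scale c x])) (E ds) = c * G (T (xs[i := x])) (E ds)"
    using graded_multilinearD[OF G T'] x y by simp
qed

text \<open>Used both for the factors, with multiplication, and for their degrees, with addition.\<close>

definition merge :: "('b \<Rightarrow> 'b \<Rightarrow> 'b) \<Rightarrow> nat \<Rightarrow> 'b list \<Rightarrow> 'b list" where
  "merge g i xs = take i xs @ g (xs ! i) (xs ! Suc i) # drop (i + 2) xs"

lemma sum_list_merge: "Suc i < length ds \<Longrightarrow> sum_list (merge (+) i ds) = sum_list (ds :: nat list)"
proof -
  assume i: "Suc i < length ds"
  then have "ds = take i ds @ ds ! i # ds ! Suc i # drop (i + 2) ds"
    by (metis Cons_nth_drop_Suc Suc_lessD add_2_eq_Suc' append_take_drop_id)
  then have "sum_list ds = sum_list (take i ds @ ds ! i # ds ! Suc i # drop (i + 2) ds)"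
    by simp
  then show ?thesis by (simp add: merge_def)
qed

lemma length_merge [simp]: "Suc i < length xs \<Longrightarrow> length (merge g i xs) = length xs - 1"
  by (simp add: merge_def)

lemma nth_merge:
  "Suc i < length xs \<Longrightarrow> j < length xs - 1 \<Longrightarrow>
     merge g i xs ! j = (if j < i then xs ! j else if j = i then g (xs ! i) (xs ! Suc i) else xs ! Suc j)"
  by (auto simp: merge_def nth_append nth_Cons' min_def)

lemma list_operation_merge:
  assumes "i < n"
  shows "list_operation (Suc n) n (merge (*) i) (merge (+) i)"
  unfolding list_operation_def
proof (intro allI impI conjI)
  fix m xs ds assume xs: "homogeneous (Suc n) m xs ds"
  have len: "length xs = Suc n" "length ds = Suc n"
    using homogeneous_length[OF xs] by auto
  have A: "xs ! k \<in> A (ds ! k)" if "k < Suc n" for k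
    by (rule homogeneous_nth[OF xs that])
  have *: "xs ! i * xs ! Suc i \<in> A (ds ! i + ds ! Suc i)"
    by (rule mult_A) (use A assms in auto)
  show "homogeneous n m (merge (*) i xs) (merge (+) i ds)"
    using assms len A * xs by (auto simp: homogeneous_iff nth_merge sum_list_merge)
  fix k assume k: "k < Suc n"
  define j where "j = (if k \<le> i then k else k - 1)"
  define L where "L z = (if k = i then z * xs ! Suc i else if k = Suc i then xs ! i * z else z)" for z
  have j: "j < n"
    using k assms by (auto simp: j_def)
  have "merge (*) i (xs[k := z]) = (merge (*) i xs)[j := L z]" for z
    by (rule nth_equalityI)
      (use k assms len in \<open>auto simp: nth_merge j_def L_def nth_list_update split: if_splits\<close>)
  moreover have "L z \<in> A (merge (+) i ds ! j)" if "z \<in> A (ds ! k)" for z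
    using that j k assms len A mult_A by (auto simp: nth_merge j_def L_def)
  moreover have "L (x + y) = L x + L y" "L (scale c x) = scale c (L x)" for x y c
    by (auto simp: L_def algebra_simps scale_mult_left scale_mult_right)
  ultimately show "\<exists>j<n. \<exists>L. (\<forall>z. merge (*) i (xs[k := z]) = (merge (*) i xs)[j := L z]) \<and>
          (\<forall>z\<in>A (ds ! k). L z \<in> A (merge (+) i ds ! j)) \<and>
          (\<forall>x y. L (x + y) = L x + L y) \<and> (\<forall>c x. L (scale c x) = scale c (L x))"
    using j by blast
qed

definition rotate_last :: "'b list \<Rightarrow> 'b list" where
  "rotate_last xs = last xs # butlast xs"

lemma nth_rotate_last:
  "length xs = Suc n \<Longrightarrow> j < Suc n \<Longrightarrow> rotate_last xs ! j = (if j = 0 then xs ! n else xs ! (j - 1))"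
  by (cases "xs = []") (auto simp: rotate_last_def nth_Cons' nth_butlast last_conv_nth)

lemma length_rotate_last [simp]: "xs \<noteq> [] \<Longrightarrow> length (rotate_last xs) = length xs"
  by (simp add: rotate_last_def)

lemma sum_list_rotate_last: "xs \<noteq> [] \<Longrightarrow> sum_list (rotate_last xs) = sum_list (xs :: nat list)"
  by (metis add.commute append_butlast_last_id rotate_last_def sum_list.Cons sum_list.Nil
      sum_list_append add_0_right)

lemma list_operation_rotate_last: "list_operation (Suc n) (Suc n) rotate_last rotate_last"
  unfolding list_operation_def
proof (intro allI impI conjI)
  fix m xs ds assume xs: "homogeneous (Suc n) m xs ds"
  have len: "length xs = Suc n" "length ds = Suc n" and ne: "xs \<noteq> []" "ds \<noteq> []"
    using homogeneous_length[OF xs] by auto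
  have A: "xs ! k \<in> A (ds ! k)" if "k < Suc n" for k
    by (rule homogeneous_nth[OF xs that])
  show "homogeneous (Suc n) m (rotate_last xs) (rotate_last ds)"
    using len ne A xs by (auto simp: homogeneous_iff nth_rotate_last sum_list_rotate_last)
  fix k assume k: "k < Suc n"
  define j where "j = (if k = n then 0 else Suc k)"
  have j: "j < Suc n"
    using k by (auto simp: j_def)
  have "rotate_last (xs[k := z]) = (rotate_last xs)[j := z]" for z
    by (rule nth_equalityI)
      (use k len ne in \<open>auto simp: nth_rotate_last j_def nth_list_update split: if_splits\<close>)
  moreover have "z \<in> A (rotate_last ds ! j)" if "z \<in> A (ds ! k)" for z
    using that j k len A by (auto simp: nth_rotate_last j_def)
  ultimately show "\<exists>j<Suc n. \<exists>L. (\<forall>z. rotate_last (xs[k := z]) = (rotate_last xs)[j := L z]) \<and>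
          (\<forall>z\<in>A (ds ! k). L z \<in> A (rotate_last ds ! j)) \<and>
          (\<forall>x y. L (x + y) = L x + L y) \<and> (\<forall>c x. L (scale c x) = scale c (L x))"
    using j by (intro exI[of _ j] conjI exI[of _ "\<lambda>z. z"]) auto
qed

lemma list_operation_append_one: "list_operation n (Suc n) (\<lambda>xs. xs @ [1]) (\<lambda>ds. ds @ [0])"
  unfolding list_operation_def
proof (intro allI impI conjI)
  fix m xs ds assume xs: "homogeneous n m xs ds"
  have len: "length xs = n" "length ds = n"
    using homogeneous_length[OF xs] by auto
  show "homogeneous (Suc n) m (xs @ [1]) (ds @ [0])"
    using xs one_A by (auto simp: homogeneous_iff nth_append less_Suc_eq)
  fix k assume k: "k < n"
  then show "\<exists>j<Suc n. \<exists>L. (\<forall>z. xs[k := z] @ [1] = (xs @ [1])[j := L z]) \<and>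
          (\<forall>z\<in>A (ds ! k). L z \<in> A ((ds @ [0]) ! j)) \<and>
          (\<forall>x y. L (x + y) = L x + L y) \<and> (\<forall>c x. L (scale c x) = scale c (L x))"
    using len by (intro exI[of _ k] conjI exI[of _ "\<lambda>z. z"]) (auto simp: list_update_append nth_append)
qed

text \<open>Linearity is restricted to \<open>C n m\<close>: outside it the formulas for \<open>b\<close>, \<open>\<tau>\<close> and \<open>s\<close> describe no
  cochain.\<close>

definition cochain_operator ::
    "nat \<Rightarrow> nat \<Rightarrow> nat \<Rightarrow> nat \<Rightarrow> ((('a list \<Rightarrow>\<^sub>0 'k) set \<Rightarrow> 'k) \<Rightarrow> ('a list \<Rightarrow>\<^sub>0 'k) set \<Rightarrow> 'k) \<Rightarrow> bool"
  where
  "cochain_operator n m n' m' T \<longleftrightarrow>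
     (\<forall>f\<in>C n m. T f \<in> C n' m') \<and>
     (\<forall>f\<in>C n m. \<forall>g\<in>C n m. T (f + g) = T f + T g) \<and>
     (\<forall>c. \<forall>f\<in>C n m. T (\<lambda>t. c * f t) = (\<lambda>t. c * T f t))"

lemma cochain_operatorD:
  assumes "cochain_operator n m n' m' T"
  shows "f \<in> C n m \<Longrightarrow> T f \<in> C n' m'"
    and "f \<in> C n m \<Longrightarrow> g \<in> C n m \<Longrightarrow> T (f + g) = T f + T g"
    and "f \<in> C n m \<Longrightarrow> T (\<lambda>t. c * f t) = (\<lambda>t. c * T f t)"
  using assms unfolding cochain_operator_def by auto

lemma cochain_operator_zero:
  assumes "cochain_operator n m n' m' T"
  shows "T 0 = 0"
proof -
  have "T (\<lambda>t. 0 * 0) = (\<lambda>t. 0 * T (\<lambda>_. 0) t)"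
    using cochain_operatorD(3)[OF assms, of "\<lambda>_. 0" 0] C_zero by (simp add: zero_fun_def)
  then show ?thesis by (simp add: zero_fun_def)
qed

lemma cochain_operator_cochain:
  assumes "\<And>f. f \<in> C n m \<Longrightarrow> graded_multilinear (Suc n') m' (\<Phi> f)"
    and "\<And>f g xs ds. f \<in> C n m \<Longrightarrow> g \<in> C n m \<Longrightarrow> homogeneous (Suc n') m' xs ds \<Longrightarrow>
      \<Phi> (f + g) xs ds = \<Phi> f xs ds + \<Phi> g xs ds"
    and "\<And>c f xs ds. f \<in> C n m \<Longrightarrow> homogeneous (Suc n') m' xs ds \<Longrightarrow>
      \<Phi> (\<lambda>t. c * f t) xs ds = c * \<Phi> f xs ds"
  shows "cochain_operator n m n' m' (\<lambda>f. cochain n' m' (\<Phi> f))"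
  unfolding cochain_operator_def
proof (intro conjI ballI allI)
  fix f assume f: "f \<in> C n m"
  show "cochain n' m' (\<Phi> f) \<in> C n' m'"
    by (rule cochain_mem[OF assms(1)[OF f]])
  show "cochain n' m' (\<Phi> (f + g)) = cochain n' m' (\<Phi> f) + cochain n' m' (\<Phi> g)" if g: "g \<in> C n m" for g
    by (rule C_eqI) (auto intro!: C_add cochain_mem assms(1) C_add f g
        simp: cochain_pure assms(1,2) C_add f g)
  show "cochain n' m' (\<Phi> (\<lambda>t. c * f t)) = (\<lambda>t. c * cochain n' m' (\<Phi> f) t)" for c
    by (rule C_eqI) (auto intro!: C_scale cochain_mem assms(1) f
        simp: cochain_pure assms(1,3) C_scale f)
qed

lemma cochain_operator_id: "cochain_operator n m n m (\<lambda>f. f)"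
  by (simp add: cochain_operator_def)

lemma cochain_operator_comp:
  assumes "cochain_operator n m n' m' S" and "cochain_operator n' m' n'' m'' T"
  shows "cochain_operator n m n'' m'' (\<lambda>f. T (S f))"
  using assms unfolding cochain_operator_def by simp

lemma cochain_operator_diff:
  assumes "cochain_operator n m n' m' S" and "cochain_operator n m n' m' T"
  shows "cochain_operator n m n' m' (\<lambda>f. S f - T f)"
  using assms unfolding cochain_operator_def
  by (auto simp: C_diff algebra_simps fun_eq_iff)

lemma cochain_operator_sum:
  assumes "\<And>i. i \<in> I \<Longrightarrow> cochain_operator n m n' m' (T i)"
  shows "cochain_operator n m n' m' (\<lambda>f. \<Sum>i\<in>I. T i f)"
proof (cases "finite I")
  case True
  then show ?thesis
    using assms
  proof (induction I)
    case empty
    then show ?case by (simp add: cochain_operator_def zero_fun_def flip: zero_fun_def)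
  next
    case (insert i I)
    then have "cochain_operator n m n' m' (T i)" "cochain_operator n m n' m' (\<lambda>f. \<Sum>i\<in>I. T i f)"
      by auto
    then show ?case
      unfolding sum.insert[OF insert(1,2)] cochain_operator_def
      by (auto simp: C_add algebra_simps fun_eq_iff)
  qed
qed (simp add: cochain_operator_def zero_fun_def flip: zero_fun_def)

lemma hoch_b_formula:
  assumes f: "f \<in> C n m"
  shows "graded_multilinear (Suc (Suc n)) m (\<lambda>xs ds.
     (\<Sum>i<Suc n. (-1) ^ i * f (pure (merge (*) i xs))) +
     (-1) ^ (Suc n + gam ds) * f (pure (merge (*) 0 (rotate_last xs))))"
proof (intro graded_multilinear_add graded_multilinear_sum graded_multilinear_mult)
  note pure = graded_multilinear_pure[OF f]
  show "graded_multilinear (Suc (Suc n)) m (\<lambda>xs ds. f (pure (merge (*) i xs)))" if "i \<in> {..<Suc n}" for i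
    by (rule graded_multilinear_list_operation[OF pure list_operation_merge]) (use that in simp)
  show "graded_multilinear (Suc (Suc n)) m (\<lambda>xs ds. f (pure (merge (*) 0 (rotate_last xs))))"
    by (rule graded_multilinear_list_operation[OF
          graded_multilinear_list_operation[OF pure list_operation_merge] list_operation_rotate_last]) simp
qed

text \<open>The last summand of \<open>b\<close> is the first face of the rotated list, which reduces it to the two list
  operations at hand.\<close>

lemma hoch_b_eq:
  "hoch_b n m f = cochain (Suc n) m (\<lambda>xs ds.
     (\<Sum>i<Suc n. (-1) ^ i * f (pure (merge (*) i xs))) +
     (-1) ^ (Suc n + gam ds) * f (pure (merge (*) 0 (rotate_last xs))))"
proof -
  have "(last xs * hd xs) # butlast (tl xs) = merge (*) 0 (rotate_last xs)"
    if xs: "homogeneous (Suc (Suc n)) m xs ds" for xs ds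
  proof -
    obtain x y zs where "xs = x # y # zs"
      using homogeneous_length[OF xs] by (metis length_Suc_conv)
    then show ?thesis
      by (cases zs rule: rev_cases) (auto simp: merge_def rotate_last_def butlast_append)
  qed
  then show ?thesis
    unfolding hoch_b_def cochain_def merge_def by (intro arg_cong[where f = The] ext) (auto simp: merge_def)
qed

lemma cochain_operator_hoch_b: "cochain_operator n m (Suc n) m (hoch_b n m)"
  unfolding hoch_b_eq[abs_def]
  by (rule cochain_operator_cochain[OF hoch_b_formula])
    (simp_all add: algebra_simps sum.distrib sum_distrib_left del: sum.lessThan_Suc)

lemma hoch_b_pure:
  assumes "f \<in> C n m" and "homogeneous (Suc (Suc n)) m xs ds"
  shows "hoch_b n m f (pure xs) = (\<Sum>i<Suc n. (-1) ^ i * f (pure (merge (*) i xs))) +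
     (-1) ^ (Suc n + gam ds) * f (pure (merge (*) 0 (rotate_last xs)))"
  unfolding hoch_b_eq by (rule cochain_pure[OF hoch_b_formula[OF assms(1)] assms(2)])

lemma cyc_formula:
  "f \<in> C n m \<Longrightarrow>
    graded_multilinear (Suc n) m (\<lambda>xs ds. (-1) ^ (n + gam ds) * f (pure (last xs # butlast xs)))"
  unfolding rotate_last_def[symmetric]
  by (intro graded_multilinear_mult
      graded_multilinear_list_operation[OF graded_multilinear_pure list_operation_rotate_last])

lemma cochain_operator_cyc: "cochain_operator n m n m (cyc n m)"
  unfolding cyc_def[abs_def]
  by (rule cochain_operator_cochain[OF cyc_formula]) (simp_all add: algebra_simps)

lemma cyc_pure:
  "f \<in> C n m \<Longrightarrow> homogeneous (Suc n) m xs ds \<Longrightarrow>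
     cyc n m f (pure xs) = (-1) ^ (n + gam ds) * f (pure (last xs # butlast xs))"
  unfolding cyc_def by (rule cochain_pure[OF cyc_formula])

lemma ext_s_formula:
  "f \<in> C (Suc n) m \<Longrightarrow> graded_multilinear (Suc n) m (\<lambda>xs ds. (-1) ^ n * f (pure (xs @ [1])))"
  by (intro graded_multilinear_mult
      graded_multilinear_list_operation[OF graded_multilinear_pure list_operation_append_one])

lemma cochain_operator_ext_s: "cochain_operator (Suc n) m n m (ext_s n m)"
  unfolding ext_s_def[abs_def]
  by (rule cochain_operator_cochain[OF ext_s_formula]) (simp_all add: algebra_simps)

lemma ext_s_pure:
  "f \<in> C (Suc n) m \<Longrightarrow> homogeneous (Suc n) m xs ds \<Longrightarrow>
     ext_s n m f (pure xs) = (-1) ^ n * f (pure (xs @ [1]))"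
  unfolding ext_s_def by (rule cochain_pure[OF ext_s_formula])

lemma cochain_operator_cyc_N: "cochain_operator n m n m (cyc_N n m)"
  unfolding cyc_N_def[abs_def]
proof (rule cochain_operator_sum)
  fix i
  show "cochain_operator n m n m ((cyc n m ^^ i))"
    by (induction i) (auto simp: o_def intro: cochain_operator_id[unfolded id_def[symmetric]]
        cochain_operator_comp[OF _ cochain_operator_cyc] simp: id_def[symmetric])
qed

lemma cochain_operator_ext_B: "cochain_operator (Suc n) m n m (ext_B n m)"
  unfolding ext_B_def[abs_def]
  by (intro cochain_operator_comp[OF _ cochain_operator_cyc_N]
      cochain_operator_comp[OF _ cochain_operator_ext_s]
      cochain_operator_diff cochain_operator_id cochain_operator_cyc)

subsection \<open>The differential of a tensor power\<close>

text \<open>The sign \<open>(-1)\<^bsup>\<bar>a\<^sub>1\<bar> + \<dots> + \<bar>a\<^sub>i\<bar>\<^esup>\<close> is distributed over the first factors by the grading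
  involution. In this form the summand is defined for all factors and linear in each.\<close>

definition phi_term :: "'a list \<Rightarrow> nat \<Rightarrow> 'a list" where
  "phi_term xs i = map sgn_op (take i xs) @ \<phi> (xs ! i) # drop (Suc i) xs"

definition phi_sum :: "'a list \<Rightarrow> ('a list \<Rightarrow>\<^sub>0 'k)" where
  "phi_sum xs = (\<Sum>i<length xs. fbasis (phi_term xs i))"

lemma length_phi_term: "i < length xs \<Longrightarrow> length (phi_term xs i) = length xs"
  by (simp add: phi_term_def)

text \<open>The map \<open>L\<close> is the grading involution, \<open>\<phi>\<close> or the identity, according as the varied factor lies
  before, at or after position \<open>i\<close>.\<close>

lemma phi_term_multilinear:
  fixes us vs :: "'a list"
  assumes "i < length us + 1 + length vs"
  obtains us' vs' L where "\<And>z. phi_term (us @ z # vs) i = us' @ L z # vs'"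
    and "length us' + 1 + length vs' = length us + 1 + length vs"
    and "\<And>x y. L (x + y) = L x + L y" and "\<And>c x. L (scale c x) = scale c (L x)"
proof -
  consider "i < length us" | "i = length us" | "i > length us" by linarith
  then show thesis
  proof cases
    case 1
    have "phi_term (us @ z # vs) i = (map sgn_op (take i us) @ \<phi> (us ! i) # drop (Suc i) us) @ z # vs" for z
      using 1 by (simp add: phi_term_def nth_append)
    then show ?thesis
      by (rule that[of _ "\<lambda>z. z"]) (use 1 in auto)
  next
    case 2
    have "phi_term (us @ z # vs) i = map sgn_op us @ \<phi> z # vs" for z
      using 2 by (simp add: phi_term_def)
    then show ?thesis
      by (rule that[of _ \<phi>]) (auto simp: phi_add phi_scale)
  next
    case 3
    define j where "j = i - Suc (length us)"
    have i: "i = Suc (length us) + j" "j < length vs"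
      using 3 assms by (auto simp: j_def)
    have "phi_term (us @ z # vs) i =
        map sgn_op us @ sgn_op z # (map sgn_op (take j vs) @ \<phi> (vs ! j) # drop (Suc j) vs)" for z
      by (simp add: phi_term_def i nth_append)
    then show ?thesis
      by (rule that[of _ sgn_op]) (use i in \<open>auto simp: sgn_op_add sgn_op_scale\<close>)
  qed
qed

lemma linear_ext_phi_sum_tensor_rel:
  assumes "p \<in> tensor_rel n"
  shows "linear_ext fscale phi_sum p \<in> tensor_rel n"
proof (rule linear_ext_tensor_rel[OF free.vector_space_axioms subspace_tensor_rel _ _ assms])
  fix us vs :: "'a list" and x y assume n: "length us + 1 + length vs = n"
  have "fbasis (phi_term (us @ (x + y) # vs) i) - fbasis (phi_term (us @ x # vs) i) -
      fbasis (phi_term (us @ y # vs) i) \<in> tensor_rel n" if i: "i < n" for i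
  proof -
    obtain us' vs' L where L: "\<And>z. phi_term (us @ z # vs) i = us' @ L z # vs'"
      "length us' + 1 + length vs' = length us + 1 + length vs" "\<And>x y. L (x + y) = L x + L y"
      using phi_term_multilinear[of i us vs] i n by metis
    show ?thesis
      unfolding L(1,3) by (rule tensor_rel_add) (use L(2) n in simp)
  qed
  then have "(\<Sum>i<n. fbasis (phi_term (us @ (x + y) # vs) i) - fbasis (phi_term (us @ x # vs) i) -
      fbasis (phi_term (us @ y # vs) i)) \<in> tensor_rel n"
    by (intro free.subspace_sum[OF subspace_tensor_rel]) auto
  then show "phi_sum (us @ (x + y) # vs) - phi_sum (us @ x # vs) - phi_sum (us @ y # vs) \<in> tensor_rel n"
    using n by (simp add: phi_sum_def sum_subtractf)
next
  fix us vs :: "'a list" and c x assume n: "length us + 1 + length vs = n"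
  have "fbasis (phi_term (us @ scale c x # vs) i) - fscale c (fbasis (phi_term (us @ x # vs) i))
      \<in> tensor_rel n" if i: "i < n" for i
  proof -
    obtain us' vs' L where L: "\<And>z. phi_term (us @ z # vs) i = us' @ L z # vs'"
      "length us' + 1 + length vs' = length us + 1 + length vs" "\<And>c x. L (scale c x) = scale c (L x)"
      using phi_term_multilinear[of i us vs] i n by metis
    show ?thesis
      unfolding L(1,3) by (rule tensor_rel_scale) (use L(2) n in simp)
  qed
  then have "(\<Sum>i<n. fbasis (phi_term (us @ scale c x # vs) i) -
      fscale c (fbasis (phi_term (us @ x # vs) i))) \<in> tensor_rel n"
    by (intro free.subspace_sum[OF subspace_tensor_rel]) auto
  then show "phi_sum (us @ scale c x # vs) - fscale c (phi_sum (us @ x # vs)) \<in> tensor_rel n"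
    using n by (simp add: phi_sum_def sum_subtractf free.scale_sum_right)
qed

text \<open>Modulo the relations the scalars \<open>(-1)\<^bsup>d\<^esup>\<close> of the single factors are pulled out one by one; \<open>ws\<close>
  collects the factors already treated.\<close>

lemma sgn_op_prefix:
  assumes "list_all2 (\<lambda>x d. x \<in> A d) us ds" and "length ws + length us + length vs = n"
  shows "fbasis (ws @ map sgn_op us @ vs) - fscale ((- 1) ^ sum_list ds) (fbasis (ws @ us @ vs))
    \<in> tensor_rel n"
  using assms
proof (induction us ds arbitrary: ws rule: list_all2_induct)
  case Nil
  then show ?case using free.subspace_0[OF subspace_tensor_rel] by simp
next
  case (Cons u us d ds)
  let ?s = "(- 1) ^ sum_list ds :: 'k" and ?u = "scale ((- 1) ^ d) u"
  have "fbasis ((ws @ [?u]) @ map sgn_op us @ vs) - fscale ?s (fbasis ((ws @ [?u]) @ us @ vs)) \<in> tensor_rel n"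
    using Cons.IH[of "ws @ [?u]"] Cons.prems by simp
  moreover have "fbasis (ws @ ?u # us @ vs) - fscale ((- 1) ^ d) (fbasis (ws @ u # us @ vs)) \<in> tensor_rel n"
    by (rule tensor_rel_scale) (use Cons in simp)
  then have "fscale ?s (fbasis (ws @ ?u # us @ vs) - fscale ((- 1) ^ d) (fbasis (ws @ u # us @ vs)))
      \<in> tensor_rel n"
    by (rule free.subspace_scale[OF subspace_tensor_rel])
  ultimately show ?case
    using free.subspace_add[OF subspace_tensor_rel] Cons(1)
    by (fastforce simp: sgn_op_homogeneous free.scale_right_diff_distrib power_add mult.commute)
qed

lemma phi_sum_homogeneous:
  assumes xs: "homogeneous n m xs ds"
  shows "phi_sum xs - (\<Sum>i<n. fscale ((- 1) ^ sum_list (take i ds)) (fbasis (xs[i := \<phi> (xs ! i)])))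
    \<in> tensor_rel n"
proof -
  have len: "length xs = n" "length ds = n"
    using homogeneous_length[OF xs] by auto
  have "fbasis (phi_term xs i) - fscale ((- 1) ^ sum_list (take i ds)) (fbasis (xs[i := \<phi> (xs ! i)]))
      \<in> tensor_rel n" if "i < n" for i
  proof -
    have "list_all2 (\<lambda>x d. x \<in> A d) (take i xs) (take i ds)"
      using xs by (auto simp: homogeneous_def intro: list_all2_takeI)
    from sgn_op_prefix[OF this, of "[]" "\<phi> (xs ! i) # drop (Suc i) xs" n] show ?thesis
      using that len by (simp add: phi_term_def upd_conv_take_nth_drop)
  qed
  then have "(\<Sum>i<n. fbasis (phi_term xs i) -
      fscale ((- 1) ^ sum_list (take i ds)) (fbasis (xs[i := \<phi> (xs ! i)]))) \<in> tensor_rel n"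
    by (intro free.subspace_sum[OF subspace_tensor_rel]) auto
  then show ?thesis
    by (simp add: phi_sum_def len sum_subtractf)
qed

lemma fbasis_list_span: "length xs = n \<Longrightarrow> fbasis xs \<in> list_span n"
  unfolding list_span_def by (rule free.span_base) blast

lemma subspace_list_span: "free.subspace (list_span n)"
  unfolding list_span_def by simp

text \<open>Splitting the factors into components from left to right writes every pure tensor as a sum of
  homogeneous ones. This makes the differential of a tensor power unique.\<close>

lemma homogeneous_lists_span:
  assumes "length xs = n"
  shows "fbasis xs \<in> free.span ({fbasis xs | xs. \<exists>m ds. homogeneous n m xs ds} \<union> tensor_rel n)"
proof -
  let ?S = "free.span ({fbasis xs | xs. \<exists>m ds. homogeneous n m xs ds} \<union> tensor_rel n)"
  have rel: "p \<in> ?S" if "p \<in> tensor_rel n" for p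
    using that by (auto intro: free.span_base)
  have "fbasis (us @ vs) \<in> ?S" if "\<forall>u\<in>set us. \<exists>d. u \<in> A d" "length us + length vs = n" for us vs
    using that
  proof (induction vs arbitrary: us)
    case Nil
    then obtain d where d: "\<And>u. u \<in> set us \<Longrightarrow> u \<in> A (d u)"
      by metis
    have "homogeneous n (sum_list (map d us)) us (map d us)"
      using Nil d by (auto simp: homogeneous_iff)
    then show ?case
      by (auto intro!: free.span_base)
  next
    case (Cons v vs)
    have n: "length us + 1 + length vs = n"
      using Cons.prems by simp
    have "fbasis (us @ (\<Sum>k\<in>M. component v k) # vs) \<in> ?S" if "finite M" for M
      using that
    proof (induction M)
      case empty
      then show ?case using rel[OF tensor_rel_zero[OF n]] by simp
    next
      case (insert k M)
      have "fbasis ((us @ [component v k]) @ vs) \<in> ?S"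
        by (rule Cons.IH) (use Cons.prems component_mem in auto)
      then have "fbasis (us @ component v k # vs) + fbasis (us @ (\<Sum>k\<in>M. component v k) # vs) \<in> ?S"
        using insert by (auto intro: free.span_add)
      from free.span_add[OF this rel[OF tensor_rel_add[OF n, of "component v k" "\<Sum>k\<in>M. component v k"]]]
      show ?case using insert by (simp add: algebra_simps)
    qed
    from this[OF finite_component[of v]] show ?case
      by (simp add: sum_component)
  qed
  from this[of "[]" xs] show ?thesis using assms by simp
qed

lemma vhom_class_zero:
  assumes "vhom (tensor_power n) (tensor_power n) h"
  shows "h (tensor_class n 0) = tensor_class n 0"
proof -
  note P = presents_tensor_power[of n]
  have 0: "0 \<in> list_span n"
    using free.subspace_0[OF subspace_list_span] .
  have zero: "vscale (tensor_power n) 0 t = tensor_class n 0" if "t \<in> vcarrier (tensor_power n)" for t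
    using that free_sub.presentsD(4)[OF P, of _ 0] free_sub.presentsD(5)[OF P] by auto
  have t: "tensor_class n 0 \<in> vcarrier (tensor_power n)"
    by (rule free_sub.presentsD(2)[OF P 0])
  then have "h (vscale (tensor_power n) 0 (tensor_class n 0)) = vscale (tensor_power n) 0 (h (tensor_class n 0))"
    and "h (tensor_class n 0) \<in> vcarrier (tensor_power n)"
    using assms unfolding vhom_def by auto
  then show ?thesis using zero t by metis
qed

text \<open>The linear extension of \<open>phi_sum\<close> induces the required map, and by \<open>homogeneous_lists_span\<close> it is
  the only one; so the definite description denotes it.\<close>

lemma phi_tensor:
  shows vhom_phi_tensor: "vhom (tensor_power n) (tensor_power n) (phi_tensor n)"
    and phi_tensor_pure: "homogeneous n m xs ds \<Longrightarrow> phi_tensor n (pure xs) = tensor_class n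
          (\<Sum>i<n. fscale ((-1) ^ sum_list (take i ds)) (fbasis (xs[i := \<phi> (xs ! i)])))"
proof -
  define P where "P h \<longleftrightarrow> vhom (tensor_power n) (tensor_power n) h \<and>
     h \<in> extensional (vcarrier (tensor_power n)) \<and>
     (\<forall>m xs ds. homogeneous n m xs ds \<longrightarrow> h (pure xs) = tensor_class n
          (\<Sum>i<n. fscale ((-1) ^ sum_list (take i ds)) (fbasis (xs[i := \<phi> (xs ! i)]))))" for h
  note TP = presents_tensor_power[of n]
  let ?\<Phi> = "linear_ext fscale phi_sum :: ('a list \<Rightarrow>\<^sub>0 'k) \<Rightarrow> _"
  interpret l: Vector_Spaces.linear fscale fscale ?\<Phi>
    by (rule linear_linear_ext[OF free.vector_space_axioms])
  have \<Phi>_fbasis: "?\<Phi> (fbasis xs) = phi_sum xs" for xs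
    by (rule linear_ext_fbasis[OF free.vector_space_axioms])
  have \<Phi>_mem: "?\<Phi> p \<in> list_span n" if "p \<in> list_span n" for p
  proof -
    have "list_span n \<subseteq> {p. ?\<Phi> p \<in> list_span n}"
      unfolding list_span_def[of n]
    proof (rule free.span_minimal)
      show "{fbasis xs |xs. length xs = n}
          \<subseteq> {p. ?\<Phi> p \<in> free.span {fbasis xs |xs. length xs = n}}"
        unfolding list_span_def[symmetric]
        by (auto simp: \<Phi>_fbasis phi_sum_def length_phi_term
            intro!: free.subspace_sum[OF subspace_list_span] fbasis_list_span)
    qed (rule l.subspace_linear_preimage, simp)
    then show ?thesis using that by blast
  qed
  obtain f where f: "\<And>p. p \<in> list_span n \<Longrightarrow> f (tensor_class n p) = tensor_class n (?\<Phi> p)"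
  proof (rule free_sub.presents_factor[OF TP])
    show "tensor_class n (?\<Phi> p) = tensor_class n (?\<Phi> q)" if "p - q \<in> tensor_rel n" for p q
      using linear_ext_phi_sum_tensor_rel[OF that] by (simp add: tensor_class_eq_iff l.diff)
  qed blast
  define h where "h = restrict f (vcarrier (tensor_power n))"
  have h: "h (tensor_class n p) = tensor_class n (?\<Phi> p)" if "p \<in> list_span n" for p
    using f[OF that] free_sub.presentsD(2)[OF TP that] by (simp add: h_def)
  have "vhom (tensor_power n) (tensor_power n) h"
    unfolding vhom_def free_sub.presentsD(5)[OF TP]
  proof (intro conjI ballI allI)
    show "h \<in> tensor_class n ` list_span n \<rightarrow> tensor_class n ` list_span n"
      using h \<Phi>_mem by auto
  next
    fix t u assume "t \<in> tensor_class n ` list_span n" "u \<in> tensor_class n ` list_span n"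
    then obtain p q where pq: "p \<in> list_span n" "q \<in> list_span n" "t = tensor_class n p" "u = tensor_class n q"
      by blast
    show "h (vadd (tensor_power n) t u) = vadd (tensor_power n) (h t) (h u)"
      unfolding pq(3,4) free_sub.presentsD(3)[OF TP pq(1,2), symmetric] h[OF pq(1)] h[OF pq(2)]
        h[OF free.subspace_add[OF subspace_list_span pq(1,2)]] l.add
      by (rule free_sub.presentsD(3)[OF TP \<Phi>_mem[OF pq(1)] \<Phi>_mem[OF pq(2)]])
  next
    fix c t assume "t \<in> tensor_class n ` list_span n"
    then obtain p where p: "p \<in> list_span n" "t = tensor_class n p"
      by blast
    show "h (vscale (tensor_power n) c t) = vscale (tensor_power n) c (h t)"
      unfolding p(2) free_sub.presentsD(4)[OF TP p(1), symmetric] h[OF p(1)]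
        h[OF free.subspace_scale[OF subspace_list_span p(1)]] l.scale
      by (rule free_sub.presentsD(4)[OF TP \<Phi>_mem[OF p(1)]])
  qed
  moreover have "h \<in> extensional (vcarrier (tensor_power n))"
    by (simp add: h_def)
  moreover have "h (pure xs) = tensor_class n
      (\<Sum>i<n. fscale ((-1) ^ sum_list (take i ds)) (fbasis (xs[i := \<phi> (xs ! i)])))"
    if xs: "homogeneous n m xs ds" for m xs ds
  proof -
    have len: "length xs = n"
      using homogeneous_length[OF xs] by simp
    have "h (pure xs) = tensor_class n (phi_sum xs)"
      unfolding pure_def len using h[OF fbasis_list_span[OF len]] by (simp add: \<Phi>_fbasis)
    then show ?thesis
      using phi_sum_homogeneous[OF xs] by (simp add: tensor_class_eq_iff)
  qed
  ultimately have Ph: "P h"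
    unfolding P_def by blast
  have "g = h" if g: "P g" for g
  proof -
    let ?E = "{p \<in> list_span n. g (tensor_class n p) = h (tensor_class n p)}"
    have vh: "vhom (tensor_power n) (tensor_power n) h" "vhom (tensor_power n) (tensor_power n) g"
      using Ph g by (auto simp: P_def)
    have E: "free.subspace ?E"
    proof (rule free.subspaceI)
      show "0 \<in> ?E"
        using vhom_class_zero[OF vh(1)] vhom_class_zero[OF vh(2)] free.subspace_0[OF subspace_list_span] by simp
    next
      fix p q assume "p \<in> ?E" "q \<in> ?E"
      then have pq: "p \<in> list_span n" "q \<in> list_span n"
        "g (tensor_class n p) = h (tensor_class n p)" "g (tensor_class n q) = h (tensor_class n q)" by auto
      then show "p + q \<in> ?E"
        using vh free_sub.presentsD(2)[OF TP] free.subspace_add[OF subspace_list_span pq(1,2)]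
        unfolding vhom_def by (simp add: free_sub.presentsD(3)[OF TP])
    next
      fix c p assume "p \<in> ?E"
      then have p: "p \<in> list_span n" "g (tensor_class n p) = h (tensor_class n p)" by auto
      then show "fscale c p \<in> ?E"
        using vh free_sub.presentsD(2)[OF TP] free.subspace_scale[OF subspace_list_span p(1)]
        unfolding vhom_def by (simp add: free_sub.presentsD(4)[OF TP])
    qed
    have "tensor_rel n \<subseteq> ?E"
    proof
      fix p assume p: "p \<in> tensor_rel n"
      then have "tensor_class n p = tensor_class n 0"
        by (simp add: tensor_class_eq_iff)
      then show "p \<in> ?E"
        using free.subspace_0[OF E] tensor_rel_subset p by auto
    qed
    moreover have "fbasis xs \<in> ?E" if xs: "homogeneous n m xs ds" for xs m ds
    proof -
      have len: "length xs = n"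
        using homogeneous_length[OF xs] by simp
      have "g (pure xs) = h (pure xs)"
        using Ph g xs unfolding P_def by simp
      then show ?thesis
        using fbasis_list_span[OF len] by (simp add: pure_def len)
    qed
    ultimately have S: "free.span ({fbasis xs | xs. \<exists>m ds. homogeneous n m xs ds} \<union> tensor_rel n) \<subseteq> ?E"
      by (intro free.span_minimal[OF _ E]) blast
    have "list_span n \<subseteq> ?E"
      unfolding list_span_def by (rule free.span_minimal)
        (use S homogeneous_lists_span E in \<open>auto simp: list_span_def\<close>)
    then have "g t = h t" if "t \<in> vcarrier (tensor_power n)" for t
      using that unfolding free_sub.presentsD(5)[OF TP] by blast
    moreover have "g \<in> extensional (vcarrier (tensor_power n))"
      "h \<in> extensional (vcarrier (tensor_power n))"
      using Ph g unfolding P_def by simp_all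
    ultimately show "g = h"
      by (intro extensionalityI) 
  qed
  with Ph have "P (THE h. P h)"
    by (rule theI)
  then have "P (phi_tensor n)"
    unfolding phi_tensor_def P_def .
  then show "vhom (tensor_power n) (tensor_power n) (phi_tensor n)"
    and "homogeneous n m xs ds \<Longrightarrow> phi_tensor n (pure xs) = tensor_class n
          (\<Sum>i<n. fscale ((-1) ^ sum_list (take i ds)) (fbasis (xs[i := \<phi> (xs ! i)])))"
    unfolding P_def by auto
qed

text \<open>Factors of degree \<open>0\<close> are killed by \<open>\<phi>\<close>. Their summands vanish in the tensor power but, as
  elements of the free vector space, need not lie in the span of the lists of total degree one
  less; dropping them leaves a representative that does.\<close>

definition phi_homogeneous :: "'a list \<Rightarrow> nat list \<Rightarrow> ('a list \<Rightarrow>\<^sub>0 'k)" where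
  "phi_homogeneous xs ds = (\<Sum>i | i < length xs \<and> ds ! i > 0.
     fscale ((-1) ^ sum_list (take i ds)) (fbasis (xs[i := \<phi> (xs ! i)])))"

lemma homogeneous_phi:
  assumes xs: "homogeneous n (Suc m) xs ds" and "i < n" and "ds ! i > 0"
  shows "homogeneous n m (xs[i := \<phi> (xs ! i)]) (ds[i := ds ! i - 1])"
proof -
  have len: "length xs = n" "length ds = n" and sum: "sum_list ds = Suc m"
    using xs by (auto simp: homogeneous_iff)
  have "\<phi> (xs ! i) \<in> A (ds ! i - 1)"
    using phi_Suc[of "xs ! i" "ds ! i - 1"] homogeneous_nth[OF xs assms(2)] assms(3) by simp
  moreover have "sum_list (ds[i := ds ! i - 1]) = m"
    using sum_list_update[of i ds "ds ! i - 1"] assms(2,3) len sum member_le_sum_list[of "ds ! i" ds]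
    by simp
  ultimately show ?thesis
    using len assms(2) homogeneous_nth[OF xs] by (auto simp: homogeneous_iff nth_list_update)
qed

lemma phi_homogeneous_mem:
  assumes "homogeneous n (Suc m) xs ds"
  shows "phi_homogeneous xs ds \<in> homogeneous_span n m"
  unfolding phi_homogeneous_def homogeneous_span_def
  using homogeneous_phi[OF assms] homogeneous_length[OF assms]
  by (intro free.span_sum free.span_scale free.span_base) blast

lemma pure_zero:
  assumes "i < length xs" and "xs ! i = 0"
  shows "pure xs = tensor_class (length xs) 0"
proof -
  have "fbasis (take i xs @ 0 # drop (Suc i) xs) \<in> tensor_rel (length xs)"
    by (rule tensor_rel_zero) (use assms in simp)
  moreover have "take i xs @ 0 # drop (Suc i) xs = xs"
    using assms by (metis id_take_nth_drop)
  ultimately show ?thesis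
    by (simp add: pure_def tensor_class_eq_iff)
qed

lemma phi_tensor_pure_homogeneous:
  assumes xs: "homogeneous n m xs ds"
  shows "phi_tensor n (pure xs) = tensor_class n (phi_homogeneous xs ds)"
proof -
  have len: "length xs = n" "length ds = n"
    using homogeneous_length[OF xs] by auto
  let ?t = "\<lambda>i. fscale ((-1) ^ sum_list (take i ds)) (fbasis (xs[i := \<phi> (xs ! i)])) :: 'a list \<Rightarrow>\<^sub>0 'k"
  have "?t i \<in> tensor_rel n" if i: "i < n" "ds ! i = 0" for i
  proof -
    have "\<phi> (xs ! i) = 0"
      using homogeneous_nth[OF xs i(1)] i(2) phi_0 by simp
    then have "fbasis (xs[i := \<phi> (xs ! i)]) \<in> tensor_rel n"
      using tensor_rel_zero[of "take i xs" "drop (Suc i) xs" n] i(1) len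
      by (simp add: upd_conv_take_nth_drop)
    then show ?thesis by (rule free.subspace_scale[OF subspace_tensor_rel])
  qed
  then have "(\<Sum>i | i < n \<and> ds ! i = 0. ?t i) \<in> tensor_rel n"
    by (intro free.subspace_sum[OF subspace_tensor_rel]) auto
  moreover have "(\<Sum>i<n. ?t i) = phi_homogeneous xs ds + (\<Sum>i | i < n \<and> ds ! i = 0. ?t i)"
    unfolding phi_homogeneous_def len
    by (subst sum.union_disjoint[symmetric]) (auto intro!: sum.cong)
  ultimately show ?thesis
    unfolding phi_tensor_pure[OF xs] tensor_class_eq_iff by simp
qed

lemma phi_tensor_mem:
  assumes "t \<in> vcarrier (tensor_power_deg n (Suc m))"
  shows "phi_tensor n t \<in> vcarrier (tensor_power_deg n m)"
proof -
  note TP = presents_tensor_power[of n] and TD = presents_tensor_power_deg[of n]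
  note vh = vhom_phi_tensor[of n, unfolded vhom_def]
  have sub: "free.subspace (homogeneous_span n k)" for k
    by (rule free_sub.presentsD(1)[OF TD])
  obtain p where p: "p \<in> homogeneous_span n (Suc m)" "t = tensor_class n p"
    using assms unfolding free_sub.presentsD(5)[OF TD] by blast
  have "p \<in> homogeneous_span n (Suc m) \<and>
      (\<exists>q\<in>homogeneous_span n m. phi_tensor n (tensor_class n p) = tensor_class n q)"
    using p(1)[unfolded homogeneous_span_def]
  proof (induction rule: free.span_induct_alt)
    case base
    then show ?case
      using vhom_class_zero[OF vhom_phi_tensor] free.subspace_0[OF sub] by blast
  next
    case (step c x y)
    then obtain xs ds where xs: "homogeneous n (Suc m) xs ds" "x = fbasis xs" by blast
    from step obtain q where q: "q \<in> homogeneous_span n m"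
      "phi_tensor n (tensor_class n y) = tensor_class n q" by blast
    define r where "r = phi_homogeneous xs ds"
    have r: "r \<in> homogeneous_span n m" "phi_tensor n (tensor_class n x) = tensor_class n r"
      using phi_homogeneous_mem[OF xs(1)] phi_tensor_pure_homogeneous[OF xs(1)] homogeneous_length[OF xs(1)]
      by (auto simp: r_def pure_def xs(2))
    have x: "x \<in> homogeneous_span n (Suc m)" and y: "y \<in> homogeneous_span n (Suc m)"
      using step by (auto simp: homogeneous_span_def intro: free.span_base)
    note cx = free.subspace_scale[OF sub x, of c]
    note mem = subsetD[OF homogeneous_span_subset]
    have "phi_tensor n (tensor_class n (fscale c x + y)) = vadd (tensor_power n)
        (phi_tensor n (tensor_class n (fscale c x))) (phi_tensor n (tensor_class n y))"
      unfolding free_sub.presentsD(3)[OF TP mem[OF cx] mem[OF y]]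
      using vh free_sub.presentsD(2)[OF TP mem[OF cx]] free_sub.presentsD(2)[OF TP mem[OF y]] by blast
    also have "phi_tensor n (tensor_class n (fscale c x)) =
        vscale (tensor_power n) c (phi_tensor n (tensor_class n x))"
      unfolding free_sub.presentsD(4)[OF TP mem[OF x]]
      using vh free_sub.presentsD(2)[OF TP mem[OF x]] by blast
    also note r(2)
    also note q(2)
    also have "vadd (tensor_power n) (vscale (tensor_power n) c (tensor_class n r)) (tensor_class n q) =
        tensor_class n (fscale c r + q)"
      using free_sub.presentsD(3,4)[OF TP] mem[OF q(1)] mem[OF r(1)]
        mem[OF free.subspace_scale[OF sub r(1)]] by simp
    finally show ?case
      using free.subspace_add[OF sub] free.subspace_scale[OF sub] cx y q(1) r(1) by blast
  qed
  then show ?thesis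
    unfolding p(2) free_sub.presentsD(5)[OF TD] by blast
qed

text \<open>Linear in the cochain by its very form; that the value is a cochain holds because the
  differential of the tensor power is linear and lowers the degree by one.\<close>

lemma cochain_operator_del: "cochain_operator n m n (Suc m) (del n m)"
  unfolding cochain_operator_def
proof (intro conjI ballI allI)
  fix f assume f: "f \<in> C n m"
  have sub: "vadd (tensor_power_deg k l) = vadd (tensor_power k)"
    "vscale (tensor_power_deg k l) = vscale (tensor_power k)" for k l
    by (simp_all add: tensor_power_deg_def)
  note TD = presents_tensor_power_deg[of "Suc n" "Suc m"]
  have carr: "vcarrier (tensor_power_deg (Suc n) (Suc m)) \<subseteq> vcarrier (tensor_power (Suc n))"
    unfolding free_sub.presentsD(5)[OF presents_tensor_power_deg] free_sub.presentsD(5)[OF presents_tensor_power]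
    using homogeneous_span_subset by blast
  note vh = vhom_phi_tensor[of "Suc n", unfolded vhom_def]
  show "del n m f \<in> C n (Suc m)"
    unfolding C_def dual_def
  proof (intro CollectI conjI ballI allI impI)
    fix t u assume tu: "t \<in> vcarrier (tensor_power_deg (Suc n) (Suc m))"
      "u \<in> vcarrier (tensor_power_deg (Suc n) (Suc m))"
    then have "vadd (tensor_power_deg (Suc n) (Suc m)) t u \<in> vcarrier (tensor_power_deg (Suc n) (Suc m))"
      by (rule free_sub.presents_closed(1)[OF TD])
    moreover have "phi_tensor (Suc n) (vadd (tensor_power (Suc n)) t u) =
        vadd (tensor_power_deg (Suc n) m) (phi_tensor (Suc n) t) (phi_tensor (Suc n) u)"
      unfolding sub using vh tu carr by blast
    ultimately show "del n m f (vadd (tensor_power_deg (Suc n) (Suc m)) t u) = del n m f t + del n m f u"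
      using f phi_tensor_mem[OF tu(1)] phi_tensor_mem[OF tu(2)] tu
      by (simp add: del_def sub C_def dual_def algebra_simps)
  next
    fix c t assume t: "t \<in> vcarrier (tensor_power_deg (Suc n) (Suc m))"
    then have "vscale (tensor_power_deg (Suc n) (Suc m)) c t \<in> vcarrier (tensor_power_deg (Suc n) (Suc m))"
      by (rule free_sub.presents_closed(2)[OF TD])
    moreover have "phi_tensor (Suc n) (vscale (tensor_power (Suc n)) c t) =
        vscale (tensor_power_deg (Suc n) m) c (phi_tensor (Suc n) t)"
      unfolding sub using vh t carr by blast
    ultimately show "del n m f (vscale (tensor_power_deg (Suc n) (Suc m)) c t) = c * del n m f t"
      using f phi_tensor_mem[OF t] t by (simp add: del_def sub C_def dual_def)
  qed (simp add: del_def)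
qed (auto simp: del_def fun_eq_iff algebra_simps)

lemma del_pure:
  assumes f: "f \<in> C n m" and xs: "homogeneous (Suc n) (Suc m) xs ds"
  shows "del n m f (pure xs) =
    (-1) ^ m * (\<Sum>i<Suc n. (-1) ^ sum_list (take i ds) * f (pure (xs[i := \<phi> (xs ! i)])))"
proof -
  have len: "length xs = Suc n" "length ds = Suc n"
    using homogeneous_length[OF xs] by auto
  let ?I = "{i. i < Suc n \<and> ds ! i > 0}"
  have sub: "free.subspace (homogeneous_span (Suc n) m)"
    by (rule free_sub.presentsD(1)[OF presents_tensor_power_deg])
  have mem: "fbasis (xs[i := \<phi> (xs ! i)]) \<in> homogeneous_span (Suc n) m" if "i \<in> ?I" for i
  proof -
    have "homogeneous (Suc n) m (xs[i := \<phi> (xs ! i)]) (ds[i := ds ! i - 1])"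
      by (rule homogeneous_phi[OF xs]) (use that in auto)
    then show ?thesis
      unfolding homogeneous_span_def by (intro free.span_base) blast
  qed
  have "f (tensor_class (Suc n) (\<Sum>i\<in>J. fscale (c i) (fbasis (xs[i := \<phi> (xs ! i)])))) =
      (\<Sum>i\<in>J. c i * f (pure (xs[i := \<phi> (xs ! i)])))" if "finite J" "J \<subseteq> ?I" for J c
    using that
  proof (induction J)
    case empty
    then show ?case using C_zero_class[OF f] by simp
  next
    case (insert i J)
    have "(\<Sum>i\<in>J. fscale (c i) (fbasis (xs[i := \<phi> (xs ! i)]))) \<in> homogeneous_span (Suc n) m"
      by (intro free.subspace_sum[OF sub] free.subspace_scale[OF sub] mem) (use insert in auto)
    then show ?case
      using insert C_class_linear[OF f] mem[of i] free.subspace_scale[OF sub mem[of i]] len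
      by (simp add: pure_def)
  qed
  from this[of ?I "\<lambda>i. (-1) ^ sum_list (take i ds)"]
  have "f (tensor_class (Suc n) (phi_homogeneous xs ds)) =
      (\<Sum>i\<in>?I. (-1) ^ sum_list (take i ds) * f (pure (xs[i := \<phi> (xs ! i)])))"
    by (simp add: phi_homogeneous_def len)
  also have "\<dots> = (\<Sum>i<Suc n. (-1) ^ sum_list (take i ds) * f (pure (xs[i := \<phi> (xs ! i)])))"
  proof (rule sum.mono_neutral_left)
    show "\<forall>i\<in>{..<Suc n} - ?I. (-1) ^ sum_list (take i ds) * f (pure (xs[i := \<phi> (xs ! i)])) = 0"
    proof
      fix i assume i: "i \<in> {..<Suc n} - ?I"
      then have "\<phi> (xs ! i) = 0"
        using homogeneous_nth[OF xs, of i] phi_0 by simp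
      then show "(-1) ^ sum_list (take i ds) * f (pure (xs[i := \<phi> (xs ! i)])) = 0"
        using pure_zero[of i "xs[i := \<phi> (xs ! i)]"] i len C_zero_class[OF f] by simp
    qed
  qed auto
  finally show ?thesis
    using pure_mem[OF xs] by (simp add: del_def phi_tensor_pure_homogeneous[OF xs] del: sum.lessThan_Suc)
qed

section \<open>Low-degree identities between the operators\<close>

lemma homogeneous_1E:
  assumes "homogeneous (Suc 0) m xs ds"
  obtains x where "xs = [x]" "ds = [m]" "x \<in> A m"
  using assms by (auto simp: homogeneous_def length_Suc_conv list_all2_Cons1)

lemma homogeneous_2E:
  assumes "homogeneous (Suc (Suc 0)) m xs ds"
  obtains x y d e where "xs = [x, y]" "ds = [d, e]" "x \<in> A d" "y \<in> A e" "d + e = m"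
  using assms by (auto simp: homogeneous_def length_Suc_conv list_all2_Cons1)

lemma homogeneous_Nil [simp]: "homogeneous 0 m [] [] \<longleftrightarrow> m = 0"
  by (auto simp: homogeneous_def)

lemma homogeneous_Cons [simp]:
  "homogeneous (Suc n) m (x # xs) (d # ds) \<longleftrightarrow> x \<in> A d \<and> d \<le> m \<and> homogeneous n (m - d) xs ds"
  by (auto simp: homogeneous_def)

lemma hoch_b_0_pure:
  assumes "f \<in> C 0 m" and "x \<in> A d" "y \<in> A e" "d + e = m"
  shows "hoch_b 0 m f (pure [x, y]) = f (pure [x * y]) - (-1) ^ (d * e) * f (pure [y * x])"
  using hoch_b_pure[OF assms(1), of "[x, y]" "[d, e]"] assms
  by (auto simp: merge_def rotate_last_def gam_def mult.commute)

lemma hoch_b_1_pure: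
  assumes "f \<in> C (Suc 0) 0" and "x \<in> A 0" "y \<in> A 0" "z \<in> A 0"
  shows "hoch_b (Suc 0) 0 f (pure [x, y, z]) =
    f (pure [x * y, z]) - f (pure [x, y * z]) + f (pure [z * x, y])"
  using hoch_b_pure[OF assms(1), of "[x, y, z]" "[0, 0, 0]"] assms
  by (simp add: merge_def rotate_last_def gam_def)

lemma ext_B_0_pure:
  assumes f: "f \<in> C (Suc 0) m" and x: "x \<in> A m"
  shows "ext_B 0 m f (pure [x]) = f (pure [x, 1]) + f (pure [1, x])"
proof -
  have "f - cyc (Suc 0) m f \<in> C (Suc 0) m"
    by (rule C_diff[OF f cochain_operatorD(1)[OF cochain_operator_cyc f]])
  from ext_s_pure[OF this, of "[x]" "[m]"] cyc_pure[OF f, of "[x, 1]" "[m, 0]"] show ?thesis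
    using x one_A by (simp add: ext_B_def cyc_N_def gam_def)
qed

lemma ext_B_1_pure:
  assumes f: "f \<in> C (Suc (Suc 0)) 0" and x: "x \<in> A 0" and y: "y \<in> A 0"
  shows "ext_B (Suc 0) 0 f (pure [x, y]) =
    (f (pure [1, x, y]) - f (pure [x, y, 1])) - (f (pure [1, y, x]) - f (pure [y, x, 1]))"
proof -
  have 1: "f - cyc (Suc (Suc 0)) 0 f \<in> C (Suc (Suc 0)) 0"
    by (rule C_diff[OF f cochain_operatorD(1)[OF cochain_operator_cyc f]])
  define g where "g = ext_s (Suc 0) 0 (f - cyc (Suc (Suc 0)) 0 f)"
  have g: "g \<in> C (Suc 0) 0"
    unfolding g_def by (rule cochain_operatorD(1)[OF cochain_operator_ext_s 1])
  have "g (pure [u, v]) = f (pure [1, u, v]) - f (pure [u, v, 1])" if "u \<in> A 0" "v \<in> A 0" for u v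
    using ext_s_pure[OF 1, of "[u, v]" "[0, 0]"] cyc_pure[OF f, of "[u, v, 1]" "[0, 0, 0]"] that one_A
    by (simp add: g_def gam_def)
  then show ?thesis
    using cyc_pure[OF g, of "[x, y]" "[0, 0]"] x y
    by (simp add: ext_B_def cyc_N_def gam_def flip: g_def)
qed

text \<open>For \<open>f \<in> C\<^sup>0(A)\<close> the cochain \<open>b f\<close> is the graded commutator form
  \<open>f(x y) - (-1)\<^bsup>\<bar>x\<bar>\<bar>y\<bar>\<^esup> f(y x)\<close>, which is invariant under \<open>\<tau>\<close>; so \<open>\<one> - \<tau>\<close> kills it.\<close>

lemma ext_B_hoch_b_0:
  assumes f: "f \<in> C 0 m"
  shows "ext_B 0 m (hoch_b 0 m f) = 0"
proof -
  have b: "hoch_b 0 m f \<in> C (Suc 0) m"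
    by (rule cochain_operatorD(1)[OF cochain_operator_hoch_b f])
  have "cyc (Suc 0) m (hoch_b 0 m f) = hoch_b 0 m f"
  proof (rule C_eqI[OF cochain_operatorD(1)[OF cochain_operator_cyc b] b])
    fix xs ds assume "homogeneous (Suc (Suc 0)) m xs ds"
    then obtain x y d e where xy: "xs = [x, y]" "ds = [d, e]" "x \<in> A d" "y \<in> A e" "d + e = m"
      by (rule homogeneous_2E)
    have "cyc (Suc 0) m (hoch_b 0 m f) (pure xs) = - ((-1) ^ (d * e)) * hoch_b 0 m f (pure [y, x])"
      using cyc_pure[OF b, of xs ds] xy by (auto simp: gam_def mult.commute)
    also have "hoch_b 0 m f (pure [y, x]) = f (pure [y * x]) - (-1) ^ (d * e) * f (pure [x * y])"
      using hoch_b_0_pure[OF f, of y e x d] xy by (simp add: mult.commute add.commute)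
    also have "- ((-1) ^ (d * e)) * \<dots> = hoch_b 0 m f (pure xs)"
      using hoch_b_0_pure[OF f, of x d y e] xy by (simp add: algebra_simps flip: power_add mult_2)
    finally show "cyc (Suc 0) m (hoch_b 0 m f) (pure xs) = hoch_b 0 m f (pure xs)" .
  qed
  then show ?thesis
    by (simp add: ext_B_def cochain_operator_zero[OF cochain_operator_comp[OF cochain_operator_ext_s cochain_operator_cyc_N]])
qed

text \<open>On \<open>x \<otimes> y\<close> both sides are
  \<open>f(y x, 1) + f(1, y x) - f(x y, 1) - f(1, x y)\<close>: the terms without a factor \<open>1\<close> in \<open>B b f\<close>
  cancel.\<close>

lemma ext_B_hoch_b_1:
  assumes f: "f \<in> C (Suc 0) 0"
  shows "ext_B (Suc 0) 0 (hoch_b (Suc 0) 0 f) = - hoch_b 0 0 (ext_B 0 0 f)"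
proof -
  have b: "hoch_b (Suc 0) 0 f \<in> C (Suc (Suc 0)) 0"
    by (rule cochain_operatorD(1)[OF cochain_operator_hoch_b f])
  have B: "ext_B 0 0 f \<in> C 0 0"
    by (rule cochain_operatorD(1)[OF cochain_operator_ext_B f])
  have bB: "0 - hoch_b 0 0 (ext_B 0 0 f) \<in> C (Suc 0) 0"
    by (rule C_diff[OF C_zero cochain_operatorD(1)[OF cochain_operator_hoch_b B]])
  have "ext_B (Suc 0) 0 (hoch_b (Suc 0) 0 f) = 0 - hoch_b 0 0 (ext_B 0 0 f)"
  proof (rule C_eqI[OF cochain_operatorD(1)[OF cochain_operator_ext_B b] bB])
    fix xs ds assume "homogeneous (Suc (Suc 0)) 0 xs ds"
    then obtain x y where xy: "xs = [x, y]" "x \<in> A 0" "y \<in> A 0"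
      by (auto elim: homogeneous_2E)
    have "x * y \<in> A 0" "y * x \<in> A 0"
      using mult_A[of _ 0 _ 0] xy by auto
    then show "ext_B (Suc 0) 0 (hoch_b (Suc 0) 0 f) (pure xs) = (0 - hoch_b 0 0 (ext_B 0 0 f)) (pure xs)"
      using xy one_A
      by (simp add: ext_B_1_pure[OF b] hoch_b_1_pure[OF f] hoch_b_0_pure[OF B] ext_B_0_pure[OF f])
  qed
  then show ?thesis by simp
qed

text \<open>On \<open>x\<close> of degree \<open>1\<close> both sides are \<open>f(\<phi> x, 1) + f(1, \<phi> x)\<close>, as \<open>\<phi>(1) = 0\<close>.\<close>

lemma ext_B_del:
  assumes f: "f \<in> C (Suc 0) 0"
  shows "ext_B 0 (Suc 0) (del (Suc 0) 0 f) = del 0 0 (ext_B 0 0 f)"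
proof -
  have d: "del (Suc 0) 0 f \<in> C (Suc 0) (Suc 0)"
    by (rule cochain_operatorD(1)[OF cochain_operator_del f])
  have B: "ext_B 0 0 f \<in> C 0 0"
    by (rule cochain_operatorD(1)[OF cochain_operator_ext_B f])
  show ?thesis
  proof (rule C_eqI[OF cochain_operatorD(1)[OF cochain_operator_ext_B d] cochain_operatorD(1)[OF cochain_operator_del B]])
    fix xs ds assume "homogeneous (Suc 0) (Suc 0) xs ds"
    then obtain x where x: "xs = [x]" "ds = [Suc 0]" "x \<in> A (Suc 0)"
      by (rule homogeneous_1E)
    have zero: "f (pure [0, x]) = 0" "f (pure [x, 0]) = 0"
      using pure_zero[of 0 "[0, x]"] pure_zero[of 1 "[x, 0]"] C_zero_class[OF f] by simp_all
    have "\<phi> x \<in> A 0" "\<phi> 1 = 0"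
      using phi_Suc[of x 0] phi_0 one_A x by auto
    then show "ext_B 0 (Suc 0) (del (Suc 0) 0 f) (pure xs) = del 0 0 (ext_B 0 0 f) (pure xs)"
      using x one_A zero del_pure[OF f, of "[x, 1]" "[Suc 0, 0]"] del_pure[OF f, of "[1, x]" "[0, Suc 0]"]
        del_pure[OF B, of "[x]" "[Suc 0]"]
      by (simp add: ext_B_0_pure[OF d] ext_B_0_pure[OF f])
  qed
qed

end

section \<open>The total complexes\<close>

global_interpretation family: subquotients "(\<lambda>c F i t. c * F i t) :: 'k::field \<Rightarrow> ('i \<Rightarrow> 't \<Rightarrow> 'k) \<Rightarrow> _"
  by unfold_locales (auto simp: fun_eq_iff algebra_simps)

context dga
begin

lemma TEH_ambient: "TEH n = ambient (\<lambda>c F i t. c * F i t) (vcarrier (TEH n))"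
  by (simp add: TEH_def family_space_def)

lemma TEC_ambient: "TEC n = ambient (\<lambda>c F i t. c * F i t) (vcarrier (TEC n))"
  by (simp add: TEC_def family_space_def)

text \<open>All families of cochains, without a condition on the total degree: \<open>D\<close> and \<open>B\<close> are linear here.\<close>

definition cochain_families :: "(nat \<times> nat \<Rightarrow> ('a list \<Rightarrow>\<^sub>0 'k) set \<Rightarrow> 'k) set" where
  "cochain_families = {F. \<forall>p q. F (p, q) \<in> C p q}"

lemma TEH_iff:
  "F \<in> vcarrier (TEH n) \<longleftrightarrow> F \<in> cochain_families \<and> (\<forall>p q. p + q \<noteq> n \<longrightarrow> F (p, q) = 0)"
  unfolding TEH_def family_space_def cochain_families_def
  by auto (metis C_zero)

lemma TEH_families: "F \<in> vcarrier (TEH n) \<Longrightarrow> F \<in> cochain_families"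
  by (simp add: TEH_iff)

lemma subspace_cochain_families: "family.subspace cochain_families"
  by (rule family.subspaceI) (auto simp: cochain_families_def C_add C_scale)

lemma subspace_TEH: "family.subspace (vcarrier (TEH n))"
  using subspace_cochain_families
  by (intro family.subspaceI) (auto simp: TEH_iff family.subspace_add family.subspace_scale
      family.subspace_0 fun_eq_iff)

lemma TEH_d_eq:
  "TEH_d n F (0, 0) = 0"
  "TEH_d n F (Suc p, 0) = hoch_b p 0 (F (p, 0))"
  "TEH_d n F (0, Suc q) = del 0 q (F (0, q))"
  "TEH_d n F (Suc p, Suc q) = hoch_b p (Suc q) (F (p, Suc q)) +
     (\<lambda>t. (-1) ^ Suc p * del (Suc p) q (F (Suc p, q)) t)"
  by (simp_all add: TEH_d_def fun_eq_iff)

lemma TEH_d_mem: "F \<in> cochain_families \<Longrightarrow> TEH_d n F \<in> cochain_families"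
  unfolding cochain_families_def
proof (intro CollectI allI)
  fix p q assume "F \<in> {F. \<forall>p q. F (p, q) \<in> C p q}"
  then have F: "F (p, q) \<in> C p q" for p q
    by simp
  note C = cochain_operatorD(1)[OF cochain_operator_hoch_b F] cochain_operatorD(1)[OF cochain_operator_del F]
  show "TEH_d n F (p, q) \<in> C p q"
    by (cases p; cases q) (simp_all only: TEH_d_eq C_zero C C_add C_scale)
qed

lemma TEH_d_add:
  assumes "F \<in> cochain_families" and "G \<in> cochain_families"
  shows "TEH_d n (F + G) = TEH_d n F + TEH_d n G"
proof
  fix i :: "nat \<times> nat"
  show "TEH_d n (F + G) i = (TEH_d n F + TEH_d n G) i"
    using assms cochain_operatorD(2)[OF cochain_operator_hoch_b] cochain_operatorD(2)[OF cochain_operator_del]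
    by (cases i) (simp add: TEH_d_def cochain_families_def fun_eq_iff algebra_simps)
qed

lemma TEH_d_scale:
  assumes "F \<in> cochain_families"
  shows "TEH_d n (\<lambda>i t. c * F i t) = (\<lambda>i t. c * TEH_d n F i t)"
proof
  fix i :: "nat \<times> nat"
  show "TEH_d n (\<lambda>i t. c * F i t) i = (\<lambda>t. c * TEH_d n F i t)"
    using assms cochain_operatorD(3)[OF cochain_operator_hoch_b] cochain_operatorD(3)[OF cochain_operator_del]
    by (cases i) (simp add: TEH_d_def cochain_families_def fun_eq_iff algebra_simps)
qed

lemma TEH_B_mem: "F \<in> cochain_families \<Longrightarrow> TEH_B F \<in> cochain_families"
  unfolding cochain_families_def TEH_B_def
  by (auto intro: cochain_operatorD(1)[OF cochain_operator_ext_B])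

lemma TEH_B_add:
  assumes "F \<in> cochain_families" and "G \<in> cochain_families"
  shows "TEH_B (F + G) = TEH_B F + TEH_B G"
  using assms cochain_operatorD(2)[OF cochain_operator_ext_B]
  by (auto simp: TEH_B_def cochain_families_def fun_eq_iff)

lemma TEH_B_scale:
  assumes "F \<in> cochain_families"
  shows "TEH_B (\<lambda>i t. c * F i t) = (\<lambda>i t. c * TEH_B F i t)"
  using assms cochain_operatorD(3)[OF cochain_operator_ext_B]
  by (auto simp: TEH_B_def cochain_families_def fun_eq_iff)

lemma zero_families: "0 \<in> cochain_families"
  by (rule family.subspace_0[OF subspace_cochain_families])

lemma TEH_d_zero [simp]: "TEH_d n 0 = 0"
  using TEH_d_scale[OF zero_families, of n 0] by (simp add: zero_fun_def)

lemma TEH_B_zero [simp]: "TEH_B 0 = 0"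
  using TEH_B_scale[OF zero_families, of 0] by (simp add: zero_fun_def)

lemma TEH_d_uminus: "F \<in> cochain_families \<Longrightarrow> TEH_d n (- F) = - TEH_d n F"
  using TEH_d_scale[of F n "- 1"] by (simp add: fun_Compl_def)

lemma TEH_d_TEH:
  assumes F: "F \<in> vcarrier (TEH n)"
  shows "TEH_d k F \<in> vcarrier (TEH (Suc n))"
  unfolding TEH_iff
proof (intro conjI allI impI TEH_d_mem TEH_families[OF F])
  fix p q assume pq: "p + q \<noteq> Suc n"
  then have "F (p - 1, q) = 0 \<or> p = 0" "F (p, q - 1) = 0 \<or> q = 0"
    using F by (auto simp: TEH_iff)
  then have "hoch_b (p - 1) q (F (p - 1, q)) = 0 \<or> p = 0" "del p (q - 1) (F (p, q - 1)) = 0 \<or> q = 0"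
    by (auto simp: cochain_operator_zero[OF cochain_operator_hoch_b]
        cochain_operator_zero[OF cochain_operator_del])
  then show "TEH_d k F (p, q) = 0"
    by (auto simp: TEH_d_def fun_eq_iff)
qed

lemma TEH_B_TEH:
  assumes F: "F \<in> vcarrier (TEH (Suc n))"
  shows "TEH_B F \<in> vcarrier (TEH n)"
  unfolding TEH_iff
proof (intro conjI allI impI TEH_B_mem TEH_families[OF F])
  fix p q assume "p + q \<noteq> n"
  then have "F (Suc p, q) = 0"
    using F by (simp add: TEH_iff)
  then show "TEH_B F (p, q) = 0"
    by (simp add: TEH_B_def cochain_operator_zero[OF cochain_operator_ext_B])
qed

lemma TEH_B_TEH_0:
  assumes F: "F \<in> vcarrier (TEH 0)"
  shows "TEH_B F = 0"
proof
  fix i :: "nat \<times> nat"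
  obtain p q where i: "i = (p, q)" by (cases i)
  have "F (Suc p, q) = 0"
    using F by (simp add: TEH_iff)
  then show "TEH_B F i = 0 i"
    by (simp add: i TEH_B_def cochain_operator_zero[OF cochain_operator_ext_B])
qed

text \<open>The target is \<open>C\<^sup>0(A)\<close> in degree \<open>0\<close>, where this is \<open>B b = 0\<close>.\<close>

lemma TEH_B_d_0:
  assumes F: "F \<in> vcarrier (TEH 0)"
  shows "TEH_B (TEH_d k F) = 0"
proof -
  have "TEH_B (TEH_d k F) \<in> vcarrier (TEH 0)"
    by (intro TEH_B_TEH TEH_d_TEH F)
  then have "TEH_B (TEH_d k F) (p, q) = 0" if "p + q \<noteq> 0" for p q
    using that unfolding TEH_iff by blast
  moreover have "TEH_B (TEH_d k F) (0, 0) = 0"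
    using F by (simp add: TEH_B_def TEH_d_eq ext_B_hoch_b_0 TEH_iff cochain_families_def)
  ultimately have "TEH_B (TEH_d k F) (p, q) = 0" for p q
    by (cases "p + q = 0") simp_all
  then show ?thesis
    by (simp add: fun_eq_iff)
qed

text \<open>In bidegree \<open>(1, 0)\<close> this is \<open>B b = - b B\<close>. In bidegree \<open>(0, 1)\<close> the left side is \<open>B b - B \<delta>\<close>,
  where \<open>B b = 0\<close> and \<open>B \<delta> = \<delta> B\<close>.\<close>

lemma TEH_B_d_1:
  assumes F: "F \<in> vcarrier (TEH (Suc 0))"
  shows "TEH_B (TEH_d k F) = - TEH_d k (TEH_B F)"
proof
  fix i :: "nat \<times> nat"
  obtain p q where i: "i = (p, q)" by (cases i)
  have l: "TEH_B (TEH_d k F) \<in> vcarrier (TEH (Suc 0))" and r: "- TEH_d k (TEH_B F) \<in> vcarrier (TEH (Suc 0))"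
    by (intro TEH_B_TEH TEH_d_TEH F family.subspace_neg[OF subspace_TEH])+
  have F': "\<And>p q. F (p, q) \<in> C p q"
    using F by (simp add: TEH_iff cochain_families_def)
  consider "p + q \<noteq> Suc 0" | "p = Suc 0" "q = 0" | "p = 0" "q = Suc 0" by linarith
  then show "TEH_B (TEH_d k F) i = (- TEH_d k (TEH_B F)) i"
  proof cases
    case 1
    then show ?thesis using l r by (simp add: TEH_iff i)
  next
    case 2
    then show ?thesis
      by (simp add: i TEH_B_def TEH_d_eq ext_B_hoch_b_1[OF F'])
  next
    case 3
    have b: "hoch_b 0 (Suc 0) (F (0, Suc 0)) \<in> C (Suc 0) (Suc 0)"
      by (rule cochain_operatorD(1)[OF cochain_operator_hoch_b F'])
    have d: "del (Suc 0) 0 (F (Suc 0, 0)) \<in> C (Suc 0) (Suc 0)"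
      by (rule cochain_operatorD(1)[OF cochain_operator_del F'])
    have "ext_B 0 (Suc 0) (hoch_b 0 (Suc 0) (F (0, Suc 0)) + (\<lambda>t. (- 1) * del (Suc 0) 0 (F (Suc 0, 0)) t)) =
        (\<lambda>t. (- 1) * ext_B 0 (Suc 0) (del (Suc 0) 0 (F (Suc 0, 0))) t)"
      using cochain_operatorD(2)[OF cochain_operator_ext_B b C_scale[OF d, of "- 1"]]
        cochain_operatorD(3)[OF cochain_operator_ext_B d, of "- 1"] ext_B_hoch_b_0[OF F'[of 0 "Suc 0"]]
      by simp
    then show ?thesis
      by (simp add: i 3 TEH_B_def TEH_d_eq ext_B_del[OF F'] fun_eq_iff)
  qed
qed

section \<open>Hochschild cohomology and its truncations\<close>

text \<open>The index of \<open>TEH_d\<close> only records the degree.\<close>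

lemma TEH_d_cong: "TEH_d m = TEH_d n"
  by (simp add: fun_eq_iff TEH_d_def)

lemma cocycles_TEH: "cocycles TEH TEH_d n = {F \<in> vcarrier (TEH n). TEH_d n F = 0}"
  unfolding cocycles_def by (subst TEH_ambient[of "Suc n"]) simp

lemma coboundaries_TEH_0: "coboundaries TEH TEH_d 0 = {0}"
  unfolding coboundaries_def by (subst TEH_ambient) simp

lemma coboundaries_TEH_Suc: "coboundaries TEH TEH_d (Suc n) = TEH_d n ` vcarrier (TEH n)"
  by (simp add: coboundaries_def)

lemma subspace_cocycles_TEH: "family.subspace (cocycles TEH TEH_d n)"
  unfolding cocycles_TEH
  by (rule family.subspaceI)
    (auto simp: TEH_d_add TEH_d_scale TEH_families family.subspace_0[OF subspace_TEH]
      family.subspace_add[OF subspace_TEH] family.subspace_scale[OF subspace_TEH] fun_eq_iff)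

lemma subspace_coboundaries_TEH: "family.subspace (coboundaries TEH TEH_d n)"
proof (cases n)
  case 0
  then show ?thesis by (simp add: coboundaries_TEH_0)
next
  case (Suc k)
  show ?thesis
    unfolding Suc coboundaries_TEH_Suc
  proof (rule family.subspaceI)
    show "0 \<in> TEH_d k ` vcarrier (TEH k)"
      by (rule image_eqI[of _ _ 0]) (simp_all add: family.subspace_0[OF subspace_TEH])
  next
    fix F G assume "F \<in> TEH_d k ` vcarrier (TEH k)" "G \<in> TEH_d k ` vcarrier (TEH k)"
    then obtain F' G' where FG: "F' \<in> vcarrier (TEH k)" "G' \<in> vcarrier (TEH k)" "F = TEH_d k F'" "G = TEH_d k G'"
      by blast
    show "F + G \<in> TEH_d k ` vcarrier (TEH k)"
      by (rule image_eqI[of _ _ "F' + G'"])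
        (use FG in \<open>simp_all add: TEH_d_add TEH_families family.subspace_add[OF subspace_TEH]\<close>)
  next
    fix c F assume "F \<in> TEH_d k ` vcarrier (TEH k)"
    then obtain F' where F: "F' \<in> vcarrier (TEH k)" "F = TEH_d k F'"
      by blast
    show "(\<lambda>t. \<lambda>x. c * F t x) \<in> TEH_d k ` vcarrier (TEH k)"
      by (rule image_eqI[of _ _ "\<lambda>i t. c * F' i t"])
        (use F in \<open>simp_all add: TEH_d_scale TEH_families family.subspace_scale[OF subspace_TEH]\<close>)
  qed
qed

lemma presents_HH:
  "family.presents (cocycles TEH TEH_d n) (coboundaries TEH TEH_d n) (HH n)
     (\<lambda>F. (+) F ` coboundaries TEH TEH_d n)"
  using family.presents_coset[OF subspace_cocycles_TEH subspace_coboundaries_TEH, of n n]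
  unfolding HH_def cohomology_def by (subst TEH_ambient) simp

lemma vzero_HH: "vzero (HH n) = coboundaries TEH TEH_d n"
  by (simp add: HH_def cohomology_def)

lemma translate_coboundaries_eq:
  "(+) F ` coboundaries TEH TEH_d n = coboundaries TEH TEH_d n \<longleftrightarrow> F \<in> coboundaries TEH TEH_d n"
  using family.translate_eq_iff[OF subspace_coboundaries_TEH, of F n 0] by simp

text \<open>What makes \<open>B\<close> well defined on classes: \<open>B D E\<close> is \<open>0\<close> or \<open>- D B E\<close>.\<close>

lemma TEH_B_coboundary:
  assumes n: "n \<le> Suc 0" and E: "E \<in> coboundaries TEH TEH_d (Suc n)"
  shows "TEH_B E \<in> coboundaries TEH TEH_d n"
proof (cases n)
  case 0
  then show ?thesis
    using E by (auto simp: coboundaries_TEH_0 coboundaries_TEH_Suc TEH_B_d_0)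
next
  case (Suc k)
  then have n: "n = Suc 0" using n by simp
  obtain E' where E': "E' \<in> vcarrier (TEH (Suc 0))" "E = TEH_d (Suc 0) E'"
    using E unfolding n coboundaries_TEH_Suc by blast
  have B: "TEH_B E' \<in> vcarrier (TEH 0)"
    by (rule TEH_B_TEH[OF E'(1)])
  have "TEH_B E = - TEH_d (Suc 0) (TEH_B E')"
    unfolding E'(2) by (rule TEH_B_d_1[OF E'(1)])
  also have "\<dots> = TEH_d 0 (- TEH_B E')"
    by (simp add: TEH_d_uminus[OF TEH_families[OF B]] TEH_d_cong[of "Suc 0" 0])
  finally show ?thesis
    unfolding n coboundaries_TEH_Suc using family.subspace_neg[OF subspace_TEH B] by blast
qed

lemma coboundary_TEH:
  "E \<in> coboundaries TEH TEH_d n \<Longrightarrow> E \<in> vcarrier (TEH n)"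
  by (cases n) (auto simp: coboundaries_TEH_0 coboundaries_TEH_Suc TEH_d_TEH
      family.subspace_0[OF subspace_TEH])

lemma HH_B_class:
  assumes n: "n \<le> Suc 0" and F: "F \<in> vcarrier (TEH (Suc n))"
  shows "HH_B (Suc n) ((+) F ` coboundaries TEH TEH_d (Suc n)) = (+) (TEH_B F) ` coboundaries TEH TEH_d n"
proof -
  have "(+) (TEH_B (F + E)) ` coboundaries TEH TEH_d n = (+) (TEH_B F) ` coboundaries TEH TEH_d n"
    if E: "E \<in> coboundaries TEH TEH_d (Suc n)" for E
    unfolding family.translate_eq_iff[OF subspace_coboundaries_TEH]
    using TEH_B_coboundary[OF n E] TEH_B_add[OF TEH_families[OF F] TEH_families[OF coboundary_TEH[OF E]]]
    by simp
  moreover have "coset (TEH n) U G = (+) G ` U" for U G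
    by (subst TEH_ambient) simp
  ultimately show ?thesis
    unfolding HH_B_def using family.subspace_0[OF subspace_coboundaries_TEH[of "Suc n"]] by auto
qed

text \<open>The cocycles whose class is in the kernel of \<open>B : HH\<^bsup>n+1\<^esup> \<rightarrow> HH\<^bsup>n\<^esup>\<close>.\<close>

definition trunc_cocycles :: "nat \<Rightarrow> (nat \<times> nat \<Rightarrow> ('a list \<Rightarrow>\<^sub>0 'k) set \<Rightarrow> 'k) set" where
  "trunc_cocycles n = {F \<in> cocycles TEH TEH_d (Suc n). TEH_B F \<in> coboundaries TEH TEH_d n}"

lemma presents_H_trunc_0:
  assumes n: "n \<le> Suc 0"
  obtains \<pi> where "family.presents (trunc_cocycles n)
      (cocycles TEH TEH_d (Suc n) \<inter> coboundaries TEH TEH_d (Suc n)) (H_trunc_HH (Suc n) 0) \<pi>"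
proof -
  let ?U = "coboundaries TEH TEH_d" and ?Z = "cocycles TEH TEH_d"
  let ?V = "truncation (Suc n) HH" and ?d = "truncation_d (Suc n) HH HH_B"
  have coc: "cocycles ?V ?d 0 = {X \<in> vcarrier (HH (Suc n)). HH_B (Suc n) X = ?U n}"
    by (simp add: cocycles_def truncation_def truncation_d_def vzero_HH)
  have ker_B: "HH_B (Suc n) ((+) F ` ?U (Suc n)) = ?U n \<longleftrightarrow> TEH_B F \<in> ?U n" if "F \<in> ?Z (Suc n)" for F
    using HH_B_class[OF n, of F] that by (simp add: translate_coboundaries_eq cocycles_TEH)
  have "(+) 0 ` ?U (Suc n) \<in> vcarrier (HH (Suc n))"
    by (rule family.presentsD(2)[OF presents_HH family.subspace_0[OF subspace_cocycles_TEH]])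
  then have T: "{?U (Suc n)} \<subseteq> vcarrier (HH (Suc n))"
    by simp
  have "family.presents (trunc_cocycles n) (?Z (Suc n) \<inter> ?U (Suc n))
      (vquotient (subsp (HH (Suc n)) (cocycles ?V ?d 0)) {?U (Suc n)})
      (\<lambda>F. coset (HH (Suc n)) {?U (Suc n)} ((+) F ` ?U (Suc n)))"
  proof (rule family.presents_vquotient[OF presents_HH _ T])
    show "cocycles ?V ?d 0 \<subseteq> vcarrier (HH (Suc n))"
      by (auto simp: coc)
    show "trunc_cocycles n = {F \<in> ?Z (Suc n). (+) F ` ?U (Suc n) \<in> cocycles ?V ?d 0}"
      unfolding trunc_cocycles_def coc
      by (intro Collect_cong conj_cong refl) (simp add: ker_B family.presentsD(2)[OF presents_HH])
    show "?Z (Suc n) \<inter> ?U (Suc n) = {F \<in> ?Z (Suc n). (+) F ` ?U (Suc n) \<in> {?U (Suc n)}}"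
      by (auto simp: translate_coboundaries_eq)
    show "family.subspace (?Z (Suc n) \<inter> ?U (Suc n))"
      by (rule family.subspace_inter[OF subspace_cocycles_TEH subspace_coboundaries_TEH])
    show "family.subspace (trunc_cocycles n)"
    proof (rule family.subspaceI)
      show "0 \<in> trunc_cocycles n"
        by (simp add: trunc_cocycles_def family.subspace_0[OF subspace_cocycles_TEH]
            family.subspace_0[OF subspace_coboundaries_TEH])
    next
      fix F G assume "F \<in> trunc_cocycles n" "G \<in> trunc_cocycles n"
      then show "F + G \<in> trunc_cocycles n"
        by (auto simp: trunc_cocycles_def family.subspace_add[OF subspace_cocycles_TEH]
            family.subspace_add[OF subspace_coboundaries_TEH] TEH_B_add cocycles_TEH TEH_families TEH_d_add
            family.subspace_add[OF subspace_TEH])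
    next
      fix c F assume F: "F \<in> trunc_cocycles n"
      then have "TEH_B (\<lambda>i t. c * F i t) = (\<lambda>i t. c * TEH_B F i t)"
        by (intro TEH_B_scale) (auto simp: trunc_cocycles_def cocycles_TEH TEH_families)
      then show "(\<lambda>i t. c * F i t) \<in> trunc_cocycles n"
        using F family.subspace_scale[OF subspace_cocycles_TEH] family.subspace_scale[OF subspace_coboundaries_TEH]
        by (simp add: trunc_cocycles_def)
    qed
  qed
  moreover have "H_trunc_HH (Suc n) 0 = vquotient (subsp (HH (Suc n)) (cocycles ?V ?d 0)) {?U (Suc n)}"
    by (simp add: H_trunc_HH_def cohomology_def coboundaries_def truncation_def vzero_HH)
  ultimately show thesis
    using that by metis
qed

text \<open>The truncated complex is zero above degree \<open>1\<close>, so all of \<open>HH\<^sup>0\<close> consists of cocycles. By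
  \<open>B D = - D B\<close> the map \<open>B\<close> takes cocycles of degree \<open>1\<close> to cocycles of degree \<open>0\<close>.\<close>

lemma presents_H_trunc_1_1:
  obtains \<pi> where "family.presents (cocycles TEH TEH_d 0) (TEH_B ` cocycles TEH TEH_d (Suc 0))
    (H_trunc_HH (Suc 0) (Suc 0)) \<pi>"
proof -
  let ?U = "coboundaries TEH TEH_d" and ?Z = "cocycles TEH TEH_d"
  define \<pi> where "\<pi> F = (+) F ` ?U 0" for F
  have \<pi>: "family.presents (?Z 0) (?U 0) (HH 0) \<pi>"
    unfolding \<pi>_def[abs_def] by (rule presents_HH)
  let ?T = "HH_B (Suc 0) ` vcarrier (HH (Suc 0))"
  have T: "?T = \<pi> ` TEH_B ` ?Z (Suc 0)"
    unfolding family.presentsD(5)[OF presents_HH] image_image \<pi>_def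
    by (intro image_cong HH_B_class) (auto simp: cocycles_TEH)
  have B: "TEH_B F \<in> ?Z 0" if "F \<in> ?Z (Suc 0)" for F
  proof -
    have F: "F \<in> vcarrier (TEH (Suc 0))" "TEH_d (Suc 0) F = 0"
      using that by (auto simp: cocycles_TEH)
    have "TEH_d 0 (TEH_B F) = TEH_d (Suc 0) (TEH_B F)"
      by (simp add: TEH_d_cong[of 0 "Suc 0"])
    also have "\<dots> = 0"
      using TEH_B_d_1[OF F(1), of "Suc 0"] F(2) by simp
    finally show ?thesis
      using TEH_B_TEH[OF F(1)] by (simp add: cocycles_TEH)
  qed
  have inj: "\<pi> x = \<pi> y \<longleftrightarrow> x = y" if "x \<in> ?Z 0" "y \<in> ?Z 0" for x y
    using family.presentsD(6)[OF \<pi> that] by (simp add: coboundaries_TEH_0)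
  have "family.presents (?Z 0) (TEH_B ` ?Z (Suc 0))
      (vquotient (subsp (HH 0) (vcarrier (HH 0))) ?T) (\<lambda>x. coset (HH 0) ?T (\<pi> x))"
  proof (rule family.presents_vquotient[OF \<pi>])
    show "?T \<subseteq> vcarrier (HH 0)"
      unfolding T family.presentsD(5)[OF \<pi>] using B by blast
    show "?Z 0 = {x \<in> ?Z 0. \<pi> x \<in> vcarrier (HH 0)}"
      using family.presentsD(2)[OF \<pi>] by auto
    show "TEH_B ` ?Z (Suc 0) = {x \<in> ?Z 0. \<pi> x \<in> ?T}"
      unfolding T using B inj by (auto simp: image_iff)
    show "family.subspace (TEH_B ` ?Z (Suc 0))"
    proof (rule family.subspaceI)
      show "0 \<in> TEH_B ` ?Z (Suc 0)"
        by (rule image_eqI[of _ _ 0]) (simp_all add: family.subspace_0[OF subspace_cocycles_TEH])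
    next
      fix F G assume "F \<in> TEH_B ` ?Z (Suc 0)" "G \<in> TEH_B ` ?Z (Suc 0)"
      then obtain F' G' where FG: "F' \<in> ?Z (Suc 0)" "G' \<in> ?Z (Suc 0)" "F = TEH_B F'" "G = TEH_B G'"
        by blast
      have "F' \<in> cochain_families" "G' \<in> cochain_families"
        using FG by (auto simp: cocycles_TEH TEH_families)
      then show "F + G \<in> TEH_B ` ?Z (Suc 0)"
        by (intro image_eqI[of _ _ "F' + G'"])
          (use FG in \<open>simp_all add: TEH_B_add family.subspace_add[OF subspace_cocycles_TEH]\<close>)
    next
      fix c F assume "F \<in> TEH_B ` ?Z (Suc 0)"
      then obtain F' where F: "F' \<in> ?Z (Suc 0)" "F = TEH_B F'"
        by blast
      have "F' \<in> cochain_families"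
        using F by (auto simp: cocycles_TEH TEH_families)
      then show "(\<lambda>i t. c * F i t) \<in> TEH_B ` ?Z (Suc 0)"
        by (intro image_eqI[of _ _ "\<lambda>i t. c * F' i t"])
          (use F in \<open>simp_all add: TEH_B_scale family.subspace_scale[OF subspace_cocycles_TEH]\<close>)
    qed
  qed (simp_all add: subspace_cocycles_TEH)
  moreover have "H_trunc_HH (Suc 0) (Suc 0) = vquotient (subsp (HH 0) (vcarrier (HH 0))) ?T"
    by (simp add: H_trunc_HH_def cohomology_def cocycles_def coboundaries_def truncation_def
        truncation_d_def cong: image_cong)
  ultimately show thesis
    using that by metis
qed

section \<open>The cyclic total complex in low degrees\<close>

text \<open>Row \<open>p\<close> is reindexed by \<open>(q - p, r)\<close>, the bidegree of its cochains in \<open>EH(A)\<close>.\<close>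

definition row ::
    "nat \<Rightarrow> (nat \<times> nat \<times> nat \<Rightarrow> ('a list \<Rightarrow>\<^sub>0 'k) set \<Rightarrow> 'k) \<Rightarrow>
     nat \<times> nat \<Rightarrow> ('a list \<Rightarrow>\<^sub>0 'k) set \<Rightarrow> 'k" where
  "row p G = (\<lambda>(q, r). G (p, q + p, r))"

text \<open>The vanishing below the diagonal is what lets the rows determine the family.\<close>

definition triangular :: "(nat \<times> nat \<times> nat \<Rightarrow> ('a list \<Rightarrow>\<^sub>0 'k) set \<Rightarrow> 'k) \<Rightarrow> bool" where
  "triangular G \<longleftrightarrow> (\<forall>p q r. q < p \<longrightarrow> G (p, q, r) = 0)"

definition of_row ::
    "nat \<Rightarrow> (nat \<times> nat \<Rightarrow> ('a list \<Rightarrow>\<^sub>0 'k) set \<Rightarrow> 'k) \<Rightarrow>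
     nat \<times> nat \<times> nat \<Rightarrow> ('a list \<Rightarrow>\<^sub>0 'k) set \<Rightarrow> 'k" where
  "of_row p F = (\<lambda>(p', q, r). if p' = p \<and> p \<le> q then F (q - p, r) else 0)"

lemma row_add [simp]: "row p (F + G) = row p F + row p G"
  and row_diff [simp]: "row p (F - G) = row p F - row p G"
  and row_scale [simp]: "row p (\<lambda>i t. c * F i t) = (\<lambda>i t. c * row p F i t)"
  and row_zero [simp]: "row p 0 = 0"
  by (auto simp: row_def fun_eq_iff)

lemma row_of_row: "row p (of_row p' F) = (if p = p' then F else 0)"
  by (auto simp: row_def of_row_def fun_eq_iff)

lemma of_row_zero: "of_row p 0 = 0"
  by (auto simp: of_row_def fun_eq_iff)

lemma triangular_of_row: "triangular (of_row p F)"
  by (auto simp: triangular_def of_row_def)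

lemma triangular_add: "triangular F \<Longrightarrow> triangular G \<Longrightarrow> triangular (F + G)"
  and triangular_scale: "triangular F \<Longrightarrow> triangular (\<lambda>i t. c * F i t)"
  and triangular_zero: "triangular 0"
  by (auto simp: triangular_def fun_eq_iff)

lemma triangular_TEC_d: "triangular (TEC_d n G)"
  by (simp add: triangular_def TEC_d_def)

lemma triangular_eqI:
  assumes "triangular F" and "triangular G" and "\<And>p. row p F = row p G"
  shows "F = G"
proof
  fix i :: "nat \<times> nat \<times> nat"
  obtain p q r where i: "i = (p, q, r)" by (cases i)
  show "F i = G i"
  proof (cases "p \<le> q")
    case True
    then show ?thesis
      using fun_cong[OF assms(3)[of p], of "(q - p, r)"] by (simp add: row_def i)
  next
    case False
    then show ?thesis using assms(1,2) by (simp add: triangular_def i)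
  qed
qed

lemma row_TEC_d_0: "row 0 (TEC_d n G) = TEH_d k (row 0 G)"
  by (auto simp: row_def TEC_d_def TEH_d_def fun_eq_iff)

lemma row_TEC_d_Suc: "row (Suc p) (TEC_d n G) = TEH_d k (row (Suc p) G) + TEH_B (row p G)"
  by (auto simp: row_def TEC_d_def TEH_d_def TEH_B_def fun_eq_iff algebra_simps)

text \<open>The total degree \<open>p + q + r\<close> is \<open>2p + (q - p) + r\<close>; this is how \<open>p\<close> shifts the degree by two.\<close>

lemma TEC_iff:
  "G \<in> vcarrier (TEC n) \<longleftrightarrow> triangular G \<and>
     (\<forall>p. row p G \<in> cochain_families \<and> (\<forall>q r. 2 * p + q + r \<noteq> n \<longrightarrow> row p G (q, r) = 0))"
  (is "_ \<longleftrightarrow> ?R")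
proof
  assume "G \<in> vcarrier (TEC n)"
  then have G: "\<And>p q r. p + q + r = n \<Longrightarrow> G (p, q, r) \<in> EC p q r"
    "\<And>p q r. p + q + r \<noteq> n \<Longrightarrow> G (p, q, r) = 0"
    by (auto simp: TEC_def family_space_def)
  have EC: "G (p, q, r) \<in> EC p q r" for p q r
    using G[of p q r] by (cases "p + q + r = n") (auto simp: EC_def)
  have "G (p, q + p, r) \<in> C q r" for p q r
    using EC[of p "q + p" r] by (simp add: EC_def)
  moreover have "q < p \<Longrightarrow> G (p, q, r) = 0" for p q r
    using EC[of p q r] by (simp add: EC_def)
  ultimately show ?R
    using G(2) by (auto simp: triangular_def row_def cochain_families_def)
next
  assume R: ?R
  have "G (p, q, r) \<in> EC p q r \<and> (p + q + r \<noteq> n \<longrightarrow> G (p, q, r) = 0)" for p q r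
  proof (cases "p \<le> q")
    case True
    have "G (p, q, r) = row p G (q - p, r)"
      using True by (simp add: row_def)
    moreover have "row p G (q - p, r) \<in> C (q - p) r"
      and "2 * p + (q - p) + r \<noteq> n \<Longrightarrow> row p G (q - p, r) = 0"
      using R by (auto simp: cochain_families_def)
    ultimately show ?thesis
      using True by (auto simp: EC_def)
  next
    case False
    then show ?thesis using R by (simp add: triangular_def EC_def)
  qed
  then show "G \<in> vcarrier (TEC n)"
    by (auto simp: TEC_def family_space_def)
qed

lemma rows_TEC_zero:
  assumes "G \<in> vcarrier (TEC n)" and "n < 2 * p"
  shows "row p G = 0"
proof
  fix i :: "nat \<times> nat"
  obtain q r where i: "i = (q, r)" by (cases i)
  have "2 * p + q + r \<noteq> n"
    using assms(2) by simp
  then show "row p G i = 0 i"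
    using assms(1) unfolding TEC_iff i by simp
qed

lemma row_TEC: "G \<in> vcarrier (TEC (2 * p + n)) \<Longrightarrow> row p G \<in> vcarrier (TEH n)"
  by (auto simp: TEC_iff TEH_iff)

lemma of_row_TEC: "F \<in> vcarrier (TEH n) \<Longrightarrow> of_row p F \<in> vcarrier (TEC (2 * p + n))"
  by (auto simp: TEC_iff TEH_iff triangular_of_row row_of_row zero_families)

lemma subspace_TEC: "family.subspace (vcarrier (TEC n))"
  by (rule family.subspaceI)
    (auto simp: TEC_iff triangular_add triangular_scale triangular_zero zero_families
      family.subspace_add[OF subspace_cochain_families] family.subspace_scale[OF subspace_cochain_families]
      fun_eq_iff)

lemma row_families: "G \<in> vcarrier (TEC n) \<Longrightarrow> row p G \<in> cochain_families"
  by (simp add: TEC_iff)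

lemma TEC_d_add:
  assumes "F \<in> vcarrier (TEC n)" and "G \<in> vcarrier (TEC n)"
  shows "TEC_d n (F + G) = TEC_d n F + TEC_d n G"
proof (rule triangular_eqI)
  fix p
  show "row p (TEC_d n (F + G)) = row p (TEC_d n F + TEC_d n G)"
    using assms by (cases p) (simp_all add: row_TEC_d_0[of _ _ 0] row_TEC_d_Suc[of _ _ _ 0] TEH_d_add TEH_B_add row_families)
qed (simp_all add: triangular_TEC_d triangular_add)

lemma TEC_d_scale:
  assumes "F \<in> vcarrier (TEC n)"
  shows "TEC_d n (\<lambda>i t. c * F i t) = (\<lambda>i t. c * TEC_d n F i t)"
proof (rule triangular_eqI)
  fix p
  show "row p (TEC_d n (\<lambda>i t. c * F i t)) = row p (\<lambda>i t. c * TEC_d n F i t)"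
    using assms by (cases p)
      (simp_all add: row_TEC_d_0[of _ _ 0] row_TEC_d_Suc[of _ _ _ 0] TEH_d_scale TEH_B_scale row_families
        fun_eq_iff algebra_simps)
qed (simp_all add: triangular_TEC_d triangular_scale)

lemma cocycles_TEC: "cocycles TEC TEC_d n = {G \<in> vcarrier (TEC n). TEC_d n G = 0}"
  unfolding cocycles_def by (subst TEC_ambient[of "Suc n"]) simp

lemma coboundaries_TEC_Suc: "coboundaries TEC TEC_d (Suc n) = TEC_d n ` vcarrier (TEC n)"
  by (simp add: coboundaries_def)

lemma TEC_d_zero: "TEC_d n 0 = 0"
  using TEC_d_scale[of 0 n 0] family.subspace_0[OF subspace_TEC] by (simp add: zero_fun_def)

lemma subspace_cocycles_TEC: "family.subspace (cocycles TEC TEC_d n)"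
  unfolding cocycles_TEC
  by (rule family.subspaceI)
    (auto simp: TEC_d_zero TEC_d_add TEC_d_scale family.subspace_0[OF subspace_TEC]
      family.subspace_add[OF subspace_TEC] family.subspace_scale[OF subspace_TEC] fun_eq_iff)

lemma subspace_coboundaries_TEC: "family.subspace (coboundaries TEC TEC_d (Suc n))"
  unfolding coboundaries_TEC_Suc
proof (rule family.subspaceI)
  show "0 \<in> TEC_d n ` vcarrier (TEC n)"
    by (rule image_eqI[of _ _ 0]) (simp_all add: TEC_d_zero family.subspace_0[OF subspace_TEC])
next
  fix F G assume "F \<in> TEC_d n ` vcarrier (TEC n)" "G \<in> TEC_d n ` vcarrier (TEC n)"
  then obtain F' G' where FG: "F' \<in> vcarrier (TEC n)" "G' \<in> vcarrier (TEC n)" "F = TEC_d n F'" "G = TEC_d n G'"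
    by blast
  show "F + G \<in> TEC_d n ` vcarrier (TEC n)"
    by (rule image_eqI[of _ _ "F' + G'"])
      (use FG in \<open>simp_all add: TEC_d_add family.subspace_add[OF subspace_TEC]\<close>)
next
  fix c F assume "F \<in> TEC_d n ` vcarrier (TEC n)"
  then obtain F' where F: "F' \<in> vcarrier (TEC n)" "F = TEC_d n F'"
    by blast
  show "(\<lambda>i t. c * F i t) \<in> TEC_d n ` vcarrier (TEC n)"
    by (rule image_eqI[of _ _ "\<lambda>i t. c * F' i t"])
      (use F in \<open>simp_all add: TEC_d_scale family.subspace_scale[OF subspace_TEC]\<close>)
qed

lemma presents_HC:
  "family.presents (cocycles TEC TEC_d (Suc n)) (coboundaries TEC TEC_d (Suc n)) (HC (Suc n))
     (\<lambda>F. (+) F ` coboundaries TEC TEC_d (Suc n))"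
  using family.presents_coset[OF subspace_cocycles_TEC[of "Suc n"] subspace_coboundaries_TEC[of n]]
  unfolding HC_def cohomology_def by (subst TEC_ambient) simp

lemma TEC_d_eq_0_iff:
  "TEC_d n G = 0 \<longleftrightarrow> TEH_d 0 (row 0 G) = 0 \<and> (\<forall>p. TEH_d 0 (row (Suc p) G) + TEH_B (row p G) = 0)"
proof
  assume "TEC_d n G = 0"
  then show "TEH_d 0 (row 0 G) = 0 \<and> (\<forall>p. TEH_d 0 (row (Suc p) G) + TEH_B (row p G) = 0)"
    using row_TEC_d_0[of n G 0] row_TEC_d_Suc[of _ n G 0] by simp
next
  assume R: "TEH_d 0 (row 0 G) = 0 \<and> (\<forall>p. TEH_d 0 (row (Suc p) G) + TEH_B (row p G) = 0)"
  show "TEC_d n G = 0"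
  proof (rule triangular_eqI[OF triangular_TEC_d triangular_zero])
    fix p
    show "row p (TEC_d n G) = row p 0"
      using R by (cases p) (simp_all add: row_TEC_d_0[of _ _ 0] row_TEC_d_Suc[of _ _ _ 0])
  qed
qed

section \<open>Cyclic cohomology in degrees one and two\<close>

lemma linear_row:
  "Vector_Spaces.linear (\<lambda>c F i t. c * F i t) (\<lambda>c F i t. c * F i t) (row p)"
  unfolding Vector_Spaces.linear_iff
  by (simp add: family.vector_space_axioms)

lemma row_TEC_high:
  assumes "G \<in> vcarrier (TEC n)" and "n \<le> 2"
  shows "n < 2 \<Longrightarrow> row (Suc p) G = 0" and "row (Suc (Suc p)) G = 0"
  using assms by (auto intro: rows_TEC_zero)

lemma cocycle_TEC_1_iff:
  "G \<in> cocycles TEC TEC_d (Suc 0) \<longleftrightarrow>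
     G \<in> vcarrier (TEC (Suc 0)) \<and> row 0 G \<in> trunc_cocycles 0"
proof (cases "G \<in> vcarrier (TEC (Suc 0))")
  case True
  have rows: "row 0 G \<in> vcarrier (TEH (Suc 0))" "row (Suc p) G = 0" for p
    using row_TEC[of G 0 "Suc 0"] row_TEC_high[OF True] True by auto
  have "TEH_d 0 (row (Suc p) G) + TEH_B (row p G) = (if p = 0 then TEH_B (row 0 G) else 0)" for p
    by (cases p) (simp_all add: rows(2))
  then show ?thesis
    using True rows(1) by (auto simp: cocycles_TEC TEC_d_eq_0_iff trunc_cocycles_def cocycles_TEH
        coboundaries_TEH_0 TEH_d_cong[of "Suc 0" 0])
qed (simp add: cocycles_TEC)

lemma coboundary_TEC_1_iff:
  assumes G: "G \<in> vcarrier (TEC (Suc 0))"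
  shows "G \<in> coboundaries TEC TEC_d (Suc 0) \<longleftrightarrow> row 0 G \<in> coboundaries TEH TEH_d (Suc 0)"
proof
  assume "G \<in> coboundaries TEC TEC_d (Suc 0)"
  then obtain E where "E \<in> vcarrier (TEC 0)" "G = TEC_d 0 E"
    unfolding coboundaries_TEC_Suc by blast
  then show "row 0 G \<in> coboundaries TEH TEH_d (Suc 0)"
    using row_TEC[of E 0 0] by (simp add: coboundaries_TEH_Suc row_TEC_d_0[of _ _ 0])
next
  assume "row 0 G \<in> coboundaries TEH TEH_d (Suc 0)"
  then obtain E where E: "E \<in> vcarrier (TEH 0)" "row 0 G = TEH_d 0 E"
    unfolding coboundaries_TEH_Suc by blast
  have "G = TEC_d 0 (of_row 0 E)"
  proof (rule triangular_eqI)
    show "triangular G"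
      using G by (simp add: TEC_iff)
    show "row p G = row p (TEC_d 0 (of_row 0 E))" for p
      using E row_TEC_high(1)[OF G] TEH_B_TEH_0[OF E(1)]
      by (cases p) (simp_all add: row_TEC_d_0[of _ _ 0] row_TEC_d_Suc[of _ _ _ 0] row_of_row)
  qed (rule triangular_TEC_d)
  then show "G \<in> coboundaries TEC TEC_d (Suc 0)"
    using of_row_TEC[OF E(1), of 0] by (simp add: coboundaries_TEC_Suc)
qed

text \<open>The first row identifies cocycles and coboundaries on both sides.\<close>

theorem HC_1_viso: "HC 1 \<simeq> H_trunc_HH 1 0"
proof -
  interpret total: subquotients_pair
    "(\<lambda>c F i t. c * F i t) :: 'k \<Rightarrow> (nat \<times> nat \<times> nat \<Rightarrow> ('a list \<Rightarrow>\<^sub>0 'k) set \<Rightarrow> 'k) \<Rightarrow> _"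
    "(\<lambda>c F i t. c * F i t) :: 'k \<Rightarrow> (nat \<times> nat \<Rightarrow> ('a list \<Rightarrow>\<^sub>0 'k) set \<Rightarrow> 'k) \<Rightarrow> _" ..
  obtain \<pi> where \<pi>: "family.presents (trunc_cocycles 0)
      (cocycles TEH TEH_d (Suc 0) \<inter> coboundaries TEH TEH_d (Suc 0)) (H_trunc_HH (Suc 0) 0) \<pi>"
    by (rule presents_H_trunc_0[of 0]) simp
  have "family.presents (cocycles TEC TEC_d (Suc 0)) (coboundaries TEC TEC_d (Suc 0))
      (H_trunc_HH (Suc 0) 0) (\<lambda>G. \<pi> (row 0 G))"
  proof (rule total.presents_pullback[OF \<pi> linear_row subspace_cocycles_TEC])
    show "row 0 ` cocycles TEC TEC_d (Suc 0) = trunc_cocycles 0"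
    proof (intro equalityI subsetI)
      fix F assume F: "F \<in> trunc_cocycles 0"
      then have "F \<in> vcarrier (TEH (Suc 0))"
        by (simp add: trunc_cocycles_def cocycles_TEH)
      then have "of_row 0 F \<in> cocycles TEC TEC_d (Suc 0)"
        using F of_row_TEC[of F "Suc 0" 0] by (simp add: cocycle_TEC_1_iff row_of_row)
      then show "F \<in> row 0 ` cocycles TEC TEC_d (Suc 0)"
        by (rule rev_image_eqI) (simp add: row_of_row)
    qed (auto simp: cocycle_TEC_1_iff)
    show "row 0 G \<in> cocycles TEH TEH_d (Suc 0) \<inter> coboundaries TEH TEH_d (Suc 0) \<longleftrightarrow>
        G \<in> coboundaries TEC TEC_d (Suc 0)" if "G \<in> cocycles TEC TEC_d (Suc 0)" for G
      using that by (auto simp: cocycle_TEC_1_iff coboundary_TEC_1_iff trunc_cocycles_def)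
  qed
  from family.viso_if_presents[OF presents_HC this] show ?thesis
    by simp
qed

lemma cocycle_TEC_2D:
  assumes G: "G \<in> cocycles TEC TEC_d 2"
  shows "row 0 G \<in> vcarrier (TEH 2)" and "row (Suc 0) G \<in> vcarrier (TEH 0)"
    and "TEH_d 0 (row 0 G) = 0" and "TEH_d 0 (row (Suc 0) G) + TEH_B (row 0 G) = 0"
  using G row_TEC[of G 0 2] row_TEC[of G "Suc 0" 0]
  by (auto simp: cocycles_TEC TEC_d_eq_0_iff numeral_2_eq_2)

lemma cocycle_TEC_2I:
  assumes F: "F \<in> vcarrier (TEH 2)" and g: "g \<in> vcarrier (TEH 0)"
    and "TEH_d 0 F = 0" and "TEH_d 0 g + TEH_B F = 0"
  shows "of_row 0 F + of_row (Suc 0) g \<in> cocycles TEC TEC_d 2"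
proof -
  have "of_row 0 F + of_row (Suc 0) g \<in> vcarrier (TEC 2)"
    using family.subspace_add[OF subspace_TEC] of_row_TEC[OF F, of 0] of_row_TEC[OF g, of "Suc 0"]
    by (simp add: numeral_2_eq_2)
  moreover have "TEH_d 0 (row (Suc p) (of_row 0 F + of_row (Suc 0) g)) +
      TEH_B (row p (of_row 0 F + of_row (Suc 0) g)) = 0" for p
    using assms(4) TEH_B_TEH_0[OF g] by (cases p) (simp_all add: row_of_row)
  ultimately show ?thesis
    using assms(3) by (simp add: cocycles_TEC TEC_d_eq_0_iff row_of_row)
qed

text \<open>The second row of an element of degree \<open>1\<close> vanishes, so that of its differential is \<open>B\<close> of the
  first.\<close>

lemma coboundary_TEC_2_iff:
  assumes G: "G \<in> cocycles TEC TEC_d 2"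
  shows "G \<in> coboundaries TEC TEC_d 2 \<longleftrightarrow>
    (\<exists>E\<in>vcarrier (TEH (Suc 0)). row 0 G = TEH_d 0 E \<and> row (Suc 0) G = TEH_B E)"
proof
  assume "G \<in> coboundaries TEC TEC_d 2"
  then obtain E where E: "E \<in> vcarrier (TEC (Suc 0))" "G = TEC_d (Suc 0) E"
    unfolding numeral_2_eq_2 coboundaries_TEC_Suc by blast
  show "\<exists>E\<in>vcarrier (TEH (Suc 0)). row 0 G = TEH_d 0 E \<and> row (Suc 0) G = TEH_B E"
    using E row_TEC[of E 0 "Suc 0"] row_TEC_high(1)[OF E(1)]
    by (intro bexI[of _ "row 0 E"]) (simp_all add: row_TEC_d_0[of _ _ 0] row_TEC_d_Suc[of _ _ _ 0])
next
  assume "\<exists>E\<in>vcarrier (TEH (Suc 0)). row 0 G = TEH_d 0 E \<and> row (Suc 0) G = TEH_B E"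
  then obtain E where E: "E \<in> vcarrier (TEH (Suc 0))" "row 0 G = TEH_d 0 E" "row (Suc 0) G = TEH_B E"
    by blast
  have GT: "G \<in> vcarrier (TEC 2)"
    using G by (simp add: cocycles_TEC)
  have "G = TEC_d (Suc 0) (of_row 0 E)"
  proof (rule triangular_eqI)
    show "triangular G"
      using GT by (simp add: TEC_iff)
    show "row p G = row p (TEC_d (Suc 0) (of_row 0 E))" for p
    proof (cases p)
      case 0
      then show ?thesis using E by (simp add: row_TEC_d_0[of _ _ 0] row_of_row)
    next
      case (Suc p')
      then show ?thesis
        using E row_TEC_high(2)[OF GT]
        by (cases p') (simp_all add: row_TEC_d_Suc[of _ _ _ 0] row_of_row)
    qed
  qed (rule triangular_TEC_d)
  then show "G \<in> coboundaries TEC TEC_d 2"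
    using of_row_TEC[OF E(1), of 0] by (simp add: coboundaries_TEC_Suc numeral_2_eq_2)
qed

text \<open>The two summands are read off from \<open>F\<close> and from \<open>g - g'\<close>, where \<open>(F, g') = \<rho> F\<close> is the
  chosen cocycle with first row \<open>F\<close>. The difference of the two cocycles has first row \<open>0\<close>, which
  makes \<open>g - g'\<close> a cocycle of degree \<open>0\<close>.\<close>

theorem HC_2_viso: "HC 2 \<simeq> H_trunc_HH 2 0 \<oplus>\<^sub>v H_trunc_HH 1 1"
proof -
  interpret total: subquotients_pair
    "(\<lambda>c F i t. c * F i t) :: 'k \<Rightarrow> (nat \<times> nat \<times> nat \<Rightarrow> ('a list \<Rightarrow>\<^sub>0 'k) set \<Rightarrow> 'k) \<Rightarrow> _"
    "(\<lambda>c F i t. c * F i t) :: 'k \<Rightarrow> (nat \<times> nat \<Rightarrow> ('a list \<Rightarrow>\<^sub>0 'k) set \<Rightarrow> 'k) \<Rightarrow> _" ..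
  let ?Z = "cocycles TEC TEC_d 2" and ?U = "coboundaries TEC TEC_d 2"
  let ?ZH = "cocycles TEH TEH_d" and ?UH = "coboundaries TEH TEH_d"
  have Z: "family.subspace ?Z" and U: "family.subspace ?U"
    using subspace_cocycles_TEC[of 2] subspace_coboundaries_TEC[of "Suc 0"] by (simp_all add: numeral_2_eq_2)
  have K: "family.subspace (?Z \<inter> ?U)"
    by (rule family.subspace_inter[OF Z U])
  obtain \<rho> where \<rho>: "Vector_Spaces.linear (\<lambda>c F i t. c * F i t) (\<lambda>c F i t. c * F i t) \<rho>"
    and \<rho>_Z: "\<And>F. F \<in> row 0 ` ?Z \<Longrightarrow> \<rho> F \<in> ?Z \<and> row 0 (\<rho> F) = F"
    and \<rho>_K: "\<And>F. F \<in> row 0 ` (?Z \<inter> ?U) \<Longrightarrow> \<rho> F \<in> ?Z \<inter> ?U"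
    using total.section_adapted_to_subspace[OF linear_row K Z] by blast
  define rest where "rest G = G - \<rho> (row 0 G)" for G
  have rest: "rest G \<in> ?Z" "row 0 (rest G) = 0" if "G \<in> ?Z" for G
    using that \<rho>_Z[of "row 0 G"] family.subspace_diff[OF Z] by (auto simp: rest_def)
  have linear_rest: "Vector_Spaces.linear (\<lambda>c F i t. c * F i t) (\<lambda>c F i t. c * F i t) (\<lambda>G. row (Suc 0) (rest G))"
  proof -
    have "\<rho> (F + G) = \<rho> F + \<rho> G" "\<rho> (\<lambda>i t. c * F i t) = (\<lambda>i t. c * \<rho> F i t)" for F G c
      using \<rho> unfolding Vector_Spaces.linear_iff by auto
    then show ?thesis
      unfolding Vector_Spaces.linear_iff rest_def
      by (simp add: family.vector_space_axioms) (simp add: fun_eq_iff algebra_simps)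
  qed
  have lift: "a \<in> row 0 ` ?Z" if a: "a \<in> trunc_cocycles (Suc 0)" for a
  proof -
    have a': "a \<in> vcarrier (TEH 2)" "TEH_d 0 a = 0"
      using a by (simp_all add: trunc_cocycles_def cocycles_TEH numeral_2_eq_2 TEH_d_cong[of 0 "Suc (Suc 0)"])
    obtain g where g: "g \<in> vcarrier (TEH 0)" "TEH_B a = TEH_d 0 g"
      using a by (auto simp: trunc_cocycles_def coboundaries_TEH_Suc)
    have "of_row 0 a + of_row (Suc 0) (- g) \<in> ?Z"
      using a' g family.subspace_neg[OF subspace_TEH g(1)]
      by (intro cocycle_TEC_2I) (simp_all add: TEH_d_uminus[OF TEH_families[OF g(1)]])
    then show ?thesis
      by (rule rev_image_eqI) (simp add: row_of_row)
  qed
  have row_0: "row 0 G \<in> trunc_cocycles (Suc 0)" if G: "G \<in> ?Z" for G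
  proof -
    note D = cocycle_TEC_2D[OF G]
    have "TEH_B (row 0 G) = - TEH_d 0 (row (Suc 0) G)"
      using D(4) by (simp add: eq_neg_iff_add_eq_0 add.commute)
    also have "\<dots> = TEH_d 0 (- row (Suc 0) G)"
      by (rule TEH_d_uminus[OF TEH_families[OF D(2)], symmetric])
    finally show ?thesis
      using D(1,3) family.subspace_neg[OF subspace_TEH D(2)]
      by (simp add: trunc_cocycles_def cocycles_TEH coboundaries_TEH_Suc numeral_2_eq_2
          TEH_d_cong[of "Suc (Suc 0)" 0])
  qed
  have row_1: "row (Suc 0) (rest G) \<in> ?ZH 0" if G: "G \<in> ?Z" for G
    using cocycle_TEC_2D(2,4)[OF rest(1)[OF G]] rest(2)[OF G] by (simp add: cocycles_TEH)
  have surj: "(\<lambda>G. (row 0 G, row (Suc 0) (rest G))) ` ?Z = trunc_cocycles (Suc 0) \<times> ?ZH 0"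
  proof (intro equalityI subsetI)
    fix x assume "x \<in> trunc_cocycles (Suc 0) \<times> ?ZH 0"
    then obtain a b where ab: "x = (a, b)" "a \<in> trunc_cocycles (Suc 0)" "b \<in> ?ZH 0"
      by blast
    have b: "of_row (Suc 0) b \<in> ?Z"
      using cocycle_TEC_2I[of 0 b] ab(3) family.subspace_0[OF subspace_TEH]
      by (simp add: cocycles_TEH of_row_zero)
    have a: "\<rho> a \<in> ?Z" "row 0 (\<rho> a) = a"
      using \<rho>_Z[OF lift[OF ab(2)]] by auto
    show "x \<in> (\<lambda>G. (row 0 G, row (Suc 0) (rest G))) ` ?Z"
      by (rule image_eqI[of _ _ "\<rho> a + of_row (Suc 0) b"])
        (use a b family.subspace_add[OF Z] in \<open>simp_all add: ab(1) rest_def row_of_row\<close>)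
  qed (use row_0 row_1 in auto)
  have ker: "row 0 G \<in> ?ZH (Suc (Suc 0)) \<inter> ?UH (Suc (Suc 0)) \<and> row (Suc 0) (rest G) \<in> TEH_B ` ?ZH (Suc 0)
      \<longleftrightarrow> G \<in> ?U" if G: "G \<in> ?Z" for G
  proof
    assume L: "row 0 G \<in> ?ZH (Suc (Suc 0)) \<inter> ?UH (Suc (Suc 0)) \<and> row (Suc 0) (rest G) \<in> TEH_B ` ?ZH (Suc 0)"
    then obtain E where E: "E \<in> vcarrier (TEH (Suc 0))" "row 0 G = TEH_d 0 E"
      by (auto simp: coboundaries_TEH_Suc TEH_d_cong[of "Suc 0" 0])
    \<comment> \<open>A coboundary with the same first row; it brings \<open>\<rho> (row 0 G)\<close> into the coboundaries.\<close>
    define G1 where "G1 = of_row 0 (TEH_d 0 E) + of_row (Suc 0) (TEH_B E)"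
    have G1: "G1 \<in> ?Z"
      unfolding G1_def
      by (rule cocycle_TEC_2I) (use cocycle_TEC_2D(1,3)[OF G] E TEH_B_TEH TEH_B_d_1[OF E(1), of 0] in auto)
    moreover have "G1 \<in> ?U"
      unfolding coboundary_TEC_2_iff[OF G1] using E(1) by (auto simp: G1_def row_of_row)
    moreover have "row 0 G1 = row 0 G"
      by (simp add: G1_def row_of_row E(2))
    ultimately have "\<rho> (row 0 G) \<in> ?U"
      using \<rho>_K[of "row 0 G"] by (metis IntD2 IntI image_eqI)
    moreover have "rest G \<in> ?U"
      unfolding coboundary_TEC_2_iff[OF rest(1)[OF G]]
      using L rest(2)[OF G] by (auto simp: cocycles_TEH TEH_d_cong[of "Suc 0" 0])
    ultimately show "G \<in> ?U"
      using family.subspace_add[OF U, of "rest G" "\<rho> (row 0 G)"] by (simp add: rest_def)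
  next
    assume GU: "G \<in> ?U"
    then have "\<rho> (row 0 G) \<in> ?U"
      using \<rho>_K[of "row 0 G"] G by blast
    then have "rest G \<in> ?U"
      using family.subspace_diff[OF U GU] by (simp add: rest_def)
    then obtain E where "E \<in> vcarrier (TEH (Suc 0))" "0 = TEH_d 0 E" "row (Suc 0) (rest G) = TEH_B E"
      unfolding coboundary_TEC_2_iff[OF rest(1)[OF G]] rest(2)[OF G] by blast
    then have "row (Suc 0) (rest G) \<in> TEH_B ` ?ZH (Suc 0)"
      by (auto simp: cocycles_TEH TEH_d_cong[of "Suc 0" 0])
    moreover have "row 0 G \<in> ?UH (Suc (Suc 0))"
      using GU unfolding coboundary_TEC_2_iff[OF G] by (auto simp: coboundaries_TEH_Suc TEH_d_cong[of "Suc 0" 0])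
    ultimately show "row 0 G \<in> ?ZH (Suc (Suc 0)) \<inter> ?UH (Suc (Suc 0)) \<and> row (Suc 0) (rest G) \<in> TEH_B ` ?ZH (Suc 0)"
      using row_0[OF G] by (simp add: trunc_cocycles_def)
  qed
  obtain \<pi>1 where \<pi>1: "family.presents (trunc_cocycles (Suc 0))
      (?ZH (Suc (Suc 0)) \<inter> ?UH (Suc (Suc 0))) (H_trunc_HH (Suc (Suc 0)) 0) \<pi>1"
    by (rule presents_H_trunc_0[of "Suc 0"]) simp
  obtain \<pi>2 where \<pi>2: "family.presents (?ZH 0) (TEH_B ` ?ZH (Suc 0)) (H_trunc_HH (Suc 0) (Suc 0)) \<pi>2"
    by (rule presents_H_trunc_1_1)
  note total.presents_vsum[OF \<pi>1 \<pi>2 linear_row linear_rest Z surj ker]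
  from family.viso_if_presents[OF presents_HC[of "Suc 0", folded numeral_2_eq_2] this]
  show ?thesis
    by (simp add: numeral_2_eq_2)
qed

end

theorem proposition4p12:
  fixes scale :: "'k::field_char_0 \<Rightarrow> 'a::{ring, monoid_mult} \<Rightarrow> 'a"
    and A :: "nat \<Rightarrow> 'a set"
    and \<phi> :: "'a \<Rightarrow> 'a"
  assumes "dga scale A \<phi>"
  shows "dga.HC scale A \<phi> 1 \<simeq> dga.H_trunc_HH scale A \<phi> 1 0 \<and>
         dga.HC scale A \<phi> 2 \<simeq> dga.H_trunc_HH scale A \<phi> 2 0 \<oplus>\<^sub>v dga.H_trunc_HH scale A \<phi> 1 1"
  using dga.HC_1_viso[OF assms] dga.HC_2_viso[OF assms] by blast

end
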